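(* Let $M>1$, let $\gamma\in\mathcal B(M)$, and let $p,q\in\mathbb R$ satisfy $p+q\ge 0$. Then $$C(\gamma^p,\gamma^q)\le\left(\frac{\frac{1}{2\pi}\int_0^{2\pi}\gamma^{(p-q)/2}\,d\theta}{\frac{4}{\pi}\arctan\left(M^{-(p+q)/4}\right)}\right)^2. \qquad ( * )$$ (i) Suppose $p+q>0$. Then equality holds in $( * )$ if and only if there is $\varphi\in\mathbb R$ such that $\gamma(\theta)=\bar\gamma_{p,q}(\theta+\varphi)$ (for a.e. $\theta$). Furthermore, for every $\varphi\in\mathbb R$, setting $a(\theta)=\bar\gamma_{p,q}^{\,p}(\theta+\varphi)$ and $b(\theta)=\bar\gamma_{p,q}^{\,q}(\theta+\varphi)$, a $2\pi$-periodic function $w\in H^1_{\mathrm{loc}}(\mathbb R)$, not identically zero, with $\int_0^{2\pi}aw\,d\theta=0$ satisfies the equality $\int_0^{2\pi}a w^2\,d\theta=C(a,b)\int_0^{2\pi}b w'^2\,d\theta$ if and only if $w(\theta)=K\,\bar w_{p,q}(\theta+\varphi)$ for some constant $K\ne 0$. (ii) Suppose $p+q=0$. Then $( * )$ is an equality for every $\gamma\in\mathcal B(M)$. Moreover, with $a=\gamma^p$ and $b=\gamma^{-p}$, a $2\pi$-periodic function $w\in H^1_{\mathrm{loc}}(\mathbb R)$, not identically zero, with $\int_0^{2\pi}aw\,d\theta=0$ satisfies $\int_0^{2\pi}a w^2\,d\theta=C(a,b)\int_0^{2\pi}b w'^2\,d\theta$ if and only if $$w(\theta)=K\cos\left(\frac{2\pi}{\int_0^{2\pi}\gamma^p}\int_0^\theta\gamma^p+\varphi\right)$$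 for some $K\ne0$ and $\varphi\in\mathbb R$.
   Context: For a measurable function $a$, $\inf a$ and $\sup a$ denote the essential infimum and essential supremum. $\mathcal B$ is the set of $2\pi$-periodic $a\in L^\infty(\mathbb R)$ with $\inf a>0$. For $L>1$, $\mathcal B(L)$ is the set of $2\pi$-periodic real functions $a\in L^\infty$ with $\inf a=1$ and $\sup a=L$. For $a,b\in\mathcal B$, $C(a,b)>0$ denotes the best (smallest) constant such that $$\int_0^{2\pi}a\,w^2\,d\theta\le C(a,b)\int_0^{2\pi}b\,w'^2\,d\theta$$ for every $2\pi$-periodic $w\in H^1_{\mathrm{loc}}(\mathbb R)$ satisfying $\int_0^{2\pi}a w\,d\theta=0$. For $M>1$ and $p,q\in\mathbb R$ with $p+q>0$, put $$c_{p,q}=\frac{2}{1+M^{-(p-q)/2}},\qquad \mu=\left(\frac{4}{\pi}\arctan M^{-(p+q)/4}\right)^2.$$ $\bar\gamma_{p,q}$ is the $2\pi$-periodic function given on $[0,2\pi)$ by $$\bar\gamma_{p,q}(\theta)=\begin{cases}1,& 0\le\theta<c_{p,q}\frac{\pi}{2}\ \text{ or }\ \pi\le\theta<\pi+c_{p,q}\frac{\pi}{2},\\ M,& c_{p,q}\frac{\pi}{2}\le\theta<\pi\ \text{ or }\ \pi+c_{p,q}\frac{\pi}{2}\le\theta<2\pi,\end{cases}$$ and $\bar w_{p,q}$ is the $2\pi$-periodic function given on $[0,2\pi)$ by $$\bar w_{p,q}(\theta)=\begin{cases} \sin\left[\sqrt\mu\left(c_{p,q}^{-1}\theta-\frac{\pi}{4}\right)\right],&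 0\le\theta<c_{p,q}\frac{\pi}{2},\\ M^{-(p+q)/4}\cos\left[\sqrt\mu\left(\frac{\pi}{2}+c_{p,q}^{-1}M^{(p-q)/2}(\theta-c_{p,q}\frac{\pi}{2})-\frac{3\pi}{4}\right)\right],& c_{p,q}\frac{\pi}{2}\le\theta<\pi,\\ -\sin\left[\sqrt\mu\left(\pi+c_{p,q}^{-1}(\theta-\pi)-\frac{5\pi}{4}\right)\right],& \pi\le\theta<\pi+c_{p,q}\frac{\pi}{2},\\ -M^{-(p+q)/4}\cos\left[\sqrt\mu\left(\frac{3\pi}{2}+c_{p,q}^{-1}M^{(p-q)/2}(\theta-\pi-c_{p,q}\frac{\pi}{2})-\frac{7\pi}{4}\right)\right],& \pi+c_{p,q}\frac{\pi}{2}\le\theta<2\pi. \end{cases}$$ *)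

theory Defs
  imports
    "HOL-Analysis.Analysis"
    "HOL-Probability.Essential_Supremum"
    "HOL-Library.Real_Mod"
begin

(* Elements of L^\<infinity> and H^1_loc are classes of functions modulo equality almost everywhere.
   Here they are represented by arbitrary Lebesgue measurable members of the class, so
   periodicity and all equalities between such functions are understood almost everywhere. *)

definition ae_periodic :: "(real \<Rightarrow> real) \<Rightarrow> bool" where
  "ae_periodic f \<longleftrightarrow> (AE x in lebesgue. f (x + 2 * pi) = f x)"

definition essinf :: "'a measure \<Rightarrow> ('a \<Rightarrow> ereal) \<Rightarrow> ereal" where
  "essinf M f = - esssup M (\<lambda>x. - f x)"

(* Essential boundedness follows from the two conditions on the essential bounds. *)
definition coeff_class :: "real \<Rightarrow> (real \<Rightarrow> real) set" where
  "coeff_class L = {a \<in> borel_measurable lebesgue. ae_periodic a \<and>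
     essinf lebesgue (\<lambda>x. ereal (a x)) = 1 \<and> esssup lebesgue (\<lambda>x. ereal (a x)) = ereal L}"

definition L2_loc :: "(real \<Rightarrow> real) set" where
  "L2_loc = {f \<in> borel_measurable lebesgue.
     \<forall>K. compact K \<longrightarrow> set_integrable lebesgue K (\<lambda>x. (f x)\<^sup>2)}"

(* Weak derivative on the real line, tested against compactly supported C^1 functions. *)
definition is_weak_deriv :: "(real \<Rightarrow> real) \<Rightarrow> (real \<Rightarrow> real) \<Rightarrow> bool" where
  "is_weak_deriv w w' \<longleftrightarrow>
     (\<forall>\<phi>::real \<Rightarrow> real. \<phi> C1_differentiable_on UNIV \<and> compact (closure {x. \<phi> x \<noteq> 0}) \<longrightarrow>
        (LINT x|lebesgue. w x * deriv \<phi> x) = - (LINT x|lebesgue. w' x * \<phi> x))"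

definition H1_loc :: "(real \<Rightarrow> real) set" where
  "H1_loc = {w \<in> L2_loc. \<exists>w' \<in> L2_loc. is_weak_deriv w w'}"

(* For w in H1_loc the weak derivative is unique up to equality almost everywhere, so
   integrals involving it do not depend on the choice made here. *)
definition weak_deriv :: "(real \<Rightarrow> real) \<Rightarrow> (real \<Rightarrow> real)" where
  "weak_deriv w = (SOME w'. w' \<in> L2_loc \<and> is_weak_deriv w w')"

definition admissible :: "(real \<Rightarrow> real) \<Rightarrow> (real \<Rightarrow> real) set" where
  "admissible a = {w \<in> H1_loc. ae_periodic w \<and> (LINT x:{0..2*pi}|lebesgue. a x * w x) = 0}"

(* C(a,b), for a and b measurable, periodic, and essentially bounded above and away from 0. *)
definition wirtinger_const :: "(real \<Rightarrow> real) \<Rightarrow> (real \<Rightarrow> real) \<Rightarrow> real" where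
  "wirtinger_const a b = Inf {C. 0 < C \<and> (\<forall>w \<in> admissible a.
     (LINT x:{0..2*pi}|lebesgue. a x * (w x)\<^sup>2)
       \<le> C * (LINT x:{0..2*pi}|lebesgue. b x * (weak_deriv w x)\<^sup>2))}"

definition extremal :: "(real \<Rightarrow> real) \<Rightarrow> (real \<Rightarrow> real) \<Rightarrow> (real \<Rightarrow> real) \<Rightarrow> bool" where
  "extremal a b w \<longleftrightarrow> w \<in> admissible a \<and> \<not> (AE x in lebesgue. w x = 0) \<and>
     (LINT x:{0..2*pi}|lebesgue. a x * (w x)\<^sup>2)
       = wirtinger_const a b * (LINT x:{0..2*pi}|lebesgue. b x * (weak_deriv w x)\<^sup>2)"

definition c_const :: "real \<Rightarrow> real \<Rightarrow> real \<Rightarrow> real" where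
  "c_const M p q = 2 / (1 + M powr (- (p - q) / 2))"

definition mu_const :: "real \<Rightarrow> real \<Rightarrow> real \<Rightarrow> real" where
  "mu_const M p q = (4 / pi * arctan (M powr (- (p + q) / 4)))\<^sup>2"

definition wirtinger_bound :: "real \<Rightarrow> real \<Rightarrow> real \<Rightarrow> (real \<Rightarrow> real) \<Rightarrow> real" where
  "wirtinger_bound M p q \<gamma> =
     ((1 / (2 * pi) * (LINT t:{0..2*pi}|lebesgue. \<gamma> t powr ((p - q) / 2)))
        / (4 / pi * arctan (M powr (- (p + q) / 4))))\<^sup>2"

definition gamma_bar :: "real \<Rightarrow> real \<Rightarrow> real \<Rightarrow> real \<Rightarrow> real" where
  "gamma_bar M p q \<theta> = (let t = \<theta> rmod (2 * pi); c = c_const M p q in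
     if t < c * (pi / 2) \<or> pi \<le> t \<and> t < pi + c * (pi / 2) then 1 else M)"

definition w_bar :: "real \<Rightarrow> real \<Rightarrow> real \<Rightarrow> real \<Rightarrow> real" where
  "w_bar M p q \<theta> =
     (let t = \<theta> rmod (2 * pi); c = c_const M p q; s = sqrt (mu_const M p q);
          m = M powr (- (p + q) / 4); r = M powr ((p - q) / 2)
      in if t < c * (pi / 2) then sin (s * (t / c - pi / 4))
         else if t < pi then m * cos (s * (pi / 2 + r / c * (t - c * (pi / 2)) - 3 * pi / 4))
         else if t < pi + c * (pi / 2) then - sin (s * (pi + (t - pi) / c - 5 * pi / 4))
         else - m * cos (s * (3 * pi / 2 + r / c * (t - pi - c * (pi / 2)) - 7 * pi / 4)))"

end

theory Submission
  imports Defs "HOL-Complex_Analysis.Great_Picard"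
begin

text \<open>
  One change of variable, one choice of a shift and one explicit Riccati function give the inequality and
  its cases of equality.

  Let \<open>a = \<gamma>^p\<close> and \<open>b = \<gamma>^q\<close>, and take a constant multiple of \<open>\<integral>sqrt (a / b)\<close> as new variable. Then both
  quadratic forms have the same weight \<open>A = sqrt (a b) = \<gamma>^((p+q)/2)\<close>, with values between 1 and \<open>s\<^sup>2 = M^((p+q)/2)\<close>.
  If the multiple is chosen such that the new period is \<open>8 \<alpha>\<close>, where \<open>\<alpha> = arctan (1 / s)\<close>, then the asserted
  bound becomes \<open>\<integral>A W\<^sup>2 \<le> \<integral>A W'\<^sup>2\<close> for all periodic \<open>W\<close> with \<open>\<integral>A W = 0\<close> (\<open>periodic_inequality\<close>).

  By the intermediate value theorem, \<open>W x = W (x + 4 \<alpha>) = c\<close> for some \<open>x\<close>. Since \<open>\<integral>A W = 0\<close>, replacing \<open>W\<close> by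
  \<open>W - c\<close> can only increase \<open>\<integral>A W\<^sup>2\<close>. So it suffices to prove the inequality on an interval of length \<open>4 \<alpha>\<close> for
  functions that vanish at both ends. Let \<open>B\<close> be the weight that switches between 1 and \<open>s\<^sup>2\<close> at distances \<open>2 \<alpha>\<close>,
  starting in the middle of a stretch with value 1, and let \<open>U\<close> be the solution of \<open>(B U')' = - B U\<close> that
  starts at 0; it is positive until \<open>4 \<alpha>\<close>. The function \<open>R = B U' / U\<close> satisfies \<open>R' = - (B + R\<^sup>2 / B)\<close>, and
  \<open>B\<close> is at every point the value \<open>A\<close> in \<open>[1, s\<^sup>2]\<close> for which \<open>A + R\<^sup>2 / A\<close> is largest (\<open>riccati_slack\<close>). So
  one and the same \<open>R\<close> is a supersolution of the Riccati equation of every weight \<open>A\<close>, and \<open>A W'\<^sup>2 - A W\<^sup>2\<close> is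
  \<open>(R W\<^sup>2)'\<close> plus two nonnegative terms (\<open>dirichlet_excess\<close>).

  In the case of equality \<open>c = 0\<close> and both terms vanish. Then \<open>W\<close> is a multiple of \<open>U\<close> on each half, and \<open>A\<close> is
  \<open>B\<close> where the multiple is not 0 (\<open>dirichlet_equality\<close>); the condition \<open>\<integral>A W = 0\<close> joins the halves
  (\<open>periodic_equality\<close>). A best constant equal to the bound need not be attained a priori, but a minimising
  sequence converges to a case of equality (\<open>minimiser_exists\<close>). Hence the best constant equals the bound if and
  only if \<open>A\<close> is a translate of \<open>B\<close>. In the original variable, translates of \<open>B\<close> and \<open>U\<close> are translates of
  \<open>gamma_bar\<close>, as far as the coefficient is determined by the weight, and of \<open>w_bar\<close> (\<open>bar_formulas\<close>). If
  \<open>p + q = 0\<close>, then \<open>s = 1\<close>, every weight is constant, and \<open>U\<close> is the sine.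

  Elements of \<open>H1_loc\<close> and their weak derivatives enter through \<open>H1_loc_iff_sobolev_pair\<close>: up to null sets they
  are the primitives of locally square integrable functions, and all the calculus is done with primitives.
\<close>


section \<open>Primitives of locally integrable functions\<close>

text \<open>Local absolute continuity in integral form. It is relative to a set \<open>S\<close> because the Riccati
  function used below is a primitive only between two zeros of the extremal profile.\<close>
definition primitive_on :: "real set \<Rightarrow> (real \<Rightarrow> real) \<Rightarrow> (real \<Rightarrow> real) \<Rightarrow> bool" where
  "primitive_on S F f \<longleftrightarrow> (\<forall>x\<in>S. \<forall>y\<in>S. x \<le> y \<longrightarrow>
     set_integrable lborel {x..y} f \<and> (LINT t:{x..y}|lborel. f t) = F y - F x)"

lemma primitive_onD:
  assumes "primitive_on S F f" "x \<in> S" "y \<in> S" "x \<le> y"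
  shows "set_integrable lborel {x..y} f" "(LINT t:{x..y}|lborel. f t) = F y - F x"
  using assms by (auto simp: primitive_on_def)

lemma primitive_on_subset: "primitive_on S F f \<Longrightarrow> T \<subseteq> S \<Longrightarrow> primitive_on T F f"
  by (auto simp: primitive_on_def)

lemma LINT_Icc_split:
  fixes f :: "real \<Rightarrow> real"
  assumes "set_integrable lborel {x..z} f" "x \<le> y" "y \<le> z"
  shows "(LINT t:{x..z}|lborel. f t) = (LINT t:{x..y}|lborel. f t) + (LINT t:{y..z}|lborel. f t)"
proof -
  have "set_integrable lborel {x..y} f" "set_integrable lborel {y..z} f"
    using assms by (auto intro: set_integrable_subset)
  then show ?thesis
    using assms Henstock_Kurzweil_Integration.integral_combine[OF assms(2,3) set_borel_integral_eq_integral(1)[OF assms(1)]]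
    by (simp add: set_borel_integral_eq_integral(2))
qed

lemma LINT_Icc_mono_set:
  fixes f :: "real \<Rightarrow> real"
  assumes "set_integrable lborel B f" "A \<subseteq> B" "A \<in> sets borel" "\<And>t. t \<in> B \<Longrightarrow> 0 \<le> f t"
  shows "(LINT t:A|lborel. f t) \<le> (LINT t:B|lborel. f t)"
proof -
  have "set_integrable lborel A f" using assms by (auto intro: set_integrable_subset)
  then show ?thesis using assms unfolding set_lebesgue_integral_def set_integrable_def
    by (intro integral_mono) (auto simp: indicator_def)
qed

text \<open>The bound \<open>C\<close> is only asked for on \<open>S\<close>, since the functions of interest are unbounded on the line.\<close>
lemma set_integrable_mult_bounded:
  fixes f g :: "'a \<Rightarrow> real"
  assumes "set_integrable M S f" "set_borel_measurable M S g" "\<And>x. x \<in> S \<Longrightarrow> \<bar>g x\<bar> \<le> C"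
  shows "set_integrable M S (\<lambda>x. f x * g x)"
proof -
  have "integrable M (\<lambda>x. C * (indicator S x *\<^sub>R f x))"
    using assms(1) unfolding set_integrable_def by simp
  then have "integrable M (\<lambda>x. (indicator S x *\<^sub>R f x) * (indicator S x *\<^sub>R g x))"
  proof (rule Bochner_Integration.integrable_bound)
    show "(\<lambda>x. (indicator S x *\<^sub>R f x) * (indicator S x *\<^sub>R g x)) \<in> borel_measurable M"
      using assms(1,2) unfolding set_integrable_def set_borel_measurable_def
      by (auto intro!: borel_measurable_times)
    show "AE x in M. norm (indicator S x *\<^sub>R f x * indicator S x *\<^sub>R g x) \<le> norm (C * indicator S x *\<^sub>R f x)"
    proof (rule AE_I2)
      fix x
      have "\<bar>f x\<bar> * \<bar>g x\<bar> \<le> \<bar>C\<bar> * \<bar>f x\<bar>" if "x \<in> S"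
        using mult_left_mono[of "\<bar>g x\<bar>" "\<bar>C\<bar>" "\<bar>f x\<bar>"] assms(3)[OF that] by (simp add: mult.commute)
      then show "norm (indicator S x *\<^sub>R f x * indicator S x *\<^sub>R g x) \<le> norm (C * indicator S x *\<^sub>R f x)"
        by (auto simp: indicator_def abs_mult)
    qed
  qed
  moreover have "(\<lambda>x. (indicator S x *\<^sub>R f x) * (indicator S x *\<^sub>R g x)) = (\<lambda>x. indicator S x *\<^sub>R (f x * g x))"
    by (auto simp: indicator_def)
  ultimately show ?thesis unfolding set_integrable_def by simp
qed

lemma set_integrable_Icc_bounded:
  fixes f :: "real \<Rightarrow> real"
  assumes "set_borel_measurable lborel {x..y} f" "\<And>t. t \<in> {x..y} \<Longrightarrow> \<bar>f t\<bar> \<le> C"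
  shows "set_integrable lborel {x..y} f"
proof -
  have "set_integrable lborel {x..y} (\<lambda>_. 1::real)"
    by (auto simp: set_integrable_def emeasure_lborel_Icc_eq intro!: integrable_real_indicator)
  from set_integrable_mult_bounded[OF this assms] show ?thesis by simp
qed

lemma set_borel_measurable_continuous_Icc:
  fixes f :: "real \<Rightarrow> real"
  shows "continuous_on {x..y} f \<Longrightarrow> set_borel_measurable lborel {x..y} f"
  using set_measurable_continuous_on[of "{x..y}" f] by (simp add: set_borel_measurable_def)

lemma continuous_on_Icc_bounded:
  fixes f :: "real \<Rightarrow> real"
  assumes "continuous_on {x..y} f"
  obtains C where "\<And>t. t \<in> {x..y} \<Longrightarrow> \<bar>f t\<bar> \<le> C"
proof -
  have "bounded (f ` {x..y})" using assms by (simp add: compact_continuous_image compact_imp_bounded)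
  then obtain C where "\<forall>z\<in>f ` {x..y}. norm z \<le> C" by (auto simp: bounded_iff)
  then show ?thesis using that[of C] by auto
qed

lemma set_integrable_mult_continuous:
  fixes f g :: "real \<Rightarrow> real"
  assumes "set_integrable lborel {x..y} f" "continuous_on {x..y} g"
  shows "set_integrable lborel {x..y} (\<lambda>t. f t * g t)"
  using assms continuous_on_Icc_bounded[OF assms(2)]
  by (metis set_integrable_mult_bounded set_borel_measurable_continuous_Icc)

lemma set_integrable_continuous_Icc:
  fixes g :: "real \<Rightarrow> real"
  assumes "continuous_on {x..y} g"
  shows "set_integrable lborel {x..y} g"
  using assms continuous_on_Icc_bounded[OF assms]
  by (metis set_integrable_Icc_bounded set_borel_measurable_continuous_Icc)

lemma primitive_on_continuous:
  assumes "primitive_on {a..b} F f"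
  shows "continuous_on {a..b} F"
proof (cases "a \<le> b")
  case True
  have "set_integrable lborel {a..b} f" using primitive_onD[OF assms, of a b] True by auto
  then have "f integrable_on {a..b}" by (rule set_borel_integral_eq_integral)
  then have "continuous_on {a..b} (\<lambda>x. F a + integral {a..x} f)"
    by (intro continuous_intros indefinite_integral_continuous_1)
  moreover have "F a + integral {a..x} f = F x" if "x \<in> {a..b}" for x
    using primitive_onD[OF assms, of a x] that set_borel_integral_eq_integral(2)[of "{a..x}" f] by auto
  ultimately show ?thesis using continuous_on_cong[of "{a..b}" "{a..b}" "\<lambda>x. F a + integral {a..x} f" F]
    by blast
qed auto

lemma primitive_on_UNIV_continuous:
  assumes "primitive_on UNIV F f"
  shows "continuous_on S F"
proof -
  have "isCont F x" for x
  proof -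
    have "continuous_on {x-1..x+1} F"
      by (rule primitive_on_continuous[OF primitive_on_subset[OF assms]]) auto
    then show ?thesis by (rule continuous_on_interior) auto
  qed
  then show ?thesis by (simp add: continuous_at_imp_continuous_on)
qed

text \<open>The defect of the product rule is additive over adjacent intervals, and on a short interval it is
  at most the oscillation of \<open>F\<close> and \<open>H\<close> times the integral of \<open>\<bar>f\<bar> + \<bar>h\<bar>\<close>. Bisection turns this into
  the same bound on the whole interval with an arbitrarily small factor, so the defect vanishes. This
  avoids differentiation almost everywhere.\<close>
lemma primitive_on_mult:
  assumes F: "primitive_on {a..b} F f" and H: "primitive_on {a..b} H h"
  shows "primitive_on {a..b} (\<lambda>x. F x * H x) (\<lambda>x. f x * H x + F x * h x)"
  unfolding primitive_on_def
proof (intro ballI impI)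
  fix x0 y0 assume xy: "x0 \<in> {a..b}" "y0 \<in> {a..b}" "x0 \<le> y0"
  note cF = primitive_on_continuous[OF F] and cH = primitive_on_continuous[OF H]
  define d where "d t = f t * H t + F t * h t" for t
  define m where "m t = \<bar>f t\<bar> + \<bar>h t\<bar>" for t
  have ints: "set_integrable lborel {x..y} f" "set_integrable lborel {x..y} h"
      "set_integrable lborel {x..y} d" "set_integrable lborel {x..y} m"
      "set_integrable lborel {x..y} (\<lambda>t. f t * H t)" "set_integrable lborel {x..y} (\<lambda>t. F t * h t)"
    if "a \<le> x" "x \<le> y" "y \<le> b" for x y
  proof -
    show f: "set_integrable lborel {x..y} f" and h: "set_integrable lborel {x..y} h"
      using primitive_onD(1)[OF F, of x y] primitive_onD(1)[OF H, of x y] that by auto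
    have c: "continuous_on {x..y} F" "continuous_on {x..y} H"
      using that cF cH by (auto intro: continuous_on_subset)
    show fH: "set_integrable lborel {x..y} (\<lambda>t. f t * H t)"
      by (rule set_integrable_mult_continuous[OF f c(2)])
    show Fh: "set_integrable lborel {x..y} (\<lambda>t. F t * h t)"
      using set_integrable_mult_continuous[OF h c(1)] by (simp add: mult.commute)
    show "set_integrable lborel {x..y} d"
      unfolding d_def by (rule set_integral_add(1)[OF fH Fh])
    show "set_integrable lborel {x..y} m"
      unfolding m_def by (intro set_integral_add(1) set_integrable_abs f h)
  qed
  define D where "D x y = F y * H y - F x * H x - (LINT t:{x..y}|lborel. d t)" for x y
  have small: "\<bar>D x0 y0\<bar> \<le> e * (LINT t:{x0..y0}|lborel. m t)" if e: "e > 0" for e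
  proof -
    define P where "P x y \<longleftrightarrow> (a \<le> x \<longrightarrow> y \<le> b \<longrightarrow> \<bar>D x y\<bar> \<le> e * (LINT t:{x..y}|lborel. m t))" for x y
    have "P x0 y0"
    proof (rule Bolzano[OF xy(3)])
      fix x y z assume "P x y" "P y z" and o: "x \<le> y" "y \<le> z"
      show "P x z" unfolding P_def
      proof (intro impI)
        assume i: "a \<le> x" "z \<le> b"
        have "\<bar>D x y\<bar> \<le> e * (LINT t:{x..y}|lborel. m t)" "\<bar>D y z\<bar> \<le> e * (LINT t:{y..z}|lborel. m t)"
          using \<open>P x y\<close> \<open>P y z\<close> o i by (auto simp: P_def)
        moreover have "D x z = D x y + D y z"
          unfolding D_def using LINT_Icc_split[OF ints(3) o] o i by auto
        moreover have "(LINT t:{x..z}|lborel. m t) = (LINT t:{x..y}|lborel. m t) + (LINT t:{y..z}|lborel. m t)"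
          using LINT_Icc_split[OF ints(4) o] o i by auto
        ultimately show "\<bar>D x z\<bar> \<le> e * (LINT t:{x..z}|lborel. m t)"
          by (auto simp: distrib_left)
      qed
    next
      fix x assume x: "x0 \<le> x" "x \<le> y0"
      with xy have xab: "x \<in> {a..b}" by auto
      from cF cH xab e obtain d1 d2 where d12: "d1 > 0" "d2 > 0"
        "\<And>y. y \<in> {a..b} \<Longrightarrow> dist y x < d1 \<Longrightarrow> dist (F y) (F x) < e/2"
        "\<And>y. y \<in> {a..b} \<Longrightarrow> dist y x < d2 \<Longrightarrow> dist (H y) (H x) < e/2"
        unfolding continuous_on_iff by (metis half_gt_zero)
      show "\<exists>d>0. \<forall>y z. y \<le> x \<and> x \<le> z \<and> z - y < d \<longrightarrow> P y z"
      proof (intro exI[of _ "min d1 d2"] conjI allI impI)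
        fix y z assume yz: "y \<le> x \<and> x \<le> z \<and> z - y < min d1 d2"
        show "P y z" unfolding P_def
        proof (intro impI)
          assume i: "a \<le> y" "z \<le> b"
          have yz': "y \<le> z" using yz by auto
          note I = ints[OF i(1) yz' i(2)]
          have osc: "\<bar>F u - F v\<bar> \<le> e" "\<bar>H u - H v\<bar> \<le> e" if "u \<in> {y..z}" "v \<in> {y..z}" for u v
          proof -
            have "\<bar>w - x\<bar> < d1" "\<bar>w - x\<bar> < d2" "w \<in> {a..b}" if "w \<in> {y..z}" for w
              using that yz i by (auto simp: abs_if)
            then have "\<bar>F w - F x\<bar> < e/2" "\<bar>H w - H x\<bar> < e/2" if "w \<in> {y..z}" for w
              using d12(3,4)[of w] that by (auto simp: dist_real_def)
            from this[OF that(1)] this[OF that(2)] show "\<bar>F u - F v\<bar> \<le> e" "\<bar>H u - H v\<bar> \<le> e"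
              by linarith+
          qed
          have f: "(LINT t:{y..z}|lborel. f t) = F z - F y" "(LINT t:{y..z}|lborel. h t) = H z - H y"
            using primitive_onD(2)[OF F, of y z] primitive_onD(2)[OF H, of y z] i yz' by auto
          have "F z * H z - F y * H y = (F z - F y) * H z + F y * (H z - H y)" by algebra
          also have "\<dots> = (LINT t:{y..z}|lborel. f t * H z) + (LINT t:{y..z}|lborel. F y * h t)"
            by (simp add: f)
          also have "\<dots> = (LINT t:{y..z}|lborel. f t * H z + F y * h t)"
            using I by (subst set_integral_add(2)) auto
          finally have "D y z = (LINT t:{y..z}|lborel. f t * H z + F y * h t) - (LINT t:{y..z}|lborel. d t)"
            by (simp add: D_def)
          also have "\<dots> = (LINT t:{y..z}|lborel. f t * H z + F y * h t - d t)"
            using I by (subst set_integral_diff(2)) (auto intro!: set_integral_add(1))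
          finally have D: "D y z = (LINT t:{y..z}|lborel. f t * H z + F y * h t - d t)" .
          have int: "set_integrable lborel {y..z} (\<lambda>t. f t * H z + F y * h t - d t)"
            using I by (intro set_integral_diff(1) set_integral_add(1)) auto
          have "\<bar>D y z\<bar> \<le> (LINT t:{y..z}|lborel. \<bar>f t * H z + F y * h t - d t\<bar>)"
            unfolding D using set_integral_norm_bound[OF int] by simp
          also have "\<dots> \<le> (LINT t:{y..z}|lborel. e * m t)"
          proof (rule set_integral_mono)
            show "set_integrable lborel {y..z} (\<lambda>t. \<bar>f t * H z + F y * h t - d t\<bar>)"
              by (rule set_integrable_abs[OF int])
            show "set_integrable lborel {y..z} (\<lambda>t. e * m t)" using I by auto
            fix t assume t: "t \<in> {y..z}"
            have "\<bar>f t * H z + F y * h t - d t\<bar> = \<bar>f t * (H z - H t) + (F y - F t) * h t\<bar>"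
              by (simp add: d_def algebra_simps)
            also have "\<dots> \<le> \<bar>f t\<bar> * \<bar>H z - H t\<bar> + \<bar>F y - F t\<bar> * \<bar>h t\<bar>"
              by (metis abs_mult abs_triangle_ineq)
            also have "\<dots> \<le> \<bar>f t\<bar> * e + e * \<bar>h t\<bar>"
              using osc t yz' by (intro add_mono mult_left_mono mult_right_mono) auto
            finally show "\<bar>f t * H z + F y * h t - d t\<bar> \<le> e * m t" by (simp add: m_def algebra_simps)
          qed
          finally show "\<bar>D y z\<bar> \<le> e * (LINT t:{y..z}|lborel. m t)" by simp
        qed
      qed (use d12 in auto)
    qed
    then show ?thesis using xy by (auto simp: P_def)
  qed
  have "D x0 y0 = 0"
  proof (rule ccontr)
    assume nz: "D x0 y0 \<noteq> 0"
    define K where "K = (LINT t:{x0..y0}|lborel. m t)"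
    have "0 \<le> K" unfolding K_def set_lebesgue_integral_def
      by (rule Bochner_Integration.integral_nonneg) (auto simp: m_def)
    moreover have "\<bar>D x0 y0\<bar> \<le> (\<bar>D x0 y0\<bar> / (2 * (K + 1))) * K"
      unfolding K_def[symmetric] using small[of "\<bar>D x0 y0\<bar> / (2 * (K + 1))"] nz \<open>0 \<le> K\<close> 
      by (simp add: K_def)
    moreover have "(\<bar>D x0 y0\<bar> / (2 * (K + 1))) * K < \<bar>D x0 y0\<bar>" 
    proof -
      have "\<bar>D x0 y0\<bar> * K < \<bar>D x0 y0\<bar> * (2 * (K + 1))"
        using nz \<open>0 \<le> K\<close> by (intro mult_strict_left_mono) auto
      then show ?thesis using \<open>0 \<le> K\<close> by (simp add: pos_divide_less_eq)
    qed
    ultimately show False by linarith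
  qed
  then show "set_integrable lborel {x0..y0} (\<lambda>x. f x * H x + F x * h x) \<and>
     (LINT t:{x0..y0}|lborel. f t * H t + F t * h t) = F y0 * H y0 - F x0 * H x0"
    using ints(3)[of x0 y0] xy by (auto simp: D_def d_def[abs_def])
qed

lemma primitive_onI_DERIV:
  fixes F f :: "real \<Rightarrow> real"
  assumes "finite E" "continuous_on {a..b} F"
    and "\<And>x. a < x \<Longrightarrow> x < b \<Longrightarrow> x \<notin> E \<Longrightarrow> (F has_real_derivative f x) (at x)"
    and "f \<in> borel_measurable borel" "\<And>x. x \<in> {a..b} \<Longrightarrow> \<bar>f x\<bar> \<le> C"
  shows "primitive_on {a..b} F f"
  unfolding primitive_on_def
proof (intro ballI impI)
  fix x y assume xy: "x \<in> {a..b}" "y \<in> {a..b}" "x \<le> y"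
  have int: "set_integrable lborel {x..y} f"
    using xy assms by (intro set_integrable_Icc_bounded[of _ _ _ C]) (auto simp: set_borel_measurable_def)
  have "(f has_integral (F y - F x)) {x..y}"
    using xy assms(2,3) by (intro fundamental_theorem_of_calculus_interior_strong[OF assms(1)])
      (auto simp: has_real_derivative_iff_has_vector_derivative intro: continuous_on_subset)
  then show "set_integrable lborel {x..y} f \<and> (LINT t:{x..y}|lborel. f t) = F y - F x"
    using int set_borel_integral_eq_integral(2)[OF int] by (auto simp: integral_unique)
qed

lemma primitive_on_glue:
  assumes "primitive_on {a..b} F f" "primitive_on {b..c} F f" "a \<le> b" "b \<le> c"
  shows "primitive_on {a..c} F f"
  unfolding primitive_on_def
proof (intro ballI impI)
  fix x y assume xy: "x \<in> {a..c}" "y \<in> {a..c}" "x \<le> y"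
  consider "y \<le> b" | "b \<le> x" | "x < b" "b < y" by linarith
  then show "set_integrable lborel {x..y} f \<and> (LINT t:{x..y}|lborel. f t) = F y - F x"
  proof cases
    case 1 then show ?thesis using primitive_onD[OF assms(1), of x y] xy by auto
  next
    case 2 then show ?thesis using primitive_onD[OF assms(2), of x y] xy by auto
  next
    case 3
    have i: "set_integrable lborel {x..b} f" "set_integrable lborel {b..y} f"
      using primitive_onD[OF assms(1), of x b] primitive_onD[OF assms(2), of b y] xy 3 assms by auto
    have "{x..y} = {x..b} \<union> {b..y}" using 3 by auto
    then have int: "set_integrable lborel {x..y} f" using set_integrable_Un[OF i] by simp
    show ?thesis using int LINT_Icc_split[OF int, of b] 3
       primitive_onD[OF assms(1), of x b] primitive_onD[OF assms(2), of b y] xy by auto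
  qed
qed

lemma borel_measure_eqI_box:
  fixes M N :: "real measure"
  assumes "sets M = sets borel" "sets N = sets borel"
    and "\<And>a b. a \<le> b \<Longrightarrow> emeasure M (box a b) = emeasure N (box a b)"
    and "\<And>a b. a \<le> b \<Longrightarrow> emeasure M (box a b) \<noteq> \<infinity>"
  shows "M = N"
proof (rule measure_eqI_generator_eq)
  let ?E = "range (\<lambda>(a, b). box a b::real set)"
  show "Int_stable ?E"
    by (auto simp: Int_stable_def box_Int_box simp del: box_real)
  show "?E \<subseteq> Pow UNIV" "sets M = sigma_sets UNIV ?E" "sets N = sigma_sets UNIV ?E"
    by (simp_all add: borel_eq_box assms)
  let ?A = "\<lambda>n::nat. box (- (real n *\<^sub>R One)) (real n *\<^sub>R One) :: real set"
  show "range ?A \<subseteq> ?E" "(\<Union>i. ?A i) = UNIV"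
    unfolding UN_box_eq_UNIV by auto
  show "emeasure M (?A i) \<noteq> \<infinity>" for i using assms(4)[of "-real i" "real i"] by simp
  show "emeasure M X = emeasure N X" if "X \<in> ?E" for X
  proof -
    obtain a b where "X = box a b" using \<open>X \<in> ?E\<close> by auto
    then show ?thesis using assms(3)[of a b] by (cases "a \<le> b") auto
  qed
qed

text \<open>The positive and the negative part of \<open>f\<close> are densities of two measures that agree on intervals.
  Such measures are equal, and so are their densities.\<close>
lemma AE_eq_0_if_integrals_0:
  fixes f :: "real \<Rightarrow> real"
  assumes [measurable]: "f \<in> borel_measurable borel"
    and int: "\<And>a b. set_integrable lborel {a..b} f"
    and zero: "\<And>a b. a \<le> b \<Longrightarrow> (LINT t:{a..b}|lborel. f t) = 0"
  shows "AE t in lborel. f t = 0"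
proof -
  let ?p = "\<lambda>t. ennreal (f t)" and ?n = "\<lambda>t. ennreal (- f t)"
  have em: "emeasure (density lborel (\<lambda>t. ennreal (g t))) (box a b) = ennreal (LINT t:{a..b}|lborel. max 0 (g t))"
    if "g = f \<or> g = (\<lambda>t. - f t)" for a b and g :: "real \<Rightarrow> real"
  proof -
    have [measurable]: "g \<in> borel_measurable borel" using that by auto
    have "set_integrable lborel {a..b} g" using int that by (auto simp: set_integrable_def)
    then have i: "integrable lborel (\<lambda>t. indicator {a..b} t *\<^sub>R max 0 (g t))"
      unfolding set_integrable_def
      by (rule Bochner_Integration.integrable_bound) (auto simp: indicator_def)
    have "emeasure (density lborel (\<lambda>t. ennreal (g t))) (box a b) = (\<integral>\<^sup>+t. ennreal (g t) * indicator (box a b) t \<partial>lborel)"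
      by (subst emeasure_density) auto
    also have "\<dots> = (\<integral>\<^sup>+t. ennreal (indicator {a..b} t *\<^sub>R max 0 (g t)) \<partial>lborel)"
    proof (rule nn_integral_cong_AE)
      have "AE t in lborel. t \<notin> {a, b}" by (rule AE_not_in) (auto intro: countable_imp_null_set_lborel)
      then show "AE t in lborel. ennreal (g t) * indicator (box a b) t = ennreal (indicator {a..b} t *\<^sub>R max 0 (g t))"
        by eventually_elim (auto simp: indicator_def max_def ennreal_neg)
    qed
    also have "\<dots> = ennreal (LINT t:{a..b}|lborel. max 0 (g t))"
      unfolding set_lebesgue_integral_def by (rule nn_integral_eq_integral[OF i]) auto
    finally show ?thesis .
  qed
  have "density lborel ?p = density lborel ?n"
  proof (rule borel_measure_eqI_box)
    fix a b :: real assume ab: "a \<le> b"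
    have mx: "set_integrable lborel {a..b} (\<lambda>t. max 0 (f t))" "set_integrable lborel {a..b} (\<lambda>t. max 0 (- f t))"
      using int[of a b] unfolding set_integrable_def
      by (auto elim!: Bochner_Integration.integrable_bound simp: indicator_def)
    have "(LINT t:{a..b}|lborel. max 0 (f t)) - (LINT t:{a..b}|lborel. max 0 (- f t))
        = (LINT t:{a..b}|lborel. max 0 (f t) - max 0 (- f t))"
      by (subst set_integral_diff(2)[OF mx]) simp
    also have "\<dots> = (LINT t:{a..b}|lborel. f t)"
      by (rule arg_cong[where f="set_lebesgue_integral lborel {a..b}"]) (auto simp: max_def)
    finally have "(LINT t:{a..b}|lborel. max 0 (f t)) = (LINT t:{a..b}|lborel. max 0 (- f t))"
      using zero[OF ab] by simp
    then show "emeasure (density lborel ?p) (box a b) = emeasure (density lborel ?n) (box a b)"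
      using em[of f a b] em[of "\<lambda>t. - f t" a b] by simp
    show "emeasure (density lborel ?p) (box a b) \<noteq> \<infinity>" using em[of f a b] by simp
  qed auto
  then have "AE t in lborel. ?p t = ?n t"
    by (intro sigma_finite_measure.density_unique[OF sigma_finite_lborel]) auto
  then show ?thesis
  proof eventually_elim
    case (elim t)
    show ?case
    proof (cases "f t \<ge> 0")
      case True
      then have "ennreal (f t) = 0" using elim by (simp add: ennreal_neg)
      then show ?thesis using True by (simp add: ennreal_eq_0_iff)
    next
      case False
      then have "ennreal (- f t) = 0" using elim by (simp add: ennreal_neg)
      then show ?thesis using False by (simp add: ennreal_eq_0_iff)
    qed
  qed
qed

lemma primitive_on_UNIV_unique:
  assumes "primitive_on UNIV F f" "primitive_on UNIV F g"
    and [measurable]: "f \<in> borel_measurable borel" "g \<in> borel_measurable borel"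
  shows "AE t in lborel. f t = g t"
proof -
  have i: "set_integrable lborel {a..b} f" "set_integrable lborel {a..b} g" for a b
    using primitive_onD(1)[OF assms(1), of a b] primitive_onD(1)[OF assms(2), of a b]
    by (cases "a \<le> b"; simp)+
  have "AE t in lborel. f t - g t = 0"
  proof (rule AE_eq_0_if_integrals_0)
    show "set_integrable lborel {a..b} (\<lambda>t. f t - g t)" for a b by (rule set_integral_diff(1)[OF i])
    show "(LINT t:{a..b}|lborel. f t - g t) = 0" if "a \<le> b" for a b
      using set_integral_diff(2)[OF i, of a b] primitive_onD(2)[OF assms(1), of a b] 
        primitive_onD(2)[OF assms(2), of a b] that by simp
  qed auto
  then show ?thesis by eventually_elim simp
qed

lemma set_integrable_shift:
  fixes f :: "real \<Rightarrow> real"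
  shows "set_integrable lborel {x..y} (\<lambda>t. f (t + c)) \<longleftrightarrow> set_integrable lborel {x + c..y + c} f"
proof -
  have "(\<lambda>t. indicator {x..y} t *\<^sub>R f (t + c)) = (\<lambda>t. indicator {x + c..y + c} (c + 1 * t) *\<^sub>R f (c + 1 * t))"
    by (auto simp: indicator_def add.commute)
  then show ?thesis unfolding set_integrable_def
    using lborel_integrable_real_affine_iff[of 1 "\<lambda>t. indicator {x + c..y + c} t *\<^sub>R f t" c] by simp
qed

lemma LINT_shift:
  fixes f :: "real \<Rightarrow> real"
  shows "(LINT t:{x..y}|lborel. f (t + c)) = (LINT t:{x + c..y + c}|lborel. f t)"
proof -
  have "(\<lambda>t. indicator {x..y} t *\<^sub>R f (t + c)) = (\<lambda>t. indicator {x + c..y + c} (c + 1 * t) *\<^sub>R f (c + 1 * t))"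
    by (auto simp: indicator_def add.commute)
  then show ?thesis unfolding set_lebesgue_integral_def
    using lborel_integral_real_affine[of 1 "\<lambda>t. indicator {x + c..y + c} t *\<^sub>R f t" c] by simp
qed

lemma LINT_period:
  fixes f :: "real \<Rightarrow> real"
  assumes "\<And>x y. set_integrable lborel {x..y} f" "\<And>t. f (t + l) = f t" "0 \<le> x" "x \<le> l"
  shows "(LINT t:{x..x+l}|lborel. f t) = (LINT t:{0..l}|lborel. f t)"
proof -
  have "(LINT t:{l..x+l}|lborel. f t) = (LINT t:{0..x}|lborel. f t)"
    using LINT_shift[of 0 x f l] assms(2) by simp
  moreover have "(LINT t:{x..x+l}|lborel. f t) = (LINT t:{x..l}|lborel. f t) + (LINT t:{l..x+l}|lborel. f t)"
    "(LINT t:{0..l}|lborel. f t) = (LINT t:{0..x}|lborel. f t) + (LINT t:{x..l}|lborel. f t)"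
    using assms by (auto intro!: LINT_Icc_split)
  ultimately show ?thesis by simp
qed

lemma primitive_on_shift:
  "primitive_on {a..b} (\<lambda>t. F (t + c)) (\<lambda>t. f (t + c)) \<longleftrightarrow> primitive_on {a + c..b + c} F f"
proof
  assume P: "primitive_on {a..b} (\<lambda>t. F (t + c)) (\<lambda>t. f (t + c))"
  show "primitive_on {a + c..b + c} F f" unfolding primitive_on_def
  proof (intro ballI impI)
    fix x y assume "x \<in> {a + c..b + c}" "y \<in> {a + c..b + c}" "x \<le> y"
    then have "x - c \<in> {a..b}" "y - c \<in> {a..b}" "x - c \<le> y - c" by auto
    from primitive_onD[OF P this] show "set_integrable lborel {x..y} f \<and> (LINT t:{x..y}|lborel. f t) = F y - F x"
      by (simp add: set_integrable_shift LINT_shift)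
  qed
next
  assume P: "primitive_on {a + c..b + c} F f"
  show "primitive_on {a..b} (\<lambda>t. F (t + c)) (\<lambda>t. f (t + c))" unfolding primitive_on_def
  proof (intro ballI impI)
    fix x y assume "x \<in> {a..b}" "y \<in> {a..b}" "x \<le> y"
    then have "x + c \<in> {a + c..b + c}" "y + c \<in> {a + c..b + c}" "x + c \<le> y + c" by auto
    from primitive_onD[OF P this] show "set_integrable lborel {x..y} (\<lambda>t. f (t + c)) \<and>
       (LINT t:{x..y}|lborel. f (t + c)) = F (y + c) - F (x + c)"
      by (simp add: set_integrable_shift LINT_shift)
  qed
qed


section \<open>The worst weight and its profile\<close>

lemma primitive_on_UNIV_I:
  assumes "\<And>a b. a \<le> b \<Longrightarrow> primitive_on {a..b} F f"
  shows "primitive_on UNIV F f"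
  unfolding primitive_on_def
proof (intro ballI impI)
  fix x y :: real assume "x \<le> y"
  then show "set_integrable lborel {x..y} f \<and> (LINT t:{x..y}|lborel. f t) = F y - F x"
    using primitive_onD[OF assms, of x y x y] by simp
qed

text \<open>The worst weight with values in \<open>[1, s\<^sup>2]\<close> switches between the two extreme values. Call the interval
  of length \<open>2 * al\<close> around \<open>2 * al * n\<close> the cell \<open>n\<close>. The weight \<open>B\<close> is 1 on even and \<open>s\<^sup>2\<close> on odd cells, and
  \<open>U\<close> is the solution of \<open>(B U')' = - B U\<close> with \<open>U 0 = 0\<close> and slope 1 at 0. It consists of arcs of sine and
  cosine. With \<open>V = B U'\<close> the equation is the system \<open>U' = V / B\<close>, \<open>V' = - B U\<close>.\<close>
locale bang_bang =
  fixes s :: real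
  assumes s_ge_1: "1 \<le> s"
begin

text \<open>The angle with \<open>s * sin al = cos al\<close>: only for this half length of a cell do the arcs
  \<open>sin\<close> and \<open>cos / s\<close> of \<open>U\<close> join continuously, and with them the arcs of \<open>V\<close>.\<close>
definition al :: real where "al = arctan (1 / s)"

definition cell :: "real \<Rightarrow> int" where "cell x = \<lfloor>(x + al) / (2 * al)\<rfloor>"

text \<open>The arc of \<open>U\<close> on the cell \<open>n\<close>, as a function of the distance \<open>d\<close> from the centre of the cell.\<close>
definition piece :: "int \<Rightarrow> real \<Rightarrow> real" where
  "piece n d = (if n mod 4 = 0 then sin d else if n mod 4 = 1 then cos d / s
     else if n mod 4 = 2 then - sin d else - cos d / s)"

definition U :: "real \<Rightarrow> real" where "U x = piece (cell x) (x - 2 * al * cell x)"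

definition B :: "real \<Rightarrow> real" where "B x = (if even (cell x) then 1 else s\<^sup>2)"

text \<open>The flux \<open>B U'\<close> is \<open>s\<close> times the profile a quarter of a period later. With this definition the
  regularity of \<open>V\<close> is that of \<open>U\<close>, and the second equation of the system is the first one, shifted.\<close>
definition V :: "real \<Rightarrow> real" where "V x = s * U (x + 2 * al)"

lemma s_pos: "0 < s" using s_ge_1 by simp

lemma al_pos: "0 < al" using s_pos by (simp add: al_def)

lemma al_le: "al \<le> pi / 4"
proof -
  have "arctan (1 / s) \<le> arctan 1" using s_ge_1 by (intro arctan_monotone') (simp add: field_simps)
  then show ?thesis by (simp add: al_def arctan_one)
qed

lemma al_lt: "al < pi / 2" using al_le pi_gt_zero by linarith

lemma cos_al_pos: "0 < cos al" using al_lt al_pos by (intro cos_gt_zero) auto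

lemma sin_al: "sin al = cos al / s"
proof -
  have "sin al / cos al = 1 / s" using tan_arctan[of "1 / s"] by (simp add: al_def tan_def)
  then show ?thesis using cos_al_pos s_pos by (simp add: field_simps)
qed

lemma cell_eqI: "2 * al * n - al \<le> x \<Longrightarrow> x < 2 * al * n + al \<Longrightarrow> cell x = n"
  unfolding cell_def by (rule floor_unique) (use al_pos in \<open>auto simp: field_simps\<close>)

lemma cell_bounds: "2 * al * cell x - al \<le> x" "x < 2 * al * cell x + al"
proof -
  have "of_int (cell x) \<le> (x + al) / (2 * al)" "(x + al) / (2 * al) < of_int (cell x) + 1"
    unfolding cell_def by linarith+
  then show "2 * al * cell x - al \<le> x" "x < 2 * al * cell x + al"
    using al_pos by (auto simp: field_simps)
qed

lemma cell_shift: "cell (x + 2 * al * m) = cell x + m"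
  using cell_bounds[of x] by (intro cell_eqI) (auto simp: algebra_simps)

lemma cell_measurable [measurable]: "cell \<in> borel \<rightarrow>\<^sub>M count_space UNIV"
  unfolding cell_def by measurable

lemma piece_measurable [measurable]: "(\<lambda>x. piece (f x) (g x)) \<in> borel_measurable borel"
  if [measurable]: "f \<in> borel \<rightarrow>\<^sub>M count_space UNIV" "g \<in> borel_measurable borel"
  unfolding piece_def by measurable

lemma U_measurable [measurable]: "U \<in> borel_measurable borel"
  unfolding U_def by measurable

lemma B_measurable [measurable]: "B \<in> borel_measurable borel"
  unfolding B_def by measurable

lemma V_measurable [measurable]: "V \<in> borel_measurable borel"
  unfolding V_def by measurable

lemma mod4_cases:
  fixes n :: int
  obtains "n mod 4 = 0" | "n mod 4 = 1" | "n mod 4 = 2" | "n mod 4 = 3"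
  by linarith

lemma mod4_add:
  fixes n :: int
  shows "n mod 4 = 0 \<Longrightarrow> (n + 1) mod 4 = 1" "n mod 4 = 1 \<Longrightarrow> (n + 1) mod 4 = 2"
    "n mod 4 = 2 \<Longrightarrow> (n + 1) mod 4 = 3" "n mod 4 = 3 \<Longrightarrow> (n + 1) mod 4 = 0"
    "n mod 4 = 0 \<Longrightarrow> (n + 2) mod 4 = 2" "n mod 4 = 1 \<Longrightarrow> (n + 2) mod 4 = 3"
    "n mod 4 = 2 \<Longrightarrow> (n + 2) mod 4 = 0" "n mod 4 = 3 \<Longrightarrow> (n + 2) mod 4 = 1"
    "n mod 4 = 0 \<Longrightarrow> \<not> 4 dvd n + 1" "n mod 4 = 1 \<Longrightarrow> \<not> 4 dvd n + 1"
    "n mod 4 = 2 \<Longrightarrow> \<not> 4 dvd n + 1" "n mod 4 = 3 \<Longrightarrow> 4 dvd n + 1"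
  by presburger+

lemma piece_step: "piece (n + 1) (- al) = piece n al"
  by (rule mod4_cases[of n]) (simp_all add: piece_def sin_al mod4_add)

lemma piece_shift2: "piece (n + 2) d = - piece n d"
  by (rule mod4_cases[of n]) (simp_all add: piece_def mod4_add)

lemma even_mod4: "even (n::int) \<longleftrightarrow> n mod 4 = 0 \<or> n mod 4 = 2"
  by presburger

text \<open>The formula holds at both ends of the cell, which is the continuity of \<open>U\<close> at the switching points.\<close>
lemma U_eq_piece:
  assumes "2 * al * n - al \<le> x" "x \<le> 2 * al * n + al"
  shows "U x = piece n (x - 2 * al * n)"
proof (cases "x = 2 * al * n + al")
  case True
  have "cell x = n + 1" by (rule cell_eqI) (use True al_pos in \<open>auto simp: algebra_simps\<close>)
  then show ?thesis using True piece_step[of n] by (simp add: U_def algebra_simps)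
next
  case False
  then have "cell x = n" using assms by (intro cell_eqI) auto
  then show ?thesis by (simp add: U_def)
qed

lemma U_shift4: "U (x + 4 * al) = - U x"
  using cell_shift[of x 2] piece_shift2[of "cell x"] by (simp add: U_def algebra_simps)

lemma V_shift4: "V (x + 4 * al) = - V x"
  using U_shift4[of "x + 2 * al"] by (simp add: V_def algebra_simps)

lemma B_shift4: "B (x + 4 * al) = B x"
  using cell_shift[of x 2] by (simp add: B_def algebra_simps)

lemma B_shift2: "B x * B (x + 2 * al) = s\<^sup>2"
  using cell_shift[of x 1] by (simp add: B_def)

lemma U_shift8: "U (x + 8 * al) = U x"
  using U_shift4[of x] U_shift4[of "x + 4 * al"] by (simp add: algebra_simps)

lemma V_shift8: "V (x + 8 * al) = V x"
  using V_shift4[of x] V_shift4[of "x + 4 * al"] by (simp add: algebra_simps)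

lemma B_shift8: "B (x + 8 * al) = B x"
  using B_shift4[of x] B_shift4[of "x + 4 * al"] by (simp add: algebra_simps)

lemma B_bounds: "1 \<le> B x" "B x \<le> s\<^sup>2" "0 < B x"
  using s_ge_1 one_le_power[of s 2] by (auto simp: B_def intro: zero_less_power)

lemma abs_piece_le: "\<bar>piece n d\<bar> \<le> 1"
proof -
  have "\<bar>cos d\<bar> / s \<le> 1 / 1" using s_ge_1 by (intro frac_le) auto
  then show ?thesis using s_pos by (auto simp: piece_def)
qed

lemma abs_U_le: "\<bar>U x\<bar> \<le> 1" by (simp add: U_def abs_piece_le)

lemma abs_V_le: "\<bar>V x\<bar> \<le> s"
  using abs_U_le[of "x + 2 * al"] s_pos mult_left_mono[of "\<bar>U (x + 2 * al)\<bar>" 1 s] by (simp add: V_def abs_mult)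

lemma isCont_piece: "isCont (\<lambda>x. piece n (x - c)) x"
  using s_pos by (cases "n mod 4 = 0"; cases "n mod 4 = 1"; cases "n mod 4 = 2")
    (auto simp: piece_def intro!: continuous_intros)

lemma isCont_U: "isCont U x"
proof -
  define n where "n = cell x"
  have b: "2 * al * n - al \<le> x" "x < 2 * al * n + al" using cell_bounds[of x] by (auto simp: n_def)
  have c: "continuous_on {2 * al * m - al..2 * al * m + al} U" for m :: int
  proof -
    have "continuous_on {2 * al * m - al..2 * al * m + al} (\<lambda>x. piece m (x - 2 * al * m))"
      by (simp add: continuous_at_imp_continuous_on isCont_piece)
    then show ?thesis
      by (rule continuous_on_eq) (metis U_eq_piece atLeastAtMost_iff)
  qed
  have "continuous_on ({2 * al * (n - 1) - al..2 * al * (n - 1) + al} \<union> {2 * al * n - al..2 * al * n + al}) U"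
    using c[of n] c[of "n - 1"] by (intro continuous_on_closed_Un) auto
  moreover have "x \<in> interior ({2 * al * (n - 1) - al..2 * al * (n - 1) + al} \<union> {2 * al * n - al..2 * al * n + al})"
  proof (rule interiorI)
    show "open {2 * al * (n - 1) - al<..<2 * al * n + al}" by simp
    show "x \<in> {2 * al * (n - 1) - al<..<2 * al * n + al}" using b al_pos by (auto simp: algebra_simps)
    show "{2 * al * (n - 1) - al<..<2 * al * n + al} \<subseteq>
      {2 * al * (n - 1) - al..2 * al * (n - 1) + al} \<union> {2 * al * n - al..2 * al * n + al}"
      using al_pos by (auto simp: algebra_simps)
  qed
  ultimately show ?thesis by (rule continuous_on_interior)
qed

lemma continuous_on_U: "continuous_on S U"
  by (simp add: continuous_at_imp_continuous_on isCont_U)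

lemma continuous_on_V: "continuous_on S V"
  unfolding V_def by (intro continuous_intros continuous_on_compose2[OF continuous_on_U[of UNIV]]) auto

definition switches :: "real set" where "switches = range (\<lambda>n::int. 2 * al * n - al)"

lemma finite_switches: "finite (switches \<inter> {a..b})"
proof -
  have "switches \<inter> {a..b} \<subseteq> (\<lambda>n::int. 2 * al * n - al) ` {cell a..cell b}"
  proof
    fix x assume "x \<in> switches \<inter> {a..b}"
    then obtain n :: int where n: "x = 2 * al * n - al" "a \<le> x" "x \<le> b" by (auto simp: switches_def)
    have "cell x = n" using n al_pos by (intro cell_eqI) auto
    moreover have "cell a \<le> cell x" "cell x \<le> cell b"
      using n(2,3) al_pos by (auto simp: cell_def intro!: floor_mono divide_right_mono)
    ultimately show "x \<in> (\<lambda>n::int. 2 * al * n - al) ` {cell a..cell b}" using n by auto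
  qed
  then show ?thesis by (rule finite_subset) simp
qed

lemma not_switch_cell:
  assumes "x \<notin> switches"
  shows "2 * al * cell x - al < x" "x < 2 * al * cell x + al"
proof -
  have "x \<noteq> 2 * al * cell x - al" using assms by (auto simp: switches_def)
  with cell_bounds[of x] show "2 * al * cell x - al < x" "x < 2 * al * cell x + al" by auto
qed

lemma not_switch_shift2: "x \<notin> switches \<Longrightarrow> x + 2 * al \<notin> switches"
proof (rule ccontr)
  assume "x \<notin> switches" "\<not> x + 2 * al \<notin> switches"
  then obtain n :: int where "x + 2 * al = 2 * al * n - al" by (auto simp only: switches_def not_not image_iff)
  then have "x = 2 * al * of_int (n - 1) - al" by (simp add: algebra_simps)
  then show False using \<open>x \<notin> switches\<close> unfolding switches_def by blast
qed

lemma DERIV_piece: "((\<lambda>x. piece n (x - c)) has_real_derivative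
    (s * piece (n + 1) (x - c)) / (if even n then 1 else s\<^sup>2)) (at x)"
  using s_pos
  by (rule_tac mod4_cases[of n])
    (auto simp: piece_def even_mod4 mod4_add power2_eq_square
      intro!: derivative_eq_intros)

lemma V_eq_piece:
  assumes "2 * al * n - al \<le> x" "x \<le> 2 * al * n + al"
  shows "V x = s * piece (n + 1) (x - 2 * al * n)"
  using U_eq_piece[of "n + 1" "x + 2 * al"] assms by (simp add: V_def algebra_simps)

lemma DERIV_U:
  assumes "x \<notin> switches"
  shows "(U has_real_derivative V x / B x) (at x)"
proof -
  define n where "n = cell x"
  note b = not_switch_cell[OF assms, folded n_def]
  have "((\<lambda>x. piece n (x - 2 * al * n)) has_real_derivative V x / B x) (at x)"
    using DERIV_piece[of n "2 * al * n" x] V_eq_piece[of n x] b by (simp add: B_def n_def)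
  moreover have "\<forall>\<^sub>F y in nhds x. piece n (y - 2 * al * n) = U y"
  proof -
    have "\<forall>\<^sub>F y in nhds x. y \<in> {2 * al * n - al<..<2 * al * n + al}"
      by (rule eventually_nhds_in_open) (use b in auto)
    then show ?thesis
      by eventually_elim (metis U_eq_piece greaterThanLessThan_iff less_imp_le)
  qed
  ultimately show ?thesis using DERIV_cong_ev[of x x "\<lambda>x. piece n (x - 2 * al * n)" U "V x / B x" "V x / B x"] by auto
qed

lemma DERIV_V:
  assumes "x \<notin> switches"
  shows "(V has_real_derivative - (B x * U x)) (at x)"
proof -
  have "((\<lambda>x. s * U (x + 2 * al)) has_real_derivative s * (V (x + 2 * al) / B (x + 2 * al) * 1)) (at x)"
    by (intro DERIV_cmult DERIV_chain'[where g=U] DERIV_U not_switch_shift2 assms)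
      (auto intro!: derivative_eq_intros)
  moreover have "s * (V (x + 2 * al) / B (x + 2 * al) * 1) = - (B x * U x)"
  proof -
    have VV: "V (x + 2 * al) = - (s * U x)" using U_shift4[of x] by (simp add: V_def algebra_simps)
    have "1 / B (x + 2 * al) = B x / s\<^sup>2"
      using B_shift2[of x] B_bounds(3)[of "x + 2 * al"] s_pos by (simp add: field_simps)
    have "s * (V (x + 2 * al) / B (x + 2 * al) * 1) = - (s\<^sup>2 * U x) * (1 / B (x + 2 * al))"
      by (simp add: VV power2_eq_square)
    also have "\<dots> = - (B x * U x)"
      unfolding \<open>1 / B (x + 2 * al) = B x / s\<^sup>2\<close> using s_pos by simp
    finally show ?thesis .
  qed
  ultimately show ?thesis by (simp add: V_def[abs_def])
qed

lemma primitive_U: "primitive_on UNIV U (\<lambda>x. V x / B x)"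
proof (rule primitive_on_UNIV_I)
  fix a b :: real
  show "primitive_on {a..b} U (\<lambda>x. V x / B x)"
  proof (rule primitive_onI_DERIV[OF finite_switches[of a b] continuous_on_U])
    show "\<bar>V x / B x\<bar> \<le> s" for x
    proof -
      have "\<bar>V x\<bar> / B x \<le> s / 1" using abs_V_le[of x] B_bounds[of x] s_pos by (intro frac_le) auto
      then show ?thesis using B_bounds(3)[of x] by simp
    qed
  qed (auto intro: DERIV_U)
qed

lemma primitive_V: "primitive_on UNIV V (\<lambda>x. - (B x * U x))"
proof (rule primitive_on_UNIV_I)
  fix a b :: real
  show "primitive_on {a..b} V (\<lambda>x. - (B x * U x))"
  proof (rule primitive_onI_DERIV[OF finite_switches[of a b] continuous_on_V])
    show "\<bar>- (B x * U x)\<bar> \<le> s\<^sup>2 * 1" for x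
      using abs_U_le[of x] B_bounds[of x] mult_mono[of "B x" "s\<^sup>2" "\<bar>U x\<bar>" 1]
      by (simp add: abs_mult)
  qed (auto intro: DERIV_V)
qed

lemma U_0: "U 0 = 0" using U_eq_piece[of 0 0] al_pos by (simp add: piece_def)

lemma V_0: "V 0 = 1" using V_eq_piece[of 0 0] al_pos s_pos by (simp add: piece_def)

lemma U_pos:
  assumes "0 < x" "x < 4 * al"
  shows "0 < U x"
proof -
  consider "x \<le> al" | "al \<le> x" "x \<le> 3 * al" | "3 * al \<le> x" by linarith
  then show ?thesis
  proof cases
    case 1
    then have "U x = sin x" using U_eq_piece[of 0 x] assms by (simp add: piece_def)
    then show ?thesis using 1 assms al_lt by (simp add: sin_gt_zero)
  next
    case 2
    then have "U x = cos (x - 2 * al) / s" using U_eq_piece[of 1 x] by (simp add: piece_def)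
    then show ?thesis using 2 al_lt s_pos by (simp add: cos_gt_zero_pi)
  next
    case 3
    then have "U x = sin (4 * al - x)" using U_eq_piece[of 2 x] assms by (simp add: piece_def sin_diff)
    then show ?thesis using 3 assms al_lt by (simp add: sin_gt_zero)
  qed
qed

lemma sin_cos_cell:
  assumes "\<bar>d\<bar> \<le> al"
  shows "s\<^sup>2 * (sin d)\<^sup>2 \<le> (cos d)\<^sup>2" "\<bar>d\<bar> < al \<Longrightarrow> s\<^sup>2 * (sin d)\<^sup>2 < (cos d)\<^sup>2"
proof -
  have eq: "(sin d)\<^sup>2 = (sin \<bar>d\<bar>)\<^sup>2" "(cos d)\<^sup>2 = (cos \<bar>d\<bar>)\<^sup>2" by (auto simp: abs_if)
  have sc: "sin \<bar>d\<bar> \<le> sin al" "cos al \<le> cos \<bar>d\<bar>"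
  proof -
    have "- (pi / 2) \<le> \<bar>d\<bar>" "al \<le> pi / 2" "al \<le> pi" using al_lt pi_gt_zero abs_ge_zero[of d] by linarith+
    then show "sin \<bar>d\<bar> \<le> sin al" "cos al \<le> cos \<bar>d\<bar>"
      using sin_monotone_2pi_le[of "\<bar>d\<bar>" al] cos_monotone_0_pi_le[of "\<bar>d\<bar>" al] assms by simp_all
  qed
  have "0 \<le> sin \<bar>d\<bar>" using assms al_lt by (intro sin_ge_zero) auto
  have ssin: "s * sin \<bar>d\<bar> \<le> cos al" using mult_left_mono[OF sc(1), of s] sin_al s_pos by simp
  with sc have "s * sin \<bar>d\<bar> \<le> cos \<bar>d\<bar>" by linarith
  then have "(s * sin \<bar>d\<bar>)\<^sup>2 \<le> (cos \<bar>d\<bar>)\<^sup>2" using \<open>0 \<le> sin \<bar>d\<bar>\<close> s_pos by (intro power_mono) auto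
  then show "s\<^sup>2 * (sin d)\<^sup>2 \<le> (cos d)\<^sup>2" unfolding eq by (simp add: power_mult_distrib)
  assume "\<bar>d\<bar> < al"
  then have "cos al < cos \<bar>d\<bar>" using al_lt by (intro cos_monotone_0_pi) auto
  then have "s * sin \<bar>d\<bar> < cos \<bar>d\<bar>" using ssin by linarith
  then have "(s * sin \<bar>d\<bar>)\<^sup>2 < (cos \<bar>d\<bar>)\<^sup>2" using \<open>0 \<le> sin \<bar>d\<bar>\<close> s_pos by (intro power_strict_mono) auto
  then show "s\<^sup>2 * (sin d)\<^sup>2 < (cos d)\<^sup>2" unfolding eq by (simp add: power_mult_distrib)
qed

text \<open>The switching points are exactly the points with \<open>\<bar>V\<bar> = s * \<bar>U\<bar>\<close>.\<close>
lemma V_U_compare: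
  shows "even (cell x) \<Longrightarrow> s\<^sup>2 * (U x)\<^sup>2 \<le> (V x)\<^sup>2" "odd (cell x) \<Longrightarrow> (V x)\<^sup>2 \<le> s\<^sup>2 * (U x)\<^sup>2"
    and "even (cell x) \<Longrightarrow> x \<notin> switches \<Longrightarrow> s\<^sup>2 * (U x)\<^sup>2 < (V x)\<^sup>2"
    and "odd (cell x) \<Longrightarrow> x \<notin> switches \<Longrightarrow> (V x)\<^sup>2 < s\<^sup>2 * (U x)\<^sup>2"
proof -
  define n where "n = cell x"
  define d where "d = x - 2 * al * n"
  have d: "\<bar>d\<bar> \<le> al" using cell_bounds[of x] by (auto simp: d_def n_def)
  have d': "\<bar>d\<bar> < al" if "x \<notin> switches" using not_switch_cell[OF that] by (auto simp: d_def n_def)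
  have U: "U x = piece n d" by (simp add: U_def d_def n_def)
  have V: "V x = s * piece (n + 1) d" using V_eq_piece[of n x] cell_bounds[of x] by (simp add: d_def n_def)
  have e: "(U x)\<^sup>2 = (sin d)\<^sup>2" "(V x)\<^sup>2 = (cos d)\<^sup>2" if "even n"
    using that s_pos unfolding U V even_mod4
    by (auto simp: piece_def mod4_add power_mult_distrib power_divide)
  have o: "s\<^sup>2 * (U x)\<^sup>2 = (cos d)\<^sup>2" "(V x)\<^sup>2 = s\<^sup>2 * (sin d)\<^sup>2" if "odd n"
  proof -
    have "n mod 4 = 1 \<or> n mod 4 = 3" using that by presburger
    then show "s\<^sup>2 * (U x)\<^sup>2 = (cos d)\<^sup>2" "(V x)\<^sup>2 = s\<^sup>2 * (sin d)\<^sup>2"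
      using s_pos unfolding U V
      by (auto simp: piece_def mod4_add power_mult_distrib power_divide)
  qed
  show "even (cell x) \<Longrightarrow> s\<^sup>2 * (U x)\<^sup>2 \<le> (V x)\<^sup>2" "odd (cell x) \<Longrightarrow> (V x)\<^sup>2 \<le> s\<^sup>2 * (U x)\<^sup>2"
    using sin_cos_cell(1)[OF d] e o by (auto simp: n_def)
  show "even (cell x) \<Longrightarrow> x \<notin> switches \<Longrightarrow> s\<^sup>2 * (U x)\<^sup>2 < (V x)\<^sup>2"
    "odd (cell x) \<Longrightarrow> x \<notin> switches \<Longrightarrow> (V x)\<^sup>2 < s\<^sup>2 * (U x)\<^sup>2"
    using sin_cos_cell(2)[OF d d'] e o by (auto simp: n_def)
qed

text \<open>The logarithmic flux \<open>B U' / U\<close>. It satisfies the Riccati equation \<open>R' = - (B + R\<^sup>2 / B)\<close>.\<close>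
definition R :: "real \<Rightarrow> real" where "R x = V x / U x"

lemma R_measurable [measurable]: "R \<in> borel_measurable borel" unfolding R_def by measurable

text \<open>The heart of the matter. The function \<open>A \<mapsto> A + R\<^sup>2 / A\<close> is convex, so on \<open>[1, s\<^sup>2]\<close> it is largest at an
  end point: at 1 if \<open>\<bar>R\<bar> \<ge> s\<close> and at \<open>s\<^sup>2\<close> if \<open>\<bar>R\<bar> \<le> s\<close>. The weight \<open>B\<close> switches so as to select this end point.
  Hence \<open>R' \<le> - (A + R\<^sup>2 / A)\<close> for every weight \<open>A\<close>, with equality only for \<open>A = B\<close>.\<close>
lemma riccati_slack:
  assumes "0 < x" "x < 4 * al" "1 \<le> A" "A \<le> s\<^sup>2"
  shows "A + (R x)\<^sup>2 / A \<le> B x + (R x)\<^sup>2 / B x"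
    and "x \<notin> switches \<Longrightarrow> A + (R x)\<^sup>2 / A = B x + (R x)\<^sup>2 / B x \<Longrightarrow> A = B x"
proof -
  have A: "0 < A" using assms by simp
  have eq: "B x + (R x)\<^sup>2 / B x - (A + (R x)\<^sup>2 / A) = (B x - A) * (1 - (R x)\<^sup>2 / (A * B x))"
    using A B_bounds(3)[of x] by (simp add: field_simps)
  have U: "0 < (U x)\<^sup>2" using U_pos[OF assms(1,2)] by simp
  have R2: "(R x)\<^sup>2 = (V x)\<^sup>2 / (U x)\<^sup>2" by (simp add: R_def power_divide)
  have "(B x - A) * (1 - (R x)\<^sup>2 / (A * B x)) \<ge> 0 \<and>
     (x \<notin> switches \<longrightarrow> (B x - A) * (1 - (R x)\<^sup>2 / (A * B x)) = 0 \<longrightarrow> A = B x)"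
  proof (cases "even (cell x)")
    case True
    then have B: "B x = 1" by (simp add: B_def)
    have 1: "s\<^sup>2 \<le> (R x)\<^sup>2" using V_U_compare(1)[OF True] U unfolding R2 by (simp add: field_simps)
    have 2: "s\<^sup>2 < (R x)\<^sup>2" if "x \<notin> switches" using V_U_compare(3)[OF True that] U unfolding R2 by (simp add: field_simps)
    have "1 - (R x)\<^sup>2 / (A * B x) \<le> 0" "x \<notin> switches \<Longrightarrow> 1 - (R x)\<^sup>2 / (A * B x) < 0"
      using 1 2 A assms(4) B by (auto simp: field_simps)
    then show ?thesis using assms(3) B by (auto intro!: mult_nonpos_nonpos)
  next
    case False
    then have B: "B x = s\<^sup>2" by (simp add: B_def)
    have 1: "(R x)\<^sup>2 \<le> s\<^sup>2" using V_U_compare(2)[OF False] U unfolding R2 by (simp add: field_simps)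
    have 2: "(R x)\<^sup>2 < s\<^sup>2" if "x \<notin> switches" using V_U_compare(4)[OF False that] U unfolding R2 by (simp add: field_simps)
    have "s\<^sup>2 * 1 \<le> s\<^sup>2 * A" using assms(3) by (intro mult_left_mono) auto
    then have "(R x)\<^sup>2 \<le> A * B x" "x \<notin> switches \<Longrightarrow> (R x)\<^sup>2 < A * B x"
      using 1 2 B by (auto simp: mult.commute)
    moreover have "0 < A * B x" using A B_bounds(3)[of x] by simp
    ultimately have "1 - (R x)\<^sup>2 / (A * B x) \<ge> 0" "x \<notin> switches \<Longrightarrow> 1 - (R x)\<^sup>2 / (A * B x) > 0"
      by auto
    moreover have "0 \<le> B x - A" using assms(4) B by simp
    ultimately show ?thesis by (metis less_irrefl mult_nonneg_nonneg mult_eq_0_iff right_minus_eq)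
  qed
  then show "A + (R x)\<^sup>2 / A \<le> B x + (R x)\<^sup>2 / B x"
    "x \<notin> switches \<Longrightarrow> A + (R x)\<^sup>2 / A = B x + (R x)\<^sup>2 / B x \<Longrightarrow> A = B x"
    using eq by auto
qed

lemma primitive_R:
  assumes "0 < y" "z < 4 * al"
  shows "primitive_on {y..z} R (\<lambda>x. - (B x + (R x)\<^sup>2 / B x))"
proof -
  have pos: "U x > 0" if "x \<in> {y..z}" for x using that assms by (intro U_pos) auto
  have c: "continuous_on {y..z} R" unfolding R_def
    by (intro continuous_intros continuous_on_U continuous_on_V) (use pos in force)
  then obtain K where K: "\<And>x. x \<in> {y..z} \<Longrightarrow> \<bar>R x\<bar> \<le> K" using continuous_on_Icc_bounded by blast
  show ?thesis
  proof (rule primitive_onI_DERIV[OF finite_switches[of y z] c])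
    fix x assume x: "y < x" "x < z" "x \<notin> switches \<inter> {y..z}"
    then have "x \<notin> switches" "U x \<noteq> 0" using pos[of x] by auto
    then show "(R has_real_derivative - (B x + (R x)\<^sup>2 / B x)) (at x)"
      unfolding R_def using B_bounds(3)[of x]
      by (auto intro!: derivative_eq_intros DERIV_U DERIV_V simp: field_simps power2_eq_square)
  next
    fix x assume x: "x \<in> {y..z}"
    have "(R x)\<^sup>2 / B x \<le> K\<^sup>2 / 1"
      using K[OF x] B_bounds[of x] by (intro frac_le) (auto simp: abs_le_square_iff[symmetric])
    then show "\<bar>- (B x + (R x)\<^sup>2 / B x)\<bar> \<le> s\<^sup>2 + K\<^sup>2"
      using B_bounds[of x] divide_nonneg_pos[OF zero_le_power2[of "R x"] B_bounds(3)[of x]] by linarith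
  qed simp
qed

text \<open>This bound and the next symmetry control \<open>R\<close> near the two zeros 0 and \<open>4 * al\<close> of \<open>U\<close>, where it has
  its poles.\<close>
lemma R_near_0: "0 < y \<Longrightarrow> y \<le> al \<Longrightarrow> R y \<le> 1 / y"
proof -
  assume y: "0 < y" "y \<le> al"
  have "U y = sin y" "V y = cos y"
    using U_eq_piece[of 0 y] V_eq_piece[of 0 y] y s_pos by (auto simp: piece_def)
  moreover have "0 < sin y" "0 < cos y" using y al_lt by (auto intro!: sin_gt_zero cos_gt_zero)
  moreover have "y * cos y \<le> sin y"
  proof -
    have "sin 0 - 0 * cos 0 \<le> sin y - y * cos y"
    proof (rule DERIV_nonneg_imp_nondecreasing[where f = "\<lambda>t. sin t - t * cos t"])
      fix t assume "0 \<le> t" "t \<le> y"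
      then have "0 \<le> t * sin t" using y al_lt by (auto intro!: mult_nonneg_nonneg sin_ge_zero)
      moreover have "((\<lambda>t. sin t - t * cos t) has_real_derivative t * sin t) (at t)"
        by (auto intro!: derivative_eq_intros)
      ultimately show "\<exists>d. ((\<lambda>t. sin t - t * cos t) has_real_derivative d) (at t) \<and> 0 \<le> d" by blast
    qed (use y in auto)
    then show ?thesis by simp
  qed
  ultimately show ?thesis using y by (simp add: R_def field_simps)
qed

lemma R_reflect: "R (4 * al - x) = - R x" if x: "0 \<le> x" "x \<le> al"
proof -
  have "U x = sin x" "V x = cos x" "U (4 * al - x) = sin x" "V (4 * al - x) = - cos x"
    using U_eq_piece[of 0 x] V_eq_piece[of 0 x] U_eq_piece[of 2 "4 * al - x"] V_eq_piece[of 2 "4 * al - x"] x s_pos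
    by (auto simp: piece_def)
  then show ?thesis by (simp add: R_def)
qed

end


section \<open>The Dirichlet problem on half a period\<close>

text \<open>The value type is arbitrary so that the lemma also applies to periodic predicates.\<close>
lemma periodic_int:
  fixes f :: "real \<Rightarrow> 'b"
  assumes "\<And>x. f (x + l) = f x"
  shows "f (x + of_int n * l) = f x"
proof -
  have nat: "f (x + of_nat k * l) = f x" for k x
  proof (induction k)
    case (Suc k)
    then show ?case using assms[of "x + of_nat k * l"] by (simp add: algebra_simps)
  qed simp
  show ?thesis
  proof (cases "n \<ge> 0")
    case True then show ?thesis using nat[of x "nat n"] by simp
  next
    case False then show ?thesis using nat[of "x + of_int n * l" "nat (- n)"] by simp
  qed
qed

lemma ex_period_window:
  fixes l :: real
  assumes "l > 0"
  obtains n :: int where "a \<le> x + of_int n * l" "x + of_int n * l < a + l"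
proof -
  define n where "n = - \<lfloor>(x - a) / l\<rfloor>"
  have "of_int \<lfloor>(x - a) / l\<rfloor> \<le> (x - a) / l" "(x - a) / l < of_int \<lfloor>(x - a) / l\<rfloor> + 1" by linarith+
  then have "of_int \<lfloor>(x - a) / l\<rfloor> * l \<le> x - a" "x - a < (of_int \<lfloor>(x - a) / l\<rfloor> + 1) * l"
    using assms by (simp_all only: pos_le_divide_eq[symmetric] pos_divide_less_eq[symmetric])
  then have "a \<le> x + of_int n * l" "x + of_int n * l < a + l" by (simp_all add: n_def algebra_simps)
  then show ?thesis by (rule that)
qed

lemma AE_periodic:
  fixes P :: "real \<Rightarrow> bool"
  assumes [measurable]: "Measurable.pred borel P" and l: "l > 0" and per: "\<And>x. P (x + l) = P x"
    and ae: "AE x in lborel. a \<le> x \<longrightarrow> x \<le> a + l \<longrightarrow> P x"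
  shows "AE x in lborel. P x"
proof -
  have "AE x in lborel. a \<le> of_int n * l + 1 * x \<longrightarrow> of_int n * l + 1 * x \<le> a + l \<longrightarrow> P (of_int n * l + 1 * x)" for n :: int
    by (rule AE_borel_affine[OF _ _ ae]) auto
  then have "AE x in lborel. \<forall>n::int. a \<le> x + of_int n * l \<longrightarrow> x + of_int n * l \<le> a + l \<longrightarrow> P (x + of_int n * l)"
    unfolding AE_all_countable by (simp add: add.commute)
  then show ?thesis
  proof eventually_elim
    case (elim x)
    obtain n :: int where "a \<le> x + of_int n * l" "x + of_int n * l < a + l" using ex_period_window[OF l] .
    then show ?case using elim periodic_int[of P, OF per] by auto
  qed
qed

text \<open>With the mean slope \<open>m\<close> this is the integral of \<open>G\<^sup>2 \<ge> 2 * m * G - m\<^sup>2\<close>.\<close>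
lemma cauchy_schwarz_increment:
  assumes W: "primitive_on {a..b} W G" and "a < b" and sq: "set_integrable lborel {a..b} (\<lambda>x. (G x)\<^sup>2)"
  shows "(W b - W a)\<^sup>2 \<le> (b - a) * (LINT x:{a..b}|lborel. (G x)\<^sup>2)"
proof -
  define m where "m = (W b - W a) / (b - a)"
  have G: "set_integrable lborel {a..b} G" "(LINT x:{a..b}|lborel. G x) = W b - W a"
    using primitive_onD[OF W, of a b] \<open>a < b\<close> by auto
  have c: "set_integrable lborel {a..b} (\<lambda>_. m\<^sup>2)" by (rule set_integrable_continuous_Icc) auto
  have int: "set_integrable lborel {a..b} (\<lambda>x. 2 * m * G x - m\<^sup>2)"
    using G(1) c by (intro set_integral_diff(1)) auto
  have "(LINT x:{a..b}|lborel. 2 * m * G x - m\<^sup>2) \<le> (LINT x:{a..b}|lborel. (G x)\<^sup>2)"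
  proof (rule set_integral_mono[OF int sq])
    fix x show "2 * m * G x - m\<^sup>2 \<le> (G x)\<^sup>2" using zero_le_power2[of "G x - m"] unfolding power2_diff by (simp add: algebra_simps)
  qed
  also have "(LINT x:{a..b}|lborel. 2 * m * G x - m\<^sup>2) = 2 * m * (W b - W a) - m\<^sup>2 * (b - a)"
    using G c \<open>a < b\<close> by (subst set_integral_diff(2)) (auto simp: set_integral_const)
  finally have "(b - a) * (2 * m * (W b - W a) - m\<^sup>2 * (b - a)) \<le> (b - a) * (LINT x:{a..b}|lborel. (G x)\<^sup>2)"
    using \<open>a < b\<close> by (intro mult_left_mono) auto
  moreover have "(b - a) * (2 * m * (W b - W a) - m\<^sup>2 * (b - a)) = (W b - W a)\<^sup>2"
  proof -
    have "W b - W a = m * (b - a)" using \<open>a < b\<close> by (simp add: m_def)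
    then show ?thesis unfolding \<open>W b - W a = m * (b - a)\<close> by (simp add: power2_eq_square algebra_simps)
  qed
  ultimately show ?thesis by simp
qed

context bang_bang begin

lemma null_switches: "AE x in lborel. x \<notin> switches"
  by (rule AE_not_in) (auto simp: switches_def intro: countable_imp_null_set_lborel)

definition weight :: "(real \<Rightarrow> real) \<Rightarrow> bool" where
  "weight A \<longleftrightarrow> A \<in> borel_measurable borel \<and> (\<forall>x. 1 \<le> A x \<and> A x \<le> s\<^sup>2)"

lemma weightD:
  assumes "weight A"
  shows "A \<in> borel_measurable borel" "1 \<le> A x" "A x \<le> s\<^sup>2" "0 < A x" "\<bar>A x\<bar> \<le> s\<^sup>2"
proof -
  have "1 \<le> A x" "A x \<le> s\<^sup>2" using assms by (auto simp: weight_def)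
  then show "1 \<le> A x" "A x \<le> s\<^sup>2" "0 < A x" "\<bar>A x\<bar> \<le> s\<^sup>2" by auto
qed (use assms in \<open>auto simp: weight_def\<close>)

lemma weight_mult_integrable:
  assumes "weight A" "set_integrable lborel {x..y} f"
  shows "set_integrable lborel {x..y} (\<lambda>t. A t * f t)"
proof -
  have "set_integrable lborel {x..y} (\<lambda>t. f t * A t)"
    using weightD[OF assms(1)]
    by (intro set_integrable_mult_bounded[OF assms(2), where C="s\<^sup>2"]) (auto simp: set_borel_measurable_def)
  then show ?thesis by (simp add: mult.commute)
qed

text \<open>What remains of \<open>A G\<^sup>2 - A W\<^sup>2\<close>, for \<open>G = W'\<close>, once the exact derivative \<open>(R W\<^sup>2)'\<close> is split off. The first
  term is the slack in the Riccati inequality, the second one completes the square.\<close>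
definition excess :: "(real \<Rightarrow> real) \<Rightarrow> (real \<Rightarrow> real) \<Rightarrow> (real \<Rightarrow> real) \<Rightarrow> real \<Rightarrow> real" where
  "excess A W G x = (B x + (R x)\<^sup>2 / B x - (A x + (R x)\<^sup>2 / A x)) * (W x)\<^sup>2 + A x * (G x - R x * W x / A x)\<^sup>2"

lemma excess_nonneg:
  assumes "weight A" "0 < x" "x < 4 * al"
  shows "0 \<le> excess A W G x"
  unfolding excess_def using riccati_slack(1)[OF assms(2,3) weightD(2,3)[OF assms(1)]] weightD(4)[OF assms(1), of x]
  by (intro add_nonneg_nonneg mult_nonneg_nonneg) auto

text \<open>Integrate \<open>A G\<^sup>2 - A W\<^sup>2 = (R W\<^sup>2)' + excess\<close> over \<open>[e, 4 * al - e]\<close>. The boundary terms have the wrong sign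
  but are paid for by the end pieces: \<open>R e \<le> 1 / e\<close>, and \<open>(W e)\<^sup>2\<close> is at most \<open>e\<close> times the integral of
  \<open>A G\<^sup>2\<close> over \<open>[0, e]\<close>. So only the integral of \<open>A W\<^sup>2\<close> over the end pieces is lost, and it tends to 0.\<close>
lemma dirichlet_excess:
  assumes A: "weight A" and W: "primitive_on {0..4 * al} W G"
    and sq: "set_integrable lborel {0..4 * al} (\<lambda>x. (G x)\<^sup>2)"
    and bc: "W 0 = 0" "W (4 * al) = 0"
    and yz: "0 < y" "y \<le> z" "z < 4 * al"
  shows "set_integrable lborel {y..z} (excess A W G)"
    and "(LINT x:{y..z}|lborel. excess A W G x)
      \<le> (LINT x:{0..4 * al}|lborel. A x * (G x)\<^sup>2) - (LINT x:{0..4 * al}|lborel. A x * (W x)\<^sup>2)"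
proof -
  let ?L = "4 * al"
  note cW = primitive_on_continuous[OF W]
  have AG: "set_integrable lborel {0..?L} (\<lambda>x. A x * (G x)\<^sup>2)" by (rule weight_mult_integrable[OF A sq])
  have AW: "set_integrable lborel {0..?L} (\<lambda>x. A x * (W x)\<^sup>2)"
    by (intro weight_mult_integrable[OF A] set_integrable_continuous_Icc continuous_intros cW)
  define h where "h x = - (B x + (R x)\<^sup>2 / B x) * (W x * W x) + R x * (G x * W x + W x * G x)" for x
  have inner: "set_integrable lborel {u..v} (excess A W G) \<and> (LINT x:{u..v}|lborel. excess A W G x)
      = (LINT x:{u..v}|lborel. A x * (G x)\<^sup>2) - (LINT x:{u..v}|lborel. A x * (W x)\<^sup>2)
        - (R v * (W v)\<^sup>2 - R u * (W u)\<^sup>2)" if uv: "0 < u" "u \<le> v" "v < ?L" for u v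
  proof -
    have Wuv: "primitive_on {u..v} W G" by (rule primitive_on_subset[OF W]) (use uv in auto)
    have "primitive_on {u..v} (\<lambda>x. R x * (W x * W x)) h"
      unfolding h_def using primitive_on_mult[OF primitive_R[OF uv(1,3)] primitive_on_mult[OF Wuv Wuv]] .
    from primitive_onD[OF this, of u v] uv
    have h: "set_integrable lborel {u..v} h" "(LINT x:{u..v}|lborel. h x) = R v * (W v)\<^sup>2 - R u * (W u)\<^sup>2"
      by (auto simp: power2_eq_square)
    have i: "set_integrable lborel {u..v} (\<lambda>x. A x * (G x)\<^sup>2)" "set_integrable lborel {u..v} (\<lambda>x. A x * (W x)\<^sup>2)"
      by (rule set_integrable_subset[OF AG] set_integrable_subset[OF AW]; use uv in auto)+
    have "excess A W G x = A x * (G x)\<^sup>2 - A x * (W x)\<^sup>2 - h x" for x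
    proof -
      have "A x \<noteq> 0" using weightD(4)[OF A, of x] by simp
      then have "A x * (G x - R x * W x / A x)\<^sup>2 = A x * (G x)\<^sup>2 - 2 * (G x * R x * W x) + (R x)\<^sup>2 / A x * (W x)\<^sup>2"
        by (simp add: power2_eq_square field_simps)
      then show ?thesis unfolding excess_def h_def by (simp add: power2_eq_square algebra_simps)
    qed
    then have eq: "excess A W G = (\<lambda>x. A x * (G x)\<^sup>2 - A x * (W x)\<^sup>2 - h x)" by auto
    show ?thesis unfolding eq using i h by (simp add: set_integral_diff)
  qed
  show "set_integrable lborel {y..z} (excess A W G)" using inner[OF yz] by simp
  have AGsub: "set_integrable lborel {u..v} (\<lambda>x. A x * (G x)\<^sup>2)" if "0 \<le> u" "v \<le> ?L" for u v
    by (rule set_integrable_subset[OF AG]) (use that in auto)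
  have AWsub: "set_integrable lborel {u..v} (\<lambda>x. A x * (W x)\<^sup>2)" if "0 \<le> u" "v \<le> ?L" for u v
    by (rule set_integrable_subset[OF AW]) (use that in auto)
  have CS: "(W v - W u)\<^sup>2 \<le> (v - u) * (LINT x:{u..v}|lborel. A x * (G x)\<^sup>2)" if uv: "0 \<le> u" "u < v" "v \<le> ?L" for u v
  proof -
    have sq': "set_integrable lborel {u..v} (\<lambda>x. (G x)\<^sup>2)" by (rule set_integrable_subset[OF sq]) (use uv in auto)
    have "primitive_on {u..v} W G" by (rule primitive_on_subset[OF W]) (use uv in auto)
    from cauchy_schwarz_increment[OF this uv(2) sq']
    have "(W v - W u)\<^sup>2 \<le> (v - u) * (LINT x:{u..v}|lborel. (G x)\<^sup>2)" .
    also have "\<dots> \<le> (v - u) * (LINT x:{u..v}|lborel. A x * (G x)\<^sup>2)"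
    proof (intro mult_left_mono set_integral_mono[OF sq' AGsub])
      show "(G x)\<^sup>2 \<le> A x * (G x)\<^sup>2" for x
        using mult_right_mono[OF weightD(2)[OF A, of x], of "(G x)\<^sup>2"] by simp
    qed (use uv in auto)
    finally show ?thesis .
  qed
  have left: "R u * (W u)\<^sup>2 \<le> (LINT x:{0..u}|lborel. A x * (G x)\<^sup>2)" if u: "0 < u" "u \<le> al" for u
  proof -
    have "R u * (W u)\<^sup>2 \<le> 1 / u * (W u)\<^sup>2" using R_near_0[OF u] by (intro mult_right_mono) auto
    also have "\<dots> \<le> (LINT x:{0..u}|lborel. A x * (G x)\<^sup>2)" using CS[of 0 u] u bc al_pos by (simp add: field_simps)
    finally show ?thesis .
  qed
  have right: "- (R (?L - u) * (W (?L - u))\<^sup>2) \<le> (LINT x:{?L - u..?L}|lborel. A x * (G x)\<^sup>2)" if u: "0 < u" "u \<le> al" for u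
  proof -
    have "- (R (?L - u) * (W (?L - u))\<^sup>2) = R u * (W (?L - u))\<^sup>2" using R_reflect[of u] u by simp
    also have "\<dots> \<le> 1 / u * (W (?L - u))\<^sup>2" using R_near_0[OF u] by (intro mult_right_mono) auto
    also have "\<dots> \<le> (LINT x:{?L - u..?L}|lborel. A x * (G x)\<^sup>2)" using CS[of "?L - u" ?L] u bc al_pos by (simp add: field_simps)
    finally show ?thesis .
  qed
  obtain K0 where K0: "\<And>t. t \<in> {0..?L} \<Longrightarrow> \<bar>W t\<bar> \<le> K0" using continuous_on_Icc_bounded[OF cW] by blast
  \<comment> \<open>A bound for \<open>A W\<^sup>2\<close>, hence for the loss on the end pieces.\<close>
  define K where "K = s\<^sup>2 * K0\<^sup>2"
  have AWK: "A x * (W x)\<^sup>2 \<le> K" if "x \<in> {0..?L}" for x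
    unfolding K_def using K0[OF that] weightD(2-5)[OF A, of x]
    by (intro mult_mono) (auto simp: abs_le_square_iff[symmetric])
  have AWint: "(LINT x:{u..v}|lborel. A x * (W x)\<^sup>2) \<le> K * (v - u)" if uv: "0 \<le> u" "u \<le> v" "v \<le> ?L" for u v
  proof -
    have "(LINT x:{u..v}|lborel. A x * (W x)\<^sup>2) \<le> (LINT x:{u..v}|lborel. K)"
      by (intro set_integral_mono AWsub set_integrable_continuous_Icc AWK) (use uv in auto)
    then show ?thesis using uv by (simp add: set_integral_const mult.commute)
  qed
  define D where "D = (LINT x:{0..?L}|lborel. A x * (G x)\<^sup>2) - (LINT x:{0..?L}|lborel. A x * (W x)\<^sup>2)"
  have est: "(LINT x:{y..z}|lborel. excess A W G x) \<le> D + 2 * K * e"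
    if e: "0 < e" "e \<le> al" "e \<le> y" "z \<le> ?L - e" for e
  proof -
    have uv: "0 < e" "e \<le> ?L - e" "?L - e < ?L" using e yz by auto
    have "(LINT x:{y..z}|lborel. excess A W G x) \<le> (LINT x:{e..?L - e}|lborel. excess A W G x)"
      using inner[OF uv] e yz by (intro LINT_Icc_mono_set) (auto intro!: excess_nonneg A)
    also have "\<dots> = (LINT x:{e..?L - e}|lborel. A x * (G x)\<^sup>2) - (LINT x:{e..?L - e}|lborel. A x * (W x)\<^sup>2)
        - (R (?L - e) * (W (?L - e))\<^sup>2 - R e * (W e)\<^sup>2)" using inner[OF uv] by simp
    also have "\<dots> \<le> (LINT x:{0..?L}|lborel. A x * (G x)\<^sup>2) - (LINT x:{e..?L - e}|lborel. A x * (W x)\<^sup>2)"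
      using left[OF e(1,2)] right[OF e(1,2)] LINT_Icc_split[OF AG, of e] LINT_Icc_split[OF AGsub[of e ?L], of "?L - e"] uv
      by auto
    also have "\<dots> \<le> D + 2 * K * e"
      using LINT_Icc_split[OF AW, of e] LINT_Icc_split[OF AWsub[of e ?L], of "?L - e"] uv
        AWint[of 0 e] AWint[of "?L - e" ?L] unfolding D_def by auto
    finally show ?thesis .
  qed
  have "(LINT x:{y..z}|lborel. excess A W G x) \<le> D"
  proof (rule field_le_epsilon)
    fix d :: real assume d: "0 < d"
    have "0 \<le> K" using s_pos by (simp add: K_def)
    define e where "e = min (min al (d / (2 * K + 1))) (min y (?L - z))"
    have "0 < e" using al_pos d yz \<open>0 \<le> K\<close> by (simp add: e_def)
    have "2 * K * e \<le> (2 * K + 1) * (d / (2 * K + 1))"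
      using \<open>0 \<le> K\<close> \<open>0 < e\<close> by (intro mult_mono) (auto simp: e_def)
    then have "2 * K * e \<le> d" using \<open>0 \<le> K\<close> by simp
    moreover have "(LINT x:{y..z}|lborel. excess A W G x) \<le> D + 2 * K * e"
      by (rule est[OF \<open>0 < e\<close>]) (auto simp: e_def)
    ultimately show "(LINT x:{y..z}|lborel. excess A W G x) \<le> D + d" by linarith
  qed
  then show "(LINT x:{y..z}|lborel. excess A W G x)
      \<le> (LINT x:{0..?L}|lborel. A x * (G x)\<^sup>2) - (LINT x:{0..?L}|lborel. A x * (W x)\<^sup>2)" by (simp add: D_def)
qed

lemma dirichlet_inequality:
  assumes "weight A" "primitive_on {0..4 * al} W G"
    and "set_integrable lborel {0..4 * al} (\<lambda>x. (G x)\<^sup>2)" "W 0 = 0" "W (4 * al) = 0"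
  shows "(LINT x:{0..4 * al}|lborel. A x * (W x)\<^sup>2) \<le> (LINT x:{0..4 * al}|lborel. A x * (G x)\<^sup>2)"
proof -
  have y: "0 < 2 * al" "2 * al < 4 * al" using al_pos by auto
  have "0 \<le> (LINT x:{2 * al..2 * al}|lborel. excess A W G x)"
    unfolding set_lebesgue_integral_def
    by (rule Bochner_Integration.integral_nonneg) (use y excess_nonneg[OF assms(1)] in \<open>auto simp: indicator_def\<close>)
  then show ?thesis using dirichlet_excess(2)[OF assms y(1) order_refl y(2)] by linarith
qed

text \<open>The excess vanishes almost everywhere. Its second term gives \<open>G = R W / A\<close>, its first term gives
  \<open>A = B\<close> wherever \<open>W\<close> is not 0. So \<open>G = R W / B\<close> throughout, which says that \<open>W / U\<close> has derivative 0.\<close>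
lemma dirichlet_equality:
  assumes A: "weight A" and W: "primitive_on {0..4 * al} W G" and [measurable]: "G \<in> borel_measurable borel" "W \<in> borel_measurable borel"
    and sq: "set_integrable lborel {0..4 * al} (\<lambda>x. (G x)\<^sup>2)"
    and bc: "W 0 = 0" "W (4 * al) = 0"
    and eq: "(LINT x:{0..4 * al}|lborel. A x * (G x)\<^sup>2) = (LINT x:{0..4 * al}|lborel. A x * (W x)\<^sup>2)"
  obtains K where "\<And>x. 0 \<le> x \<Longrightarrow> x \<le> 4 * al \<Longrightarrow> W x = K * U x"
    and "K \<noteq> 0 \<Longrightarrow> AE x in lborel. 0 \<le> x \<longrightarrow> x \<le> 4 * al \<longrightarrow> A x = B x"
proof -
  have [measurable]: "A \<in> borel_measurable borel" by (rule weightD(1)[OF A])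
  have [measurable]: "excess A W G \<in> borel_measurable borel" unfolding excess_def by measurable
  have AEyz: "AE x in lborel. y \<le> x \<longrightarrow> x \<le> z \<longrightarrow> excess A W G x = 0" if yz: "0 < y" "y \<le> z" "z < 4 * al" for y z
  proof -
    have nn: "0 \<le> indicator {y..z} x *\<^sub>R excess A W G x" for x
      using excess_nonneg[OF A, of x W G] yz by (auto simp: indicator_def)
    have i: "integrable lborel (\<lambda>x. indicator {y..z} x *\<^sub>R excess A W G x)"
      using dirichlet_excess(1)[OF A W sq bc yz] by (simp add: set_integrable_def)
    have "(LINT x|lborel. indicator {y..z} x *\<^sub>R excess A W G x) \<le> 0"
      using dirichlet_excess(2)[OF A W sq bc yz] eq by (simp add: set_lebesgue_integral_def)
    moreover have "(LINT x|lborel. indicator {y..z} x *\<^sub>R excess A W G x) \<ge> 0"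
      by (rule Bochner_Integration.integral_nonneg) (rule nn)
    ultimately have "(LINT x|lborel. indicator {y..z} x *\<^sub>R excess A W G x) = 0" by simp
    then have "AE x in lborel. indicator {y..z} x *\<^sub>R excess A W G x = 0"
      by (subst (asm) integral_nonneg_eq_0_iff_AE[OF i]) (use nn in auto)
    then show ?thesis by eventually_elim (auto simp: indicator_def)
  qed
  \<comment> \<open>The intervals \<open>[d n, 4 * al - d n]\<close> exhaust the open interval.\<close>
  define d where "d n = 2 * al / (real n + 1)" for n
  have d: "0 < d n" "d n \<le> 4 * al - d n" "4 * al - d n < 4 * al" for n
  proof -
    have "d n \<le> 2 * al / 1" unfolding d_def using al_pos by (intro divide_left_mono) auto
    then show "0 < d n" "d n \<le> 4 * al - d n" "4 * al - d n < 4 * al" using al_pos by (auto simp: d_def)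
  qed
  have "AE x in lborel. \<forall>n. d n \<le> x \<longrightarrow> x \<le> 4 * al - d n \<longrightarrow> excess A W G x = 0"
    unfolding AE_all_countable using AEyz[OF d] by blast
  then have AE0: "AE x in lborel. 0 < x \<longrightarrow> x < 4 * al \<longrightarrow> excess A W G x = 0"
  proof eventually_elim
    case (elim x)
    show ?case
    proof (intro impI)
      assume x: "0 < x" "x < 4 * al"
      define m where "m = min x (4 * al - x)"
      have "0 < m" using x by (simp add: m_def)
      obtain n where "2 * al / m < real n" using reals_Archimedean2 by blast
      then have "2 * al \<le> m * (real n + 1)" using \<open>0 < m\<close> by (simp add: field_simps)
      then have "d n \<le> m" unfolding d_def by (simp add: pos_divide_le_eq)
      then show "excess A W G x = 0" using elim by (auto simp: m_def)
    qed
  qed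
  have AE1: "AE x in lborel. 0 < x \<longrightarrow> x < 4 * al \<longrightarrow> (W x = 0 \<or> A x = B x) \<and> G x = R x * W x / B x"
    using AE0 null_switches
  proof eventually_elim
    case (elim x)
    show ?case
    proof (intro impI)
      assume x: "0 < x" "x < 4 * al"
      let ?S = "B x + (R x)\<^sup>2 / B x - (A x + (R x)\<^sup>2 / A x)"
      have Ax: "1 \<le> A x" "A x \<le> s\<^sup>2" "0 < A x" using weightD(2-5)[OF A, of x] by auto
      note slack = riccati_slack[OF x Ax(1,2)]
      have "0 \<le> ?S * (W x)\<^sup>2" "0 \<le> A x * (G x - R x * W x / A x)\<^sup>2"
        using slack(1) Ax by auto
      moreover have "?S * (W x)\<^sup>2 + A x * (G x - R x * W x / A x)\<^sup>2 = 0"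
        using elim x by (simp add: excess_def)
      ultimately have "?S * (W x)\<^sup>2 = 0" "A x * (G x - R x * W x / A x)\<^sup>2 = 0" by linarith+
      then have "W x = 0 \<or> A x = B x" "G x = R x * W x / A x" using slack(2) elim Ax by auto
      then show "(W x = 0 \<or> A x = B x) \<and> G x = R x * W x / B x" by auto
    qed
  qed
  define K where "K = W (2 * al) / U (2 * al)"
  have const: "W z / U z = W y / U y" if yz: "0 < y" "y \<le> z" "z < 4 * al" for y z
  proof -
    have pos: "U x > 0" if "x \<in> {y..z}" for x using that yz by (intro U_pos) auto
    have cU: "continuous_on {y..z} (\<lambda>x. 1 / U x)"
      by (intro continuous_intros continuous_on_U) (use pos in force)
    have cD: "continuous_on {y..z} (\<lambda>x. \<bar>V x\<bar> / (U x)\<^sup>2)"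
      by (intro continuous_intros continuous_on_U continuous_on_V) (use pos in force)
    then obtain C where C: "\<And>x. x \<in> {y..z} \<Longrightarrow> \<bar>\<bar>V x\<bar> / (U x)\<^sup>2\<bar> \<le> C" using continuous_on_Icc_bounded by blast
    have "primitive_on {y..z} (\<lambda>x. 1 / U x) (\<lambda>x. - (V x / B x) / (U x)\<^sup>2)"
    proof (rule primitive_onI_DERIV[OF finite_switches[of y z] cU])
      fix x assume x: "y < x" "x < z" "x \<notin> switches \<inter> {y..z}"
      then have "x \<notin> switches" "U x \<noteq> 0" using pos[of x] by auto
      then show "((\<lambda>x. 1 / U x) has_real_derivative - (V x / B x) / (U x)\<^sup>2) (at x)"
        by (auto intro!: derivative_eq_intros DERIV_U simp: power2_eq_square)
    next
      fix x assume x: "x \<in> {y..z}"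
      have "\<bar>V x\<bar> / (U x)\<^sup>2 / B x \<le> C / 1"
        using C[OF x] B_bounds[of x] order_trans[OF abs_ge_zero C[OF x]] by (intro frac_le) auto
      then show "\<bar>- (V x / B x) / (U x)\<^sup>2\<bar> \<le> C" using B_bounds[of x] by (simp add: abs_mult field_simps)
    qed measurable
    then have "primitive_on {y..z} (\<lambda>x. W x * (1 / U x)) (\<lambda>x. G x * (1 / U x) + W x * (- (V x / B x) / (U x)\<^sup>2))"
      by (intro primitive_on_mult primitive_on_subset[OF W]) (use yz in auto)
    from primitive_onD(2)[OF this, of y z] yz
    have "W z / U z - W y / U y = (LINT x:{y..z}|lborel. G x * (1 / U x) + W x * (- (V x / B x) / (U x)\<^sup>2))" by simp
    also have "\<dots> = (LINT x:{y..z}|lborel. 0)"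
    proof (rule set_lebesgue_integral_cong_AE)
      show "AE x\<in>{y..z} in lborel. G x * (1 / U x) + W x * (- (V x / B x) / (U x)\<^sup>2) = 0"
        using AE1
      proof eventually_elim
        case (elim x)
        show ?case
        proof
          assume x: "x \<in> {y..z}"
          then have "G x = R x * W x / B x" using elim yz by auto
          then show "G x * (1 / U x) + W x * (- (V x / B x) / (U x)\<^sup>2) = 0"
            using pos[OF x] by (simp add: R_def power2_eq_square)
        qed
      qed
    qed auto
    finally show ?thesis by simp
  qed
  have WK: "W x = K * U x" if x: "0 < x" "x < 4 * al" for x
  proof -
    have "W x / U x = K"
      unfolding K_def using const[of x "2 * al"] const[of "2 * al" x] x al_pos
      by (cases "x \<le> 2 * al") auto
    then show ?thesis using U_pos[OF x] by (simp add: field_simps)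
  qed
  show thesis
  proof
    show "W x = K * U x" if "0 \<le> x" "x \<le> 4 * al" for x
      using WK[of x] that bc U_0 U_shift4[of 0] by (cases "x = 0"; cases "x = 4 * al") auto
    assume "K \<noteq> 0"
    have "AE x in lborel. x \<noteq> c" for c :: real
      using AE_not_in[of "{c}" lborel] by (auto intro: countable_imp_null_set_lborel)
    from AE1 this[of 0] this[of "4 * al"] show "AE x in lborel. 0 \<le> x \<longrightarrow> x \<le> 4 * al \<longrightarrow> A x = B x"
    proof eventually_elim
      case (elim x)
      show ?case
      proof (intro impI)
        assume "0 \<le> x" "x \<le> 4 * al"
        then have x: "0 < x" "x < 4 * al" using elim by auto
        have "W x \<noteq> 0" using WK[OF x] U_pos[OF x] \<open>K \<noteq> 0\<close> by simp
        then show "A x = B x" using elim x by auto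
      qed
    qed
  qed
qed

end


section \<open>The periodic problem\<close>

context bang_bang begin

definition periodic_weight :: "(real \<Rightarrow> real) \<Rightarrow> bool" where
  "periodic_weight A \<longleftrightarrow> weight A \<and> (\<forall>x. A (x + 8 * al) = A x)"

text \<open>The functions of the normalised variational problem, together with their derivatives.\<close>
definition competitor :: "(real \<Rightarrow> real) \<Rightarrow> (real \<Rightarrow> real) \<Rightarrow> (real \<Rightarrow> real) \<Rightarrow> bool" where
  "competitor A W G \<longleftrightarrow> primitive_on UNIV W G \<and> G \<in> borel_measurable borel \<and>
     (\<forall>x y. set_integrable lborel {x..y} (\<lambda>t. (G t)\<^sup>2)) \<and>
     (\<forall>x. W (x + 8 * al) = W x) \<and> (\<forall>x. G (x + 8 * al) = G x) \<and>
     (LINT x:{0..8 * al}|lborel. A x * W x) = 0"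

lemma competitorD:
  assumes "competitor A W G"
  shows "primitive_on UNIV W G" "G \<in> borel_measurable borel" "set_integrable lborel {x..y} (\<lambda>t. (G t)\<^sup>2)"
    "W (t + 8 * al) = W t" "G (t + 8 * al) = G t" "(LINT x:{0..8 * al}|lborel. A x * W x) = 0"
    "continuous_on S W" "W \<in> borel_measurable borel"
proof -
  show c: "continuous_on S W" for S
    using assms primitive_on_UNIV_continuous unfolding competitor_def by blast
  show "W \<in> borel_measurable borel" by (rule borel_measurable_continuous_onI[OF c])
qed (use assms in \<open>auto simp: competitor_def\<close>)

lemma periodic_weightD:
  assumes "periodic_weight A"
  shows "weight A" "A (x + 8 * al) = A x"
  using assms by (auto simp: periodic_weight_def)

lemma weight_shift: "weight A \<Longrightarrow> weight (\<lambda>x. A (x + c))"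
  unfolding weight_def by (auto intro: measurable_compose_rev[where N=borel])

lemma competitor_integrable:
  assumes A: "periodic_weight A" and W: "competitor A W G"
  shows "set_integrable lborel {x..y} (\<lambda>t. A t * (G t)\<^sup>2)"
    "set_integrable lborel {x..y} (\<lambda>t. A t * (W t - c)\<^sup>2)"
    "set_integrable lborel {x..y} (\<lambda>t. A t * (W t)\<^sup>2)"
    "set_integrable lborel {x..y} (\<lambda>t. A t * W t)"
    "set_integrable lborel {x..y} A"
proof -
  note wt = periodic_weightD(1)[OF A]
  note cW = competitorD(7)[OF W]
  show "set_integrable lborel {x..y} (\<lambda>t. A t * (G t)\<^sup>2)"
    by (rule weight_mult_integrable[OF wt competitorD(3)[OF W]])
  show "set_integrable lborel {x..y} (\<lambda>t. A t * (W t - c)\<^sup>2)"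
    "set_integrable lborel {x..y} (\<lambda>t. A t * (W t)\<^sup>2)"
    "set_integrable lborel {x..y} (\<lambda>t. A t * W t)"
    by (intro weight_mult_integrable[OF wt] set_integrable_continuous_Icc continuous_intros cW)+
  have "set_integrable lborel {x..y} (\<lambda>t. A t * 1)"
    by (intro weight_mult_integrable[OF wt] set_integrable_continuous_Icc continuous_intros)
  then show "set_integrable lborel {x..y} A" by simp
qed

text \<open>The difference \<open>W (x + 4 * al) - W x\<close> takes opposite values at 0 and at \<open>4 * al\<close>.\<close>
lemma equal_at_half_period:
  assumes "competitor A W G"
  obtains x where "0 \<le> x" "x \<le> 4 * al" "W (x + 4 * al) = W x"
proof -
  let ?f = "\<lambda>x. W (x + 4 * al) - W x"
  have c: "continuous_on {0..4 * al} ?f"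
    by (intro continuous_intros continuous_on_compose2[OF competitorD(7)[OF assms, of UNIV]]) auto
  have f: "?f (4 * al) = - ?f 0" using competitorD(4)[OF assms, of 0] by simp
  have "\<exists>x. 0 \<le> x \<and> x \<le> 4 * al \<and> ?f x = 0"
  proof (cases "?f 0 \<le> 0")
    case True
    have "0 \<le> ?f (4 * al)" using True f by linarith
    show ?thesis using IVT'[OF True \<open>0 \<le> ?f (4 * al)\<close> _ c] al_pos by auto
  next
    case False
    have "?f (4 * al) \<le> 0" using False f by linarith
    show ?thesis using IVT2'[OF \<open>?f (4 * al) \<le> 0\<close> _ _ c] False al_pos by auto
  qed
  then show thesis using that by auto
qed

lemma half_period:
  assumes A: "periodic_weight A" and W: "competitor A W G" and c: "W x = c" "W (x + 4 * al) = c"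
  shows "(LINT t:{x..x + 4 * al}|lborel. A t * (W t - c)\<^sup>2) \<le> (LINT t:{x..x + 4 * al}|lborel. A t * (G t)\<^sup>2)"
    and "(LINT t:{x..x + 4 * al}|lborel. A t * (W t - c)\<^sup>2) = (LINT t:{x..x + 4 * al}|lborel. A t * (G t)\<^sup>2) \<Longrightarrow>
      \<exists>K. (\<forall>t. x \<le> t \<longrightarrow> t \<le> x + 4 * al \<longrightarrow> W t - c = K * U (t - x)) \<and>
          (K \<noteq> 0 \<longrightarrow> (AE t in lborel. x \<le> t \<longrightarrow> t \<le> x + 4 * al \<longrightarrow> A t = B (t - x)))"
proof -
  let ?A = "\<lambda>t. A (t + x)" and ?W = "\<lambda>t. W (t + x) - c" and ?G = "\<lambda>t. G (t + x)"
  have [measurable]: "G \<in> borel_measurable borel" "W \<in> borel_measurable borel" "A \<in> borel_measurable borel"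
    using competitorD[OF W] weightD(1)[OF periodic_weightD(1)[OF A]] by auto
  have wt: "weight ?A" by (rule weight_shift[OF periodic_weightD(1)[OF A]])
  have "primitive_on {0 + x..4 * al + x} (\<lambda>t. W t - c) G"
    using primitive_on_subset[OF competitorD(1)[OF W]] by (auto simp: primitive_on_def)
  then have prim: "primitive_on {0..4 * al} ?W ?G"
    using primitive_on_shift[of 0 "4 * al" "\<lambda>t. W t - c" x G] by simp
  have sq: "set_integrable lborel {0..4 * al} (\<lambda>t. (?G t)\<^sup>2)"
    using set_integrable_shift[of 0 "4 * al" "\<lambda>t. (G t)\<^sup>2" x] competitorD(3)[OF W] by simp
  have bc: "?W 0 = 0" "?W (4 * al) = 0" using c by (auto simp: add.commute)
  have sh: "(LINT t:{0..4 * al}|lborel. ?A t * (?W t)\<^sup>2) = (LINT t:{x..x + 4 * al}|lborel. A t * (W t - c)\<^sup>2)"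
    "(LINT t:{0..4 * al}|lborel. ?A t * (?G t)\<^sup>2) = (LINT t:{x..x + 4 * al}|lborel. A t * (G t)\<^sup>2)"
    using LINT_shift[of 0 "4 * al" "\<lambda>t. A t * (W t - c)\<^sup>2" x] LINT_shift[of 0 "4 * al" "\<lambda>t. A t * (G t)\<^sup>2" x]
    by (simp_all add: add.commute)
  show "(LINT t:{x..x + 4 * al}|lborel. A t * (W t - c)\<^sup>2) \<le> (LINT t:{x..x + 4 * al}|lborel. A t * (G t)\<^sup>2)"
    using dirichlet_inequality[OF wt prim sq bc] unfolding sh .
  assume eq: "(LINT t:{x..x + 4 * al}|lborel. A t * (W t - c)\<^sup>2) = (LINT t:{x..x + 4 * al}|lborel. A t * (G t)\<^sup>2)"
  obtain K where K: "\<And>t. 0 \<le> t \<Longrightarrow> t \<le> 4 * al \<Longrightarrow> ?W t = K * U t"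
    and K': "K \<noteq> 0 \<Longrightarrow> AE t in lborel. 0 \<le> t \<longrightarrow> t \<le> 4 * al \<longrightarrow> ?A t = B t"
    using dirichlet_equality[OF wt prim _ _ sq bc] eq unfolding sh by auto
  have "W t - c = K * U (t - x)" if "x \<le> t" "t \<le> x + 4 * al" for t
    using K[of "t - x"] that by simp
  moreover have "AE t in lborel. x \<le> t \<longrightarrow> t \<le> x + 4 * al \<longrightarrow> A t = B (t - x)" if "K \<noteq> 0"
  proof -
    have "AE t in lborel. 0 \<le> - x + 1 * t \<longrightarrow> - x + 1 * t \<le> 4 * al \<longrightarrow> ?A (- x + 1 * t) = B (- x + 1 * t)"
      by (rule AE_borel_affine[OF _ _ K'[OF that]]) auto
    then show ?thesis by eventually_elim (auto simp: algebra_simps)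
  qed
  ultimately show "\<exists>K. (\<forall>t. x \<le> t \<longrightarrow> t \<le> x + 4 * al \<longrightarrow> W t - c = K * U (t - x)) \<and>
          (K \<noteq> 0 \<longrightarrow> (AE t in lborel. x \<le> t \<longrightarrow> t \<le> x + 4 * al \<longrightarrow> A t = B (t - x)))" by blast
qed

lemma sum_of_halves:
  assumes A: "periodic_weight A" and W: "competitor A W G" and x: "0 \<le> x" "x \<le> 4 * al"
  shows "(LINT t:{x..x + 4 * al}|lborel. A t * (G t)\<^sup>2) + (LINT t:{x + 4 * al..x + 8 * al}|lborel. A t * (G t)\<^sup>2)
      = (LINT t:{0..8 * al}|lborel. A t * (G t)\<^sup>2)"
    and "(LINT t:{x..x + 4 * al}|lborel. A t * (W t - c)\<^sup>2) + (LINT t:{x + 4 * al..x + 8 * al}|lborel. A t * (W t - c)\<^sup>2)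
      = (LINT t:{0..8 * al}|lborel. A t * (W t)\<^sup>2) + c\<^sup>2 * (LINT t:{0..8 * al}|lborel. A t)"
    and "(LINT t:{x..x + 4 * al}|lborel. A t * W t) + (LINT t:{x + 4 * al..x + 8 * al}|lborel. A t * W t) = 0"
proof -
  note i = competitor_integrable[OF A W]
  note per = competitorD(4,5)[OF W] periodic_weightD(2)[OF A]
  have h: "(LINT t:{x..x + 4 * al}|lborel. f t) + (LINT t:{x + 4 * al..x + 8 * al}|lborel. f t) = (LINT t:{0..8 * al}|lborel. f t)"
    if "\<And>x y. set_integrable lborel {x..y} f" "\<And>t. f (t + 8 * al) = f t" for f :: "real \<Rightarrow> real"
    using LINT_Icc_split[OF that(1)[of x "x + 8 * al"], of "x + 4 * al"] LINT_period[OF that, of x] x al_pos by simp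
  show "(LINT t:{x..x + 4 * al}|lborel. A t * (G t)\<^sup>2) + (LINT t:{x + 4 * al..x + 8 * al}|lborel. A t * (G t)\<^sup>2)
      = (LINT t:{0..8 * al}|lborel. A t * (G t)\<^sup>2)"
    by (rule h) (auto simp: i per)
  show "(LINT t:{x..x + 4 * al}|lborel. A t * W t) + (LINT t:{x + 4 * al..x + 8 * al}|lborel. A t * W t) = 0"
    by (subst h) (auto simp: i per competitorD(6)[OF W])
  have hc: "(LINT t:{x..x + 4 * al}|lborel. A t * (W t - c)\<^sup>2) + (LINT t:{x + 4 * al..x + 8 * al}|lborel. A t * (W t - c)\<^sup>2)
      = (LINT t:{0..8 * al}|lborel. A t * (W t - c)\<^sup>2)"
    by (rule h) (auto simp: i per)
  have "(\<lambda>t. A t * (W t - c)\<^sup>2) = (\<lambda>t. A t * (W t)\<^sup>2 - 2 * c * (A t * W t) + c\<^sup>2 * A t)"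
    by (auto simp: power2_eq_square algebra_simps)
  then have "(LINT t:{0..8 * al}|lborel. A t * (W t - c)\<^sup>2) = (LINT t:{0..8 * al}|lborel. A t * (W t)\<^sup>2 - 2 * c * (A t * W t) + c\<^sup>2 * A t)"
    by simp
  also have "(LINT t:{0..8 * al}|lborel. A t * (W t)\<^sup>2 - 2 * c * (A t * W t) + c\<^sup>2 * A t)
     = (LINT t:{0..8 * al}|lborel. A t * (W t)\<^sup>2) - 2 * c * (LINT t:{0..8 * al}|lborel. A t * W t)
        + c\<^sup>2 * (LINT t:{0..8 * al}|lborel. A t)"
    using i by (simp add: set_integral_add set_integral_diff)
  finally have "(LINT t:{0..8 * al}|lborel. A t * (W t - c)\<^sup>2) = (LINT t:{0..8 * al}|lborel. A t * (W t)\<^sup>2)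
      - 2 * c * (LINT t:{0..8 * al}|lborel. A t * W t) + c\<^sup>2 * (LINT t:{0..8 * al}|lborel. A t)" .
  with hc show "(LINT t:{x..x + 4 * al}|lborel. A t * (W t - c)\<^sup>2) + (LINT t:{x + 4 * al..x + 8 * al}|lborel. A t * (W t - c)\<^sup>2)
      = (LINT t:{0..8 * al}|lborel. A t * (W t)\<^sup>2) + c\<^sup>2 * (LINT t:{0..8 * al}|lborel. A t)"
    using competitorD(6)[OF W] by simp
qed

lemma weight_integral_pos:
  assumes "periodic_weight A"
  shows "8 * al \<le> (LINT t:{0..8 * al}|lborel. A t)"
proof -
  have i: "set_integrable lborel {0..8 * al} A"
    using weight_mult_integrable[OF periodic_weightD(1)[OF assms], of 0 "8 * al" "\<lambda>_. 1"] set_integrable_continuous_Icc[of 0 "8 * al" "\<lambda>_. 1"] by simp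
  have "(LINT t:{0..8 * al}|lborel. 1) \<le> (LINT t:{0..8 * al}|lborel. A t)"
  proof (rule set_integral_mono[OF _ i])
    show "set_integrable lborel {0..8 * al} (\<lambda>_. 1::real)" by (rule set_integrable_continuous_Icc) auto
  qed (rule weightD(2)[OF periodic_weightD(1)[OF assms]])
  then show ?thesis using al_pos by (simp add: set_integral_const)
qed

text \<open>Choose \<open>x\<close> with \<open>W x = W (x + 4 * al) = c\<close>. Then \<open>W - c\<close> vanishes at both ends of the two halves of the
  period that starts at \<open>x\<close>, so the Dirichlet inequality applies to each half. As \<open>A W\<close> has mean zero, the
  integral of \<open>A (W - c)\<^sup>2\<close> exceeds that of \<open>A W\<^sup>2\<close> by the nonnegative term \<open>c\<^sup>2 \<integral>A\<close>.\<close>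
theorem periodic_inequality:
  assumes A: "periodic_weight A" and W: "competitor A W G"
  shows "(LINT t:{0..8 * al}|lborel. A t * (W t)\<^sup>2) \<le> (LINT t:{0..8 * al}|lborel. A t * (G t)\<^sup>2)"
proof -
  obtain x where x: "0 \<le> x" "x \<le> 4 * al" "W (x + 4 * al) = W x" using equal_at_half_period[OF W] .
  have e: "x + 4 * al + 4 * al = x + 8 * al" by simp
  have "W (x + 8 * al) = W x" using competitorD(4)[OF W] by simp
  from half_period(1)[OF A W refl x(3)] half_period(1)[OF A W x(3), unfolded e, OF this]
  have "(LINT t:{0..8 * al}|lborel. A t * (W t)\<^sup>2) + (W x)\<^sup>2 * (LINT t:{0..8 * al}|lborel. A t)
      \<le> (LINT t:{0..8 * al}|lborel. A t * (G t)\<^sup>2)"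
    using sum_of_halves(1)[OF A W x(1,2)] sum_of_halves(2)[OF A W x(1,2), of "W x"] by linarith
  moreover have "0 \<le> (W x)\<^sup>2 * (LINT t:{0..8 * al}|lborel. A t)"
    using weight_integral_pos[OF A] al_pos by (intro mult_nonneg_nonneg) auto
  ultimately show ?thesis by linarith
qed

lemma integral_BU: "(LINT t:{0..4 * al}|lborel. B t * U t) = 2"
proof -
  have "(LINT t:{0..4 * al}|lborel. - (B t * U t)) = V (4 * al) - V 0"
    using primitive_onD(2)[OF primitive_V, of 0 "4 * al"] al_pos by simp
  moreover have "(LINT t:{0..4 * al}|lborel. - (B t * U t)) = - (LINT t:{0..4 * al}|lborel. B t * U t)"
    by (simp add: set_lebesgue_integral_def)
  ultimately show ?thesis using V_shift4[of 0] V_0 by simp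
qed

text \<open>Now \<open>c = 0\<close> and both halves are cases of equality, with factors \<open>K1\<close> and \<open>K2\<close>. A half contributes
  twice its factor to the integral of \<open>A W\<close>, so the mean zero condition gives \<open>K2 = - K1\<close>, and the two
  arcs are the two arcs of a single multiple of \<open>U\<close>.\<close>
theorem periodic_equality:
  assumes A: "periodic_weight A" and W: "competitor A W G"
    and eq: "(LINT t:{0..8 * al}|lborel. A t * (W t)\<^sup>2) = (LINT t:{0..8 * al}|lborel. A t * (G t)\<^sup>2)"
    and nz: "W t0 \<noteq> 0"
  obtains K x where "K \<noteq> 0" "\<And>t. W t = K * U (t - x)" "AE t in lborel. A t = B (t - x)"
proof -
  have [measurable]: "A \<in> borel_measurable borel" using weightD(1)[OF periodic_weightD(1)[OF A]] .
  obtain x where x: "0 \<le> x" "x \<le> 4 * al" "W (x + 4 * al) = W x" using equal_at_half_period[OF W] .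
  have e: "x + 4 * al + 4 * al = x + 8 * al" by simp
  have W8: "W (x + 8 * al) = W x" using competitorD(4)[OF W] by simp
  note h1 = half_period[OF A W refl x(3)]
  note h2 = half_period[OF A W x(3), unfolded e, OF W8]
  have sums: "(W x)\<^sup>2 * (LINT t:{0..8 * al}|lborel. A t) = 0"
    "(LINT t:{x..x + 4 * al}|lborel. A t * (W t - W x)\<^sup>2) = (LINT t:{x..x + 4 * al}|lborel. A t * (G t)\<^sup>2)"
    "(LINT t:{x + 4 * al..x + 8 * al}|lborel. A t * (W t - W x)\<^sup>2) = (LINT t:{x + 4 * al..x + 8 * al}|lborel. A t * (G t)\<^sup>2)"
  proof -
    have "0 \<le> (W x)\<^sup>2 * (LINT t:{0..8 * al}|lborel. A t)"
      using weight_integral_pos[OF A] al_pos by (intro mult_nonneg_nonneg) auto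
    with h1(1) h2(1) sum_of_halves(1)[OF A W x(1,2)] sum_of_halves(2)[OF A W x(1,2), of "W x"] eq
    show "(W x)\<^sup>2 * (LINT t:{0..8 * al}|lborel. A t) = 0"
      "(LINT t:{x..x + 4 * al}|lborel. A t * (W t - W x)\<^sup>2) = (LINT t:{x..x + 4 * al}|lborel. A t * (G t)\<^sup>2)"
      "(LINT t:{x + 4 * al..x + 8 * al}|lborel. A t * (W t - W x)\<^sup>2) = (LINT t:{x + 4 * al..x + 8 * al}|lborel. A t * (G t)\<^sup>2)"
      by linarith+
  qed
  have Wx: "W x = 0" using sums(1) weight_integral_pos[OF A] al_pos by auto
  from h1(2)[OF sums(2)] obtain K1 where
    "(\<forall>t. x \<le> t \<longrightarrow> t \<le> x + 4 * al \<longrightarrow> W t - W x = K1 * U (t - x)) \<and>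
     (K1 \<noteq> 0 \<longrightarrow> (AE t in lborel. x \<le> t \<longrightarrow> t \<le> x + 4 * al \<longrightarrow> A t = B (t - x)))" by blast
  then have K1: "\<And>t. x \<le> t \<Longrightarrow> t \<le> x + 4 * al \<Longrightarrow> W t = K1 * U (t - x)"
    and AE1: "K1 \<noteq> 0 \<Longrightarrow> AE t in lborel. x \<le> t \<longrightarrow> t \<le> x + 4 * al \<longrightarrow> A t = B (t - x)"
    unfolding Wx by simp_all
  from h2(2)[OF sums(3)] obtain K2 where
    "(\<forall>t. x + 4 * al \<le> t \<longrightarrow> t \<le> x + 8 * al \<longrightarrow> W t - W x = K2 * U (t - (x + 4 * al))) \<and>
     (K2 \<noteq> 0 \<longrightarrow> (AE t in lborel. x + 4 * al \<le> t \<longrightarrow> t \<le> x + 8 * al \<longrightarrow> A t = B (t - (x + 4 * al))))" by blast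
  then have K2: "\<And>t. x + 4 * al \<le> t \<Longrightarrow> t \<le> x + 8 * al \<Longrightarrow> W t = K2 * U (t - (x + 4 * al))"
    and AE2: "K2 \<noteq> 0 \<Longrightarrow> AE t in lborel. x + 4 * al \<le> t \<longrightarrow> t \<le> x + 8 * al \<longrightarrow> A t = B (t - (x + 4 * al))"
    unfolding Wx by simp_all
  have half: "(LINT t:{y..y + 4 * al}|lborel. A t * W t) = 2 * K"
    if Wy: "\<And>t. y \<le> t \<Longrightarrow> t \<le> y + 4 * al \<Longrightarrow> W t = K * U (t - y)"
      and Ay: "K \<noteq> 0 \<Longrightarrow> AE t in lborel. y \<le> t \<longrightarrow> t \<le> y + 4 * al \<longrightarrow> A t = B (t - y)" for y K
  proof -
    have [measurable]: "W \<in> borel_measurable borel" by (rule competitorD(8)[OF W])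
    have "(LINT t:{y..y + 4 * al}|lborel. A t * W t) = (LINT t:{y..y + 4 * al}|lborel. K * (B (t - y) * U (t - y)))"
    proof (cases "K = 0")
      case True
      have "(LINT t:{y..y + 4 * al}|lborel. A t * W t) = (LINT t:{y..y + 4 * al}|lborel. 0)"
        by (rule set_lebesgue_integral_cong) (use Wy True in auto)
      then show ?thesis using True by simp
    next
      case False
      show ?thesis
      proof (rule set_lebesgue_integral_cong_AE)
        show "AE t\<in>{y..y + 4 * al} in lborel. A t * W t = K * (B (t - y) * U (t - y))"
          using Ay[OF False] by eventually_elim (auto simp: Wy)
      qed auto
    qed
    also have "\<dots> = K * (LINT t:{0..4 * al}|lborel. B t * U t)"
      using LINT_shift[of 0 "4 * al" "\<lambda>t. B (t - y) * U (t - y)" y] by (simp add: add.commute)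
    finally show ?thesis using integral_BU by simp
  qed
  have "2 * K1 + 2 * K2 = 0"
    using sum_of_halves(3)[OF A W x(1,2)] half[OF K1 AE1] half[of "x + 4 * al" K2, unfolded e, OF K2 AE2] by simp
  then have K2': "K2 = - K1" by simp
  have Wwin: "W t = K1 * U (t - x)" if "x \<le> t" "t \<le> x + 8 * al" for t
  proof (cases "t \<le> x + 4 * al")
    case True then show ?thesis using K1 that by auto
  next
    case False
    have "U (t - x) = - U (t - (x + 4 * al))" using U_shift4[of "t - (x + 4 * al)"] by (simp add: algebra_simps)
    then show ?thesis using K2[of t] K2' False that by simp
  qed
  have Wall: "W t = K1 * U (t - x)" for t
  proof -
    obtain n :: int where n: "x \<le> t + of_int n * (8 * al)" "t + of_int n * (8 * al) < x + 8 * al"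
      using ex_period_window[of "8 * al" x t] al_pos by auto
    have "W t = W (t + of_int n * (8 * al))" using periodic_int[of W "8 * al" t n] competitorD(4)[OF W] by simp
    also have "\<dots> = K1 * U (t + of_int n * (8 * al) - x)" using Wwin n by simp
    also have "U (t + of_int n * (8 * al) - x) = U (t - x)"
      using periodic_int[of U "8 * al" "t - x" n] U_shift8 by (simp add: algebra_simps)
    finally show ?thesis .
  qed
  have "K1 \<noteq> 0" using nz Wall by auto
  have "AE t in lborel. A t = B (t - x)"
  proof (rule AE_periodic[where a = x and l = "8 * al"])
    show "A (t + 8 * al) = B (t + 8 * al - x) \<longleftrightarrow> A t = B (t - x)" for t
      using B_shift8[of "t - x"] periodic_weightD(2)[OF A] by (simp add: algebra_simps)
    show "AE t in lborel. x \<le> t \<longrightarrow> t \<le> x + 8 * al \<longrightarrow> A t = B (t - x)"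
    proof -
      have "AE t in lborel. x + 4 * al \<le> t \<longrightarrow> t \<le> x + 8 * al \<longrightarrow> A t = B (t - (x + 4 * al))"
        using AE2 \<open>K1 \<noteq> 0\<close> K2' by simp
      with AE1[OF \<open>K1 \<noteq> 0\<close>] show ?thesis
      proof eventually_elim
        case (elim t)
        have "B (t - x) = B (t - (x + 4 * al))" using B_shift4[of "t - (x + 4 * al)"] by (simp add: algebra_simps)
        then show ?case using elim by (cases "t \<le> x + 4 * al") auto
      qed
    qed
  qed (use al_pos in auto)
  with \<open>K1 \<noteq> 0\<close> Wall show thesis by (rule that)
qed

end


section \<open>Existence of minimisers\<close>

lemma cauchy_schwarz_Icc:
  fixes h :: "real \<Rightarrow> real"
  assumes "a \<le> b" "set_integrable lborel {a..b} h" "set_integrable lborel {a..b} (\<lambda>x. (h x)\<^sup>2)"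
  shows "(LINT x:{a..b}|lborel. h x)\<^sup>2 \<le> (b - a) * (LINT x:{a..b}|lborel. (h x)\<^sup>2)"
proof (cases "a = b")
  case True
  then show ?thesis using assms(2)
    by (simp add: set_borel_integral_eq_integral(2))
next
  case False
  define F where "F x = (LINT t:{a..x}|lborel. h t)" for x
  have "primitive_on {a..b} F h" unfolding primitive_on_def
  proof (intro ballI impI)
    fix x y assume xy: "x \<in> {a..b}" "y \<in> {a..b}" "x \<le> y"
    have i: "set_integrable lborel {a..y} h" "set_integrable lborel {x..y} h"
      by (rule set_integrable_subset[OF assms(2)]; use xy in auto)+
    then show "set_integrable lborel {x..y} h \<and> (LINT t:{x..y}|lborel. h t) = F y - F x"
      using LINT_Icc_split[OF i(1), of x] xy by (simp add: F_def)
  qed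
  moreover have "F a = 0" using set_borel_integral_eq_integral(2)[of "{a..a}" h]
      set_integrable_subset[OF assms(2), of "{a..a}"] assms(1) by (simp add: F_def)
  ultimately show ?thesis using cauchy_schwarz_increment[of a b F h] False assms by (simp add: F_def)
qed

lemma set_integrable_mult_of_squares:
  fixes f g :: "real \<Rightarrow> real"
  assumes [measurable]: "f \<in> borel_measurable borel" "g \<in> borel_measurable borel"
    and "set_integrable lborel {x..y} (\<lambda>t. (f t)\<^sup>2)" "set_integrable lborel {x..y} (\<lambda>t. (g t)\<^sup>2)"
  shows "set_integrable lborel {x..y} (\<lambda>t. f t * g t)"
proof -
  have "set_integrable lborel {x..y} (\<lambda>t. (f t)\<^sup>2 + (g t)\<^sup>2)" by (rule set_integral_add(1)[OF assms(3,4)])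
  then show ?thesis
  proof (rule set_integrable_bound)
    show "AE t in lborel. t \<in> {x..y} \<longrightarrow> norm (f t * g t) \<le> norm ((f t)\<^sup>2 + (g t)\<^sup>2)"
    proof (intro AE_I2 impI)
      fix t
      have "2 * (\<bar>f t\<bar> * \<bar>g t\<bar>) \<le> (f t)\<^sup>2 + (g t)\<^sup>2"
        using sum_squares_bound[of "\<bar>f t\<bar>" "\<bar>g t\<bar>"] by simp
      moreover have "0 \<le> \<bar>f t\<bar> * \<bar>g t\<bar>" by simp
      ultimately show "norm (f t * g t) \<le> norm ((f t)\<^sup>2 + (g t)\<^sup>2)"
        unfolding real_norm_def abs_mult by linarith
    qed
  qed (simp add: set_borel_measurable_def)
qed

lemma set_integrable_of_square:
  fixes f :: "real \<Rightarrow> real"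
  assumes "f \<in> borel_measurable borel" "set_integrable lborel {x..y} (\<lambda>t. (f t)\<^sup>2)"
  shows "set_integrable lborel {x..y} f"
proof -
  have "set_integrable lborel {x..y} (\<lambda>t. (1::real)\<^sup>2)" by (rule set_integrable_continuous_Icc) auto
  from set_integrable_mult_of_squares[OF assms(1) _ assms(2) this] show ?thesis by simp
qed

lemma set_integrable_periodic:
  fixes f :: "real \<Rightarrow> real"
  assumes "0 < l" "\<And>t. f (t + l) = f t" "set_integrable lborel {0..l} f"
  shows "set_integrable lborel {x..y} f"
proof -
  have cell: "set_integrable lborel {of_int n * l..of_int n * l + l} f" for n :: int
    using set_integrable_shift[of 0 l f "of_int n * l"] assms(3) periodic_int[of f l _ n] assms(2)
    by (simp add: add.commute)
  define S :: "int set" where "S = {\<lfloor>x / l\<rfloor>..\<lfloor>y / l\<rfloor>}"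
  have "set_integrable lborel (\<Union>n\<in>S. {of_int n * l..of_int n * l + l}) f"
    by (rule set_integrable_UN) (auto simp: S_def cell)
  then show ?thesis
  proof (rule set_integrable_subset)
    show "{x..y} \<subseteq> (\<Union>n\<in>S. {of_int n * l..of_int n * l + l})"
    proof
      fix t assume t: "t \<in> {x..y}"
      then have "\<lfloor>t / l\<rfloor> \<in> S" using \<open>0 < l\<close> by (auto simp: S_def intro!: floor_mono divide_right_mono)
      moreover have "of_int \<lfloor>t / l\<rfloor> * l \<le> t" "t \<le> (of_int \<lfloor>t / l\<rfloor> + 1) * l"
        unfolding pos_le_divide_eq[OF \<open>0 < l\<close>, symmetric] pos_divide_le_eq[OF \<open>0 < l\<close>, symmetric] by linarith+
      ultimately show "t \<in> (\<Union>n\<in>S. {of_int n * l..of_int n * l + l})"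
        by (auto simp: distrib_right)
    qed
  qed auto
qed

lemma primitive_on_periodic:
  fixes W G :: "real \<Rightarrow> real"
  assumes "0 < l" "\<And>t. W (t + l) = W t" "\<And>t. G (t + l) = G t" "primitive_on {0..l} W G"
  shows "primitive_on UNIV W G"
proof -
  have sh: "primitive_on {a..b} W G \<longleftrightarrow> primitive_on {a + of_int n * l..b + of_int n * l} W G" for a b and n :: int
    using primitive_on_shift[of a b W "of_int n * l" G] periodic_int[of W l _ n] periodic_int[of G l _ n] assms(2,3) by simp
  have nat: "primitive_on {0..real n * l} W G" for n
  proof (induction n)
    case 0
    show ?case by (rule primitive_on_subset[OF assms(4)]) (use assms(1) in auto)
  next
    case (Suc n)
    have "primitive_on {real n * l..real (Suc n) * l} W G"
      using sh[of 0 l "int n"] assms(4) by (simp add: algebra_simps)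
    then show ?case using Suc assms(1) by (intro primitive_on_glue[of 0 "real n * l" W G "real (Suc n) * l"]) auto
  qed
  show ?thesis
  proof (rule primitive_on_UNIV_I)
    fix a b :: real
    obtain n :: nat where n: "max \<bar>a\<bar> \<bar>b\<bar> / l < real n" using reals_Archimedean2 by blast
    then have n': "\<bar>a\<bar> \<le> real n * l" "\<bar>b\<bar> \<le> real n * l" using assms(1) by (auto simp: field_simps)
    have "primitive_on {0 + of_int (- int n) * l..real (2 * n) * l + of_int (- int n) * l} W G"
      using nat[of "2 * n"] sh by blast
    then show "primitive_on {a..b} W G" by (rule primitive_on_subset) (use n' in \<open>auto simp: algebra_simps\<close>)
  qed
qed

lemma primitive_on_linear:
  assumes "primitive_on S F f" "primitive_on S H h"
  shows "primitive_on S (\<lambda>x. a * F x + b * H x) (\<lambda>x. a * f x + b * h x)"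
  unfolding primitive_on_def
proof (intro ballI impI)
  fix x y assume xy: "x \<in> S" "y \<in> S" "x \<le> y"
  note p = primitive_onD[OF assms(1) xy] primitive_onD[OF assms(2) xy]
  show "set_integrable lborel {x..y} (\<lambda>x. a * f x + b * h x) \<and>
    (LINT t:{x..y}|lborel. a * f t + b * h t) = a * F y + b * H y - (a * F x + b * H x)"
    using p(1,3) by (simp add: set_integral_add p(2,4) right_diff_distrib)
qed

lemma fatou_Icc:
  fixes f :: "nat \<Rightarrow> real \<Rightarrow> real"
  assumes [measurable]: "\<And>i. f i \<in> borel_measurable borel" "g \<in> borel_measurable borel"
    and int: "\<And>i. set_integrable lborel {x..y} (f i)"
    and nn: "\<And>i t. 0 \<le> f i t" "\<And>t. 0 \<le> g t"
    and lim: "AE t in lborel. t \<in> {x..y} \<longrightarrow> (\<lambda>i. f i t) \<longlonglongrightarrow> g t"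
    and bd: "\<And>i. i \<ge> N \<Longrightarrow> (LINT t:{x..y}|lborel. f i t) \<le> c" and c: "0 \<le> c"
  shows "set_integrable lborel {x..y} g" "(LINT t:{x..y}|lborel. g t) \<le> c"
proof -
  let ?I = "indicator {x..y} :: real \<Rightarrow> real"
  have "(\<integral>\<^sup>+t. ennreal (?I t * g t) \<partial>lborel) = (\<integral>\<^sup>+t. liminf (\<lambda>i. ennreal (?I t * f i t)) \<partial>lborel)"
  proof (rule nn_integral_cong_AE)
    show "AE t in lborel. ennreal (?I t * g t) = liminf (\<lambda>i. ennreal (?I t * f i t))"
      using lim
    proof eventually_elim
      case (elim t)
      have "(\<lambda>i. ennreal (?I t * f i t)) \<longlonglongrightarrow> ennreal (?I t * g t)"
        using elim by (cases "t \<in> {x..y}") (auto intro!: tendsto_ennrealI)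
      then show ?case by (simp add: lim_imp_Liminf)
    qed
  qed
  also have "\<dots> \<le> liminf (\<lambda>i. \<integral>\<^sup>+t. ennreal (?I t * f i t) \<partial>lborel)"
    by (rule nn_integral_liminf) auto
  also have "\<dots> \<le> ennreal c"
  proof (rule Liminf_le)
    have "(\<integral>\<^sup>+t. ennreal (?I t * f i t) \<partial>lborel) \<le> ennreal c" if "i \<ge> N" for i
    proof -
      have "(\<integral>\<^sup>+t. ennreal (?I t * f i t) \<partial>lborel) = ennreal (LINT t:{x..y}|lborel. f i t)"
        using nn_integral_eq_integral[of lborel "\<lambda>t. ?I t * f i t"] int[of i] nn
        by (simp add: set_integrable_def set_lebesgue_integral_def)
      then show ?thesis using bd[OF that] by (simp add: ennreal_leI)
    qed
    then show "\<forall>\<^sub>F i in sequentially. (\<integral>\<^sup>+t. ennreal (?I t * f i t) \<partial>lborel) \<le> ennreal c"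
      by (auto simp: eventually_sequentially)
  qed simp
  finally have le: "(\<integral>\<^sup>+t. ennreal (?I t * g t) \<partial>lborel) \<le> ennreal c" .
  then have fin: "(\<integral>\<^sup>+t. ennreal (?I t * g t) \<partial>lborel) < \<infinity>"
    using le_less_trans ennreal_less_top by fastforce
  have int: "integrable lborel (\<lambda>t. ?I t * g t)"
    by (rule integrableI_nonneg) (use fin nn in auto)
  then show "set_integrable lborel {x..y} g" by (simp add: set_integrable_def)
  have "ennreal (LINT t|lborel. ?I t * g t) \<le> ennreal c"
    using le nn_integral_eq_integral[OF int] nn by simp
  then show "(LINT t:{x..y}|lborel. g t) \<le> c" using c by (simp add: set_lebesgue_integral_def)
qed

context bang_bang begin

lemma competitor_linear:
  assumes A: "periodic_weight A" and W1: "competitor A W1 G1" and W2: "competitor A W2 G2"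
  shows "competitor A (\<lambda>x. a * W1 x + b * W2 x) (\<lambda>x. a * G1 x + b * G2 x)"
proof -
  note [measurable] = competitorD(2)[OF W1] competitorD(2)[OF W2]
  have "set_integrable lborel {x..y} (\<lambda>t. (a * G1 t + b * G2 t)\<^sup>2)" for x y
  proof -
    have "(\<lambda>t. (a * G1 t + b * G2 t)\<^sup>2) = (\<lambda>t. a\<^sup>2 * (G1 t)\<^sup>2 + b\<^sup>2 * (G2 t)\<^sup>2 + 2 * a * b * (G1 t * G2 t))"
      by (auto simp: power2_eq_square algebra_simps)
    moreover have "set_integrable lborel {x..y} (\<lambda>t. G1 t * G2 t)"
      by (intro set_integrable_mult_of_squares competitorD(3)[OF W1] competitorD(3)[OF W2]) measurable
    ultimately show ?thesis
      using competitorD(3)[OF W1, of x y] competitorD(3)[OF W2, of x y] by (auto intro!: set_integral_add(1))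
  qed
  moreover have "(LINT x:{0..8 * al}|lborel. A x * (a * W1 x + b * W2 x)) = 0"
  proof -
    have "(\<lambda>x. A x * (a * W1 x + b * W2 x)) = (\<lambda>x. a * (A x * W1 x) + b * (A x * W2 x))"
      by (auto simp: algebra_simps)
    then show ?thesis using competitor_integrable(4)[OF A W1] competitor_integrable(4)[OF A W2]
        competitorD(6)[OF W1] competitorD(6)[OF W2] by (simp add: set_integral_add)
  qed
  ultimately show ?thesis using competitorD(1,4,5)[OF W1] competitorD(1,4,5)[OF W2]
    unfolding competitor_def by (auto intro!: primitive_on_linear)
qed

lemma energy_parallelogram:
  assumes A: "periodic_weight A" and [measurable]: "F \<in> borel_measurable borel" "H \<in> borel_measurable borel"
    and F: "set_integrable lborel {x..y} (\<lambda>t. (F t)\<^sup>2)" and H: "set_integrable lborel {x..y} (\<lambda>t. (H t)\<^sup>2)"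
  shows "set_integrable lborel {x..y} (\<lambda>t. A t * (F t - H t)\<^sup>2)"
    and "(LINT t:{x..y}|lborel. A t * (F t - H t)\<^sup>2) + (LINT t:{x..y}|lborel. A t * (F t + H t)\<^sup>2)
      = 2 * (LINT t:{x..y}|lborel. A t * (F t)\<^sup>2) + 2 * (LINT t:{x..y}|lborel. A t * (H t)\<^sup>2)"
proof -
  note wt = weight_mult_integrable[OF periodic_weightD(1)[OF A]]
  have FH: "set_integrable lborel {x..y} (\<lambda>t. A t * (F t * H t))"
    by (intro wt set_integrable_mult_of_squares F H) measurable
  note i = wt[OF F] wt[OF H] FH
  have e: "(\<lambda>t. A t * (F t - H t)\<^sup>2) = (\<lambda>t. A t * (F t)\<^sup>2 + A t * (H t)\<^sup>2 - 2 * (A t * (F t * H t)))"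
    "(\<lambda>t. A t * (F t + H t)\<^sup>2) = (\<lambda>t. A t * (F t)\<^sup>2 + A t * (H t)\<^sup>2 + 2 * (A t * (F t * H t)))"
    by (auto simp: power2_eq_square algebra_simps)
  show "set_integrable lborel {x..y} (\<lambda>t. A t * (F t - H t)\<^sup>2)"
    unfolding e using i by (auto intro!: set_integral_add(1) set_integral_diff(1))
  show "(LINT t:{x..y}|lborel. A t * (F t - H t)\<^sup>2) + (LINT t:{x..y}|lborel. A t * (F t + H t)\<^sup>2)
      = 2 * (LINT t:{x..y}|lborel. A t * (F t)\<^sup>2) + 2 * (LINT t:{x..y}|lborel. A t * (H t)\<^sup>2)"
    unfolding e using i by (simp add: set_integral_add set_integral_diff)
qed

text \<open>Uniform boundedness and equicontinuity, as needed for the theorem of Arzela and Ascoli. The bound for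
  \<open>W\<close> is far from sharp.\<close>
lemma competitor_bounds:
  assumes A: "periodic_weight A" and W: "competitor A W G"
    and norm: "(LINT t:{0..8 * al}|lborel. A t * (W t)\<^sup>2) = 1" and en: "(LINT t:{0..8 * al}|lborel. A t * (G t)\<^sup>2) \<le> 2"
    and xy: "x \<in> {0..8 * al}" "y \<in> {0..8 * al}"
  shows "(W y - W x)\<^sup>2 \<le> 2 * \<bar>y - x\<bar>" and "\<bar>W x\<bar> \<le> 2 + 2 / al + 32 * al"
proof -
  note i = competitor_integrable[OF A W]
  have incr: "(W y - W x)\<^sup>2 \<le> 2 * \<bar>y - x\<bar>" if xy: "x \<in> {0..8 * al}" "y \<in> {0..8 * al}" "x < y" for x y
  proof -
    have "primitive_on {x..y} W G" by (rule primitive_on_subset[OF competitorD(1)[OF W]]) auto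
    from cauchy_schwarz_increment[OF this xy(3) competitorD(3)[OF W]]
    have "(W y - W x)\<^sup>2 \<le> (y - x) * (LINT t:{x..y}|lborel. (G t)\<^sup>2)" .
    also have "(LINT t:{x..y}|lborel. (G t)\<^sup>2) \<le> (LINT t:{x..y}|lborel. A t * (G t)\<^sup>2)"
    proof (rule set_integral_mono[OF competitorD(3)[OF W] i(1)])
      show "(G t)\<^sup>2 \<le> A t * (G t)\<^sup>2" for t
        using mult_right_mono[OF weightD(2)[OF periodic_weightD(1)[OF A], of t], of "(G t)\<^sup>2"] by simp
    qed
    also have "\<dots> \<le> (LINT t:{0..8 * al}|lborel. A t * (G t)\<^sup>2)"
      by (rule LINT_Icc_mono_set[OF i(1)])
        (use xy weightD(4)[OF periodic_weightD(1)[OF A]] in \<open>auto simp: less_imp_le\<close>)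
    also have "\<dots> \<le> 2" by (rule en)
    finally show ?thesis using xy by (simp add: mult.commute mult_left_mono)
  qed
  have incr': "(W y - W x)\<^sup>2 \<le> 2 * \<bar>y - x\<bar>" if xy: "x \<in> {0..8 * al}" "y \<in> {0..8 * al}" for x y
    using incr[of x y] incr[of y x] xy by (cases x y rule: linorder_cases) (auto simp: power2_commute)
  show "(W y - W x)\<^sup>2 \<le> 2 * \<bar>y - x\<bar>" by (rule incr'[OF xy])
  have "\<exists>z\<in>{0..8 * al}. (W z)\<^sup>2 \<le> 1 / (4 * al)"
  proof (rule ccontr)
    assume "\<not> ?thesis"
    then have *: "1 / (4 * al) \<le> (W z)\<^sup>2" if "z \<in> {0..8 * al}" for z using that by (meson linear)
    have "(LINT t:{0..8 * al}|lborel. 1 / (4 * al)) \<le> (LINT t:{0..8 * al}|lborel. A t * (W t)\<^sup>2)"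
    proof (rule set_integral_mono[OF _ i(3)])
      show "set_integrable lborel {0..8 * al} (\<lambda>t. 1 / (4 * al))" by (rule set_integrable_continuous_Icc) auto
      show "1 / (4 * al) \<le> A t * (W t)\<^sup>2" if "t \<in> {0..8 * al}" for t
        using mult_right_mono[OF weightD(2)[OF periodic_weightD(1)[OF A], of t], of "(W t)\<^sup>2"] *[OF that] by simp
    qed
    then show False using norm al_pos by (simp add: set_integral_const)
  qed
  then obtain z where z: "z \<in> {0..8 * al}" "(W z)\<^sup>2 \<le> 1 / (4 * al)" by blast
  have "\<bar>x - z\<bar> \<le> 8 * al" using xy z by auto
  then have "(W x - W z)\<^sup>2 \<le> 16 * al" using incr'[OF z(1) xy(1)] by simp
  moreover have "\<bar>u\<bar> \<le> 1 + u\<^sup>2" for u :: real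
  proof -
    have "0 \<le> (\<bar>u\<bar> - 1)\<^sup>2" by simp
    then show ?thesis by (simp add: power2_diff) 
  qed
  ultimately have "\<bar>W x - W z\<bar> \<le> 1 + 16 * al" "\<bar>W z\<bar> \<le> 1 + 1 / (4 * al)"
    using z(2) order_trans by (meson add_left_mono)+
  moreover have "1 / (4 * al) \<le> 2 / al" using al_pos by (simp add: field_simps)
  ultimately show "\<bar>W x\<bar> \<le> 2 + 2 / al + 32 * al" using al_pos by linarith
qed


text \<open>A minimising sequence has a uniformly convergent subsequence by Arzela and Ascoli. By the inequality
  itself the sum of two of its members has energy at least its norm, which is close to 4. The parallelogram
  law then makes the derivatives a Cauchy sequence in the mean square, and a subsequence converges almost
  everywhere. Fatou's lemma identifies the limit as the derivative of the uniform limit and bounds its energy.\<close>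
theorem minimiser_exists:
  assumes A: "periodic_weight A"
    and inf: "\<And>e. 0 < e \<Longrightarrow> \<exists>W G. competitor A W G \<and> 0 < (LINT t:{0..8 * al}|lborel. A t * (W t)\<^sup>2) \<and>
      (LINT t:{0..8 * al}|lborel. A t * (G t)\<^sup>2) \<le> (1 + e) * (LINT t:{0..8 * al}|lborel. A t * (W t)\<^sup>2)"
  obtains W G where "competitor A W G" "(LINT t:{0..8 * al}|lborel. A t * (W t)\<^sup>2) = 1"
    "(LINT t:{0..8 * al}|lborel. A t * (G t)\<^sup>2) = 1"
proof -
  let ?L = "8 * al"
  define E where "E F = (LINT t:{0..?L}|lborel. A t * (F t)\<^sup>2)" for F
  have L: "0 < ?L" using al_pos by simp
  note wtA = periodic_weightD(1)[OF A]
  have [measurable]: "A \<in> borel_measurable borel" by (rule weightD(1)[OF wtA])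
  have scale: "E (\<lambda>t. c * F t) = c\<^sup>2 * E F" for c F
  proof -
    have "(\<lambda>t. A t * (c * F t)\<^sup>2) = (\<lambda>t. c\<^sup>2 * (A t * (F t)\<^sup>2))" by (auto simp: power_mult_distrib)
    then show ?thesis by (simp add: E_def)
  qed
  have "\<exists>W G. competitor A W G \<and> E W = 1 \<and> E G \<le> 1 + e" if e: "0 < e" for e
  proof -
    from inf[OF e] obtain W G where W: "competitor A W G" "0 < E W" "E G \<le> (1 + e) * E W"
      unfolding E_def by blast
    define c where "c = 1 / sqrt (E W)"
    have c2: "c\<^sup>2 = 1 / E W" using W(2) by (simp add: c_def power_divide)
    have "competitor A (\<lambda>x. c * W x) (\<lambda>x. c * G x)" using competitor_linear[OF A W(1) W(1), of c 0] by simp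
    moreover have "E (\<lambda>x. c * W x) = 1" "E (\<lambda>x. c * G x) \<le> 1 + e"
      unfolding scale c2 using W(2,3) by (simp_all add: field_simps)
    ultimately show ?thesis by blast
  qed
  then have "\<exists>W G. competitor A W G \<and> E W = 1 \<and> E G \<le> 1 + 1 / (real n + 1)" for n by simp
  then obtain W0 G0 where W0: "\<And>n. competitor A (W0 n) (G0 n)" "\<And>n. E (W0 n) = 1"
    "\<And>n. E (G0 n) \<le> 1 + 1 / (real n + 1)" by metis
  have e1: "1 / (real n + 1) \<le> 1" for n by simp
  have E2: "E (G0 n) \<le> 2" for n using W0(3)[of n] e1[of n] by linarith
  note bounds = competitor_bounds[OF A W0(1) W0(2)[unfolded E_def] E2[unfolded E_def]]
  define C where "C = 2 + 2 / al + 32 * al"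
  have C: "\<bar>W0 n x\<bar> \<le> C" if "x \<in> {0..?L}" for n x using bounds(2)[OF that that] by (simp add: C_def)
  obtain g k where g: "continuous_on {0..?L} g" and k: "strict_mono (k :: nat \<Rightarrow> nat)"
    and unif: "\<And>e. 0 < e \<Longrightarrow> \<exists>N. \<forall>n x. n \<ge> N \<and> x \<in> {0..?L} \<longrightarrow> norm (W0 (k n) x - g x) < e"
  proof (rule Arzela_Ascoli[of "{0..?L}" W0 C])
    show "norm (W0 n x) \<le> C" if "x \<in> {0..?L}" for n x using C[OF that] by simp
    fix x e :: real assume x: "x \<in> {0..?L}" and e: "0 < e"
    show "\<exists>d>0. \<forall>n y. y \<in> {0..?L} \<and> norm (x - y) < d \<longrightarrow> norm (W0 n x - W0 n y) < e"
    proof (intro exI[of _ "e\<^sup>2 / 2"] conjI allI impI)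
      fix n y assume y: "y \<in> {0..?L} \<and> norm (x - y) < e\<^sup>2 / 2"
      then have "(W0 n x - W0 n y)\<^sup>2 < e\<^sup>2" using bounds(1)[of y x n] x by auto
      then have "\<bar>W0 n x - W0 n y\<bar>\<^sup>2 < e\<^sup>2" by simp
      then show "norm (W0 n x - W0 n y) < e" using e power2_less_imp_less[of "\<bar>W0 n x - W0 n y\<bar>" e] by simp
    qed (use e in auto)
  qed auto
  note W1 = W0(1)[of "k _"]
  have kn: "n \<le> k n" for n by (rule seq_suble[OF k])
  have G2: "set_integrable lborel {x..y} (\<lambda>t. (G0 n t)\<^sup>2)" for n x y by (rule competitorD(3)[OF W0(1)])
  have W2: "set_integrable lborel {x..y} (\<lambda>t. (W0 n t)\<^sup>2)" for n x y
    by (intro set_integrable_continuous_Icc continuous_intros competitorD(7)[OF W0(1)])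
  have Gm [measurable]: "G0 n \<in> borel_measurable borel" for n by (rule competitorD(2)[OF W0(1)])
  have Wm [measurable]: "W0 n \<in> borel_measurable borel" for n by (rule competitorD(8)[OF W0(1)])
  have gap: "E (\<lambda>t. G0 n t - G0 m t) \<le> 2 / (real n + 1) + 2 / (real m + 1) + E (\<lambda>t. W0 n t - W0 m t)" for n m
  proof -
    have "competitor A (\<lambda>x. 1 * W0 n x + 1 * W0 m x) (\<lambda>x. 1 * G0 n x + 1 * G0 m x)"
      by (rule competitor_linear[OF A W0(1) W0(1)])
    from periodic_inequality[OF A this]
    have "E (\<lambda>t. W0 n t + W0 m t) \<le> E (\<lambda>t. G0 n t + G0 m t)" by (simp add: E_def)
    moreover have "E (\<lambda>t. G0 n t - G0 m t) + E (\<lambda>t. G0 n t + G0 m t) = 2 * E (G0 n) + 2 * E (G0 m)"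
      unfolding E_def by (rule energy_parallelogram(2)[OF A Gm Gm G2 G2])
    moreover have "E (\<lambda>t. W0 n t - W0 m t) + E (\<lambda>t. W0 n t + W0 m t) = 2 * E (W0 n) + 2 * E (W0 m)"
      unfolding E_def by (rule energy_parallelogram(2)[OF A Wm Wm W2 W2])
    ultimately show ?thesis using W0(2)[of n] W0(2)[of m] W0(3)[of n] W0(3)[of m] by simp
  qed
  have EW: "E (\<lambda>t. W0 n t - W0 m t) \<le> s\<^sup>2 * d\<^sup>2 * ?L"
    if "\<And>t. t \<in> {0..?L} \<Longrightarrow> \<bar>W0 n t - W0 m t\<bar> \<le> d" for n m d
  proof -
    have "E (\<lambda>t. W0 n t - W0 m t) \<le> (LINT t:{0..?L}|lborel. s\<^sup>2 * d\<^sup>2)" unfolding E_def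
    proof (rule set_integral_mono)
      show "set_integrable lborel {0..?L} (\<lambda>t. A t * (W0 n t - W0 m t)\<^sup>2)"
        by (rule energy_parallelogram(1)[OF A Wm Wm W2 W2])
      show "set_integrable lborel {0..?L} (\<lambda>t. s\<^sup>2 * d\<^sup>2)" by (rule set_integrable_continuous_Icc) auto
      show "A t * (W0 n t - W0 m t)\<^sup>2 \<le> s\<^sup>2 * d\<^sup>2" if "t \<in> {0..?L}" for t
        using that \<open>\<And>t. t \<in> {0..?L} \<Longrightarrow> \<bar>W0 n t - W0 m t\<bar> \<le> d\<close>[OF that] weightD(2-5)[OF wtA, of t]
        by (intro mult_mono) (auto simp: abs_le_square_iff[symmetric])
    qed
    then show ?thesis using L by (simp add: set_integral_const ac_simps)
  qed
  have cauchy: "\<exists>N. \<forall>n\<ge>N. \<forall>m\<ge>N. E (\<lambda>t. G0 (k n) t - G0 (k m) t) \<le> e" if e: "0 < e" for e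
  proof -
    \<comment> \<open>A uniform distance \<open>d\<close> on a period contributes at most \<open>s\<^sup>2 * d\<^sup>2 * ?L\<close> to the gap; half of \<open>e\<close> is left for the rest.\<close>
    define d where "d = sqrt (e / (2 * s\<^sup>2 * ?L))"
    have d: "0 < d" "s\<^sup>2 * d\<^sup>2 * ?L = e / 2" using e L s_pos by (simp_all add: d_def)
    obtain N1 where N1: "\<And>n x. n \<ge> N1 \<Longrightarrow> x \<in> {0..?L} \<Longrightarrow> norm (W0 (k n) x - g x) < d / 2"
      using unif[of "d / 2"] d(1) by auto
    obtain N2 :: nat where N2: "8 / e < real N2" using reals_Archimedean2 by blast
    show ?thesis
    proof (intro exI[of _ "max N1 N2"] allI impI)
      fix n m assume nm: "max N1 N2 \<le> n" "max N1 N2 \<le> m"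
      have "E (\<lambda>t. W0 (k n) t - W0 (k m) t) \<le> s\<^sup>2 * d\<^sup>2 * ?L"
      proof (rule EW)
        fix t assume "t \<in> {0..?L}"
        then show "\<bar>W0 (k n) t - W0 (k m) t\<bar> \<le> d" using N1[of n t] N1[of m t] nm by (auto simp: abs_if split: if_splits)
      qed
      moreover have k8: "2 / (real (k i) + 1) \<le> e / 4" if "max N1 N2 \<le> i" for i
      proof -
        have "8 / e \<le> real (k i) + 1" using N2 kn[of i] that by linarith
        then show ?thesis using e by (simp add: field_simps)
      qed
      ultimately show "E (\<lambda>t. G0 (k n) t - G0 (k m) t) \<le> e"
        using gap[of "k n" "k m"] d(2) k8[OF nm(1)] k8[OF nm(2)] by linarith
    qed
  qed
  have diff2: "set_integrable lborel {0..?L} (\<lambda>t. (G0 n t - G0 m t)\<^sup>2)" for n m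
    using competitorD(3)[OF competitor_linear[OF A W0(1) W0(1), of 1 n "-1" m], of 0 ?L] by simp
  have L2: "(LINT t:{0..?L}|lborel. (G0 n t - G0 m t)\<^sup>2) \<le> E (\<lambda>t. G0 n t - G0 m t)" for n m
    unfolding E_def
  proof (rule set_integral_mono[OF diff2 energy_parallelogram(1)[OF A Gm Gm G2 G2]])
    show "(G0 n t - G0 m t)\<^sup>2 \<le> A t * (G0 n t - G0 m t)\<^sup>2" for t
      using mult_right_mono[OF weightD(2)[OF wtA, of t], of "(G0 n t - G0 m t)\<^sup>2"] by simp
  qed
  let ?s = "\<lambda>n t. indicator {0..?L} t *\<^sub>R G0 (k n) t"
  obtain r where r: "strict_mono r" and AEc: "AE t in lborel. Cauchy (\<lambda>i. ?s (r i) t)"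
  proof (rule cauchy_L1_AE_cauchy_subseq[of lborel ?s])
    show "integrable lborel (?s n)" for n
      using set_integrable_of_square[OF Gm G2, of 0 ?L "k n"] by (simp add: set_integrable_def)
    fix e :: real assume e: "0 < e"
    obtain N where N: "\<And>n m. n \<ge> N \<Longrightarrow> m \<ge> N \<Longrightarrow> E (\<lambda>t. G0 (k n) t - G0 (k m) t) \<le> e\<^sup>2 / (2 * ?L)"
      using cauchy[of "e\<^sup>2 / (2 * ?L)"] e L by auto
    show "\<exists>N. \<forall>i\<ge>N. \<forall>j\<ge>N. LINT x|lborel. norm (?s i x - ?s j x) < e"
    proof (intro exI[of _ N] allI impI)
      fix i j assume ij: "N \<le> i" "N \<le> j"
      let ?h = "\<lambda>t. \<bar>G0 (k i) t - G0 (k j) t\<bar>"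
      have eq: "(LINT x|lborel. norm (?s i x - ?s j x)) = (LINT t:{0..?L}|lborel. ?h t)"
        unfolding set_lebesgue_integral_def by (rule Bochner_Integration.integral_cong) (auto simp: indicator_def)
      have h2: "set_integrable lborel {0..?L} (\<lambda>t. (?h t)\<^sup>2)" using diff2[of "k i" "k j"] by simp
      have "(LINT t:{0..?L}|lborel. ?h t)\<^sup>2 \<le> (?L - 0) * (LINT t:{0..?L}|lborel. (?h t)\<^sup>2)"
        by (rule cauchy_schwarz_Icc[OF _ set_integrable_of_square[OF _ h2] h2]) (use L in auto)
      also have "(?L - 0) * (LINT t:{0..?L}|lborel. (?h t)\<^sup>2) \<le> ?L * (e\<^sup>2 / (2 * ?L))"
        unfolding diff_zero using L2[of "k i" "k j"] N[OF ij] L by (intro mult_left_mono) auto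
      also have "\<dots> = e\<^sup>2 / 2" using L by simp
      also have "\<dots> < e\<^sup>2" using e by simp
      finally have "(LINT t:{0..?L}|lborel. ?h t) < e" using e by (simp add: power_less_imp_less_base)
      then show "LINT x|lborel. norm (?s i x - ?s j x) < e" using eq by simp
    qed
  qed auto
  define w where "w i = W0 (k (r i))" for i
  define h where "h i = G0 (k (r i))" for i
  have rn: "n \<le> r n" for n by (rule seq_suble[OF r])
  have wh: "competitor A (w i) (h i)" for i by (simp add: w_def h_def W0(1))
  have [measurable]: "w i \<in> borel_measurable borel" "h i \<in> borel_measurable borel" for i
    by (simp_all add: w_def h_def)
  define W where "W t = lim (\<lambda>i. w i t)" for t
  define G where "G t = lim (\<lambda>i. h i t)" for t
  have [measurable]: "G \<in> borel_measurable borel" unfolding G_def by measurable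
  have limG: "AE t in lborel. t \<in> {0..?L} \<longrightarrow> (\<lambda>i. h i t) \<longlonglongrightarrow> G t"
    using AEc
  proof eventually_elim
    case (elim t)
    then show ?case by (auto simp: h_def G_def Cauchy_convergent_iff convergent_LIMSEQ_iff)
  qed
  have limw: "(\<lambda>i. w i t) \<longlonglongrightarrow> g t" if t: "t \<in> {0..?L}" for t
  proof (rule LIMSEQ_I)
    fix e :: real assume "0 < e"
    then obtain N where "\<And>n x. n \<ge> N \<Longrightarrow> x \<in> {0..?L} \<Longrightarrow> norm (W0 (k n) x - g x) < e" using unif by blast
    then show "\<exists>N. \<forall>n\<ge>N. norm (w n t - g t) < e" using t rn unfolding w_def by (meson order_trans)
  qed
  have limW: "(\<lambda>i. w i t) \<longlonglongrightarrow> W t" "W t = g t" if "t \<in> {0..?L}" for t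
    using limw[OF that] by (auto simp: W_def limI)
  have perW: "W (t + ?L) = W t" "G (t + ?L) = G t" for t
    using competitorD(4,5)[OF wh] by (auto simp: W_def G_def)
  have Eh: "E (h i) \<le> 1 + 1 / (real i + 1)" for i
  proof -
    have "real i \<le> real (k (r i))" using rn[of i] kn[of "r i"] by linarith
    then have "1 / (real (k (r i)) + 1) \<le> 1 / (real i + 1)" by (intro divide_left_mono) auto
    then show ?thesis using W0(3)[of "k (r i)"] by (simp add: h_def)
  qed
  have Ann: "0 \<le> A t * u\<^sup>2" for t u using weightD(4)[OF wtA, of t] by (simp add: less_imp_le)
  note fat = fatou_Icc[where x = 0 and y = ?L]
  have EG: "set_integrable lborel {0..?L} (\<lambda>t. A t * (G t)\<^sup>2) \<and> E G \<le> 1 + e" if e: "0 < e" for e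
  proof -
    obtain N :: nat where N: "1 / e < real N" using reals_Archimedean2 by blast
    have bd: "(LINT t:{0..?L}|lborel. A t * (h i t)\<^sup>2) \<le> 1 + e" if "i \<ge> N" for i
    proof -
      have "1 / e \<le> real i + 1" using N that by linarith
      then have "1 / (real i + 1) \<le> e" using e by (simp add: field_simps)
      then show ?thesis using Eh[of i] by (simp add: E_def)
    qed
    have lim: "AE t in lborel. t \<in> {0..?L} \<longrightarrow> (\<lambda>i. A t * (h i t)\<^sup>2) \<longlonglongrightarrow> A t * (G t)\<^sup>2"
      using limG by eventually_elim (auto intro!: tendsto_intros)
    have "set_integrable lborel {0..?L} (\<lambda>t. A t * (h i t)\<^sup>2)" for i by (rule competitor_integrable(1)[OF A wh])
    from fat[OF _ _ this Ann Ann lim bd] e show ?thesis by (simp add: E_def)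
  qed
  have "E G \<le> 1" by (rule field_le_epsilon) (use EG in auto)
  have G2int: "set_integrable lborel {0..?L} (\<lambda>t. (G t)\<^sup>2)"
  proof (rule set_integrable_bound)
    show "set_integrable lborel {0..?L} (\<lambda>t. A t * (G t)\<^sup>2)" using EG[of 1] by simp
    show "AE t in lborel. t \<in> {0..?L} \<longrightarrow> norm ((G t)\<^sup>2) \<le> norm (A t * (G t)\<^sup>2)"
      using mult_right_mono[OF weightD(2)[OF wtA]] weightD(4)[OF wtA] by (auto simp: abs_mult less_imp_le intro!: AE_I2)
  qed (simp add: set_borel_measurable_def)
  have Gint: "set_integrable lborel {x..y} G" if "0 \<le> x" "y \<le> ?L" for x y
    by (rule set_integrable_subset[OF set_integrable_of_square[OF _ G2int]]) (use that in auto)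
  have dG2: "set_integrable lborel {0..?L} (\<lambda>t. (G t - h n t)\<^sup>2)" for n
  proof -
    have "set_integrable lborel {0..?L} (\<lambda>t. G t * h n t)"
      by (intro set_integrable_mult_of_squares G2int competitorD(3)[OF wh]) auto
    moreover have "(\<lambda>t. (G t - h n t)\<^sup>2) = (\<lambda>t. (G t)\<^sup>2 + (h n t)\<^sup>2 - 2 * (G t * h n t))"
      by (auto simp: power2_eq_square algebra_simps)
    ultimately show ?thesis using G2int competitorD(3)[OF wh[of n], of 0 ?L]
      by (auto intro!: set_integral_add(1) set_integral_diff(1))
  qed
  have strong: "\<exists>N. \<forall>n\<ge>N. (LINT t:{0..?L}|lborel. (G t - h n t)\<^sup>2) \<le> e" if e: "0 < e" for e
  proof -
    obtain N where N: "\<And>n m. n \<ge> N \<Longrightarrow> m \<ge> N \<Longrightarrow> E (\<lambda>t. G0 (k n) t - G0 (k m) t) \<le> e"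
      using cauchy[OF e] by blast
    have "(LINT t:{0..?L}|lborel. (G t - h n t)\<^sup>2) \<le> e" if n: "n \<ge> N" for n
    proof -
      have bd: "(LINT t:{0..?L}|lborel. (h i t - h n t)\<^sup>2) \<le> e" if "i \<ge> N" for i
        using L2[of "k (r i)" "k (r n)"] N[of "r i" "r n"] rn[of i] rn[of n] n that by (simp add: h_def)
      have lim: "AE t in lborel. t \<in> {0..?L} \<longrightarrow> (\<lambda>i. (h i t - h n t)\<^sup>2) \<longlonglongrightarrow> (G t - h n t)\<^sup>2"
        using limG by eventually_elim (auto intro!: tendsto_intros)
      have "set_integrable lborel {0..?L} (\<lambda>t. (h i t - h n t)\<^sup>2)" for i using diff2 by (simp add: h_def)
      from fat(2)[OF _ _ this _ _ lim bd] e show ?thesis by simp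
    qed
    then show ?thesis by blast
  qed
  have prim: "primitive_on {0..?L} W G" unfolding primitive_on_def
  proof (intro ballI impI)
    fix x y assume xy: "x \<in> {0..?L}" "y \<in> {0..?L}" "x \<le> y"
    have hint: "set_integrable lborel {x..y} (h n)" for n
      by (rule set_integrable_of_square[OF _ competitorD(3)[OF wh]]) auto
    have Gxy: "set_integrable lborel {x..y} G" using Gint xy by auto
    have dxy: "set_integrable lborel {x..y} (\<lambda>t. (G t - h n t)\<^sup>2)" for n
      by (rule set_integrable_subset[OF dG2]) (use xy in auto)
    have sq: "((LINT t:{x..y}|lborel. G t) - (w n y - w n x))\<^sup>2 \<le> ?L * (LINT t:{0..?L}|lborel. (G t - h n t)\<^sup>2)" for n
    proof -
      have "w n y - w n x = (LINT t:{x..y}|lborel. h n t)"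
        using primitive_onD(2)[OF competitorD(1)[OF wh[of n]], of x y] xy by simp
      then have "(LINT t:{x..y}|lborel. G t) - (w n y - w n x) = (LINT t:{x..y}|lborel. G t - h n t)"
        using set_integral_diff(2)[OF Gxy hint] by simp
      also have "\<dots>\<^sup>2 \<le> (y - x) * (LINT t:{x..y}|lborel. (G t - h n t)\<^sup>2)"
        by (rule cauchy_schwarz_Icc[OF xy(3) set_integral_diff(1)[OF Gxy hint] dxy])
      also have "\<dots> \<le> ?L * (LINT t:{0..?L}|lborel. (G t - h n t)\<^sup>2)"
      proof (rule mult_mono)
        show "(LINT t:{x..y}|lborel. (G t - h n t)\<^sup>2) \<le> (LINT t:{0..?L}|lborel. (G t - h n t)\<^sup>2)"
          by (rule LINT_Icc_mono_set[OF dG2]) (use xy in auto)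
        show "0 \<le> (LINT t:{x..y}|lborel. (G t - h n t)\<^sup>2)"
          unfolding set_lebesgue_integral_def by (rule Bochner_Integration.integral_nonneg) simp
      qed (use xy L in auto)
      finally show ?thesis .
    qed
    let ?d = "(LINT t:{x..y}|lborel. G t) - (W y - W x)"
    have lim: "(\<lambda>n. ((LINT t:{x..y}|lborel. G t) - (w n y - w n x))\<^sup>2) \<longlonglongrightarrow> ?d\<^sup>2"
      using limW(1)[OF xy(1)] limW(1)[OF xy(2)] by (intro tendsto_intros)
    have "?d\<^sup>2 \<le> 0 + e" if e: "0 < e" for e
    proof -
      obtain N where N: "\<And>n. n \<ge> N \<Longrightarrow> (LINT t:{0..?L}|lborel. (G t - h n t)\<^sup>2) \<le> e / ?L"
        using strong[of "e / ?L"] e L by auto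
      have "?d\<^sup>2 \<le> e"
      proof (rule LIMSEQ_le_const2[OF lim], intro exI[of _ N] allI impI)
        fix n assume "N \<le> n"
        have "?L * (LINT t:{0..?L}|lborel. (G t - h n t)\<^sup>2) \<le> ?L * (e / ?L)"
          by (rule mult_left_mono[OF N[OF \<open>N \<le> n\<close>]]) (use L in auto)
        then show "((LINT t:{x..y}|lborel. G t) - (w n y - w n x))\<^sup>2 \<le> e" using sq[of n] L by simp
      qed
      then show ?thesis by simp
    qed
    then have "?d\<^sup>2 \<le> 0" by (rule field_le_epsilon)
    then show "set_integrable lborel {x..y} G \<and> (LINT t:{x..y}|lborel. G t) = W y - W x" using Gxy by simp
  qed
  have primU: "primitive_on UNIV W G" by (rule primitive_on_periodic[OF L perW prim])
  have [measurable]: "W \<in> borel_measurable borel"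
    by (rule borel_measurable_continuous_onI[OF primitive_on_UNIV_continuous[OF primU]])
  have conv: "(\<lambda>n. LINT t:{0..?L}|lborel. A t * (w n t) ^ j) \<longlonglongrightarrow> (LINT t:{0..?L}|lborel. A t * (W t) ^ j)" for j
    unfolding set_lebesgue_integral_def
  proof (rule integral_dominated_convergence[where w = "\<lambda>t. indicator {0..?L} t *\<^sub>R (s\<^sup>2 * C ^ j)"])
    have "set_integrable lborel {0..?L} (\<lambda>t. s\<^sup>2 * C ^ j)" by (rule set_integrable_continuous_Icc) auto
    then show "integrable lborel (\<lambda>t. indicator {0..?L} t *\<^sub>R (s\<^sup>2 * C ^ j))" by (simp add: set_integrable_def)
    show "AE t in lborel. (\<lambda>i. indicator {0..?L} t *\<^sub>R (A t * w i t ^ j)) \<longlonglongrightarrow> indicator {0..?L} t *\<^sub>R (A t * W t ^ j)"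
    proof (rule AE_I2)
      fix t show "(\<lambda>i. indicator {0..?L} t *\<^sub>R (A t * w i t ^ j)) \<longlonglongrightarrow> indicator {0..?L} t *\<^sub>R (A t * W t ^ j)"
        using limW(1)[of t] by (cases "t \<in> {0..?L}") (auto intro!: tendsto_intros)
    qed
    show "AE t in lborel. norm (indicator {0..?L} t *\<^sub>R (A t * w i t ^ j)) \<le> indicator {0..?L} t *\<^sub>R (s\<^sup>2 * C ^ j)" for i
    proof (rule AE_I2)
      fix t
      have "\<bar>A t\<bar> * \<bar>w i t\<bar> ^ j \<le> s\<^sup>2 * C ^ j" if "t \<in> {0..?L}"
        using C[OF that, of "k (r i)"] weightD(5)[OF wtA, of t]
        by (intro mult_mono power_mono) (auto simp: w_def)
      then show "norm (indicator {0..?L} t *\<^sub>R (A t * w i t ^ j)) \<le> indicator {0..?L} t *\<^sub>R (s\<^sup>2 * C ^ j)"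
        by (auto simp: indicator_def abs_mult power_abs)
    qed
  qed auto
  have "E W = 1"
  proof -
    have "(\<lambda>n. 1) \<longlonglongrightarrow> E W" using conv[of 2] W0(2) by (simp add: E_def w_def)
    then show ?thesis by (simp add: LIMSEQ_const_iff)
  qed
  moreover have "(LINT t:{0..?L}|lborel. A t * W t) = 0"
  proof -
    have "(\<lambda>n. 0) \<longlonglongrightarrow> (LINT t:{0..?L}|lborel. A t * W t)" using conv[of 1] competitorD(6)[OF wh] by simp
    then show ?thesis by (simp add: LIMSEQ_const_iff)
  qed
  then have comp: "competitor A W G"
    unfolding competitor_def using primU perW
    by (auto intro!: set_integrable_periodic[OF L _ G2int])
  moreover have "E W \<le> E G" using periodic_inequality[OF A comp] by (simp add: E_def)
  ultimately show thesis using that[OF comp] \<open>E G \<le> 1\<close> by (simp add: E_def)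
qed

end


section \<open>Weak derivatives and primitives\<close>

lemma set_integrable_lebesgue_borel:
  fixes f :: "real \<Rightarrow> real"
  assumes [measurable]: "f \<in> borel_measurable borel" "S \<in> sets borel"
  shows "set_integrable lebesgue S f \<longleftrightarrow> set_integrable lborel S f"
    and "(LINT x:S|lebesgue. f x) = (LINT x:S|lborel. f x)"
proof -
  have m: "(\<lambda>x. indicator S x *\<^sub>R f x) \<in> borel_measurable lborel" by measurable
  show "set_integrable lebesgue S f \<longleftrightarrow> set_integrable lborel S f"
    unfolding set_integrable_def by (rule integrable_completion[OF m])
  show "(LINT x:S|lebesgue. f x) = (LINT x:S|lborel. f x)"
    unfolding set_lebesgue_integral_def by (rule integral_completion[OF m])
qed

lemma borel_measurable_lebesgueI: "f \<in> borel_measurable borel \<Longrightarrow> f \<in> borel_measurable lebesgue"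
  for f :: "real \<Rightarrow> real"
  by (simp add: measurable_completion)

lemma lebesgue_measurable_AE:
  fixes f g :: "real \<Rightarrow> real"
  assumes "g \<in> borel_measurable borel" "AE x in lebesgue. f x = g x"
  shows "f \<in> borel_measurable lebesgue"
  using borel_measurable_AE[OF borel_measurable_lebesgueI[OF assms(1)], of f] assms(2)
  by (simp add: eq_commute)

lemma LINT_lebesgue_AE:
  fixes f g :: "real \<Rightarrow> real"
  assumes g: "g \<in> borel_measurable borel" and ae: "AE x in lebesgue. f x = g x" and S: "S \<in> sets borel"
  shows "(LINT x:S|lebesgue. f x) = (LINT x:S|lborel. g x)"
    and "set_integrable lebesgue S f \<longleftrightarrow> set_integrable lborel S g"
proof -
  note f = lebesgue_measurable_AE[OF g ae]
  have S': "S \<in> sets lebesgue" using S by (simp add: sets_completionI_sets)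
  have m: "set_borel_measurable lebesgue S f" "set_borel_measurable lebesgue S g"
    unfolding set_borel_measurable_def using f borel_measurable_lebesgueI[OF g] S' by auto
  show "(LINT x:S|lebesgue. f x) = (LINT x:S|lborel. g x)"
  proof -
    have "(LINT x:S|lebesgue. f x) = (LINT x:S|lebesgue. g x)"
      unfolding set_lebesgue_integral_def
      using m ae by (intro integral_cong_AE) (auto simp: set_borel_measurable_def)
    then show ?thesis using set_integrable_lebesgue_borel(2)[OF g S] by simp
  qed
  show "set_integrable lebesgue S f \<longleftrightarrow> set_integrable lborel S g"
  proof -
    have "set_integrable lebesgue S f \<longleftrightarrow> set_integrable lebesgue S g"
      unfolding set_integrable_def
      using m ae by (intro integrable_cong_AE) (auto simp: set_borel_measurable_def)
    then show ?thesis using set_integrable_lebesgue_borel(1)[OF g S] by simp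
  qed
qed

lemma L2_locI:
  assumes g: "g \<in> borel_measurable borel" and ae: "AE x in lebesgue. f x = g x"
    and sq: "\<And>x y. set_integrable lborel {x..y} (\<lambda>t. (g t)\<^sup>2)"
  shows "f \<in> L2_loc"
  unfolding L2_loc_def
proof (intro CollectI conjI allI impI)
  show "f \<in> borel_measurable lebesgue" by (rule lebesgue_measurable_AE[OF g ae])
  fix K :: "real set" assume K: "compact K"
  then obtain b where b: "\<And>x. x \<in> K \<Longrightarrow> \<bar>x\<bar> \<le> b" using compact_imp_bounded[OF K] by (auto simp: bounded_iff)
  have "set_integrable lborel K (\<lambda>t. (g t)\<^sup>2)"
  proof (rule set_integrable_subset[OF sq[of "- b" b]])
    show "K \<in> sets lborel" using K by (simp add: borel_compact)
    show "K \<subseteq> {- b..b}" using b by (auto simp: abs_le_iff minus_le_iff)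
  qed
  moreover have "AE x in lebesgue. (f x)\<^sup>2 = (g x)\<^sup>2" using ae by eventually_elim simp
  ultimately show "set_integrable lebesgue K (\<lambda>x. (f x)\<^sup>2)"
    using LINT_lebesgue_AE(2)[of "\<lambda>x. (g x)\<^sup>2" "\<lambda>x. (f x)\<^sup>2" K] g K by (simp add: borel_compact)
qed

lemma L2_locE:
  assumes "f \<in> L2_loc"
  obtains g where "g \<in> borel_measurable borel" "AE x in lebesgue. f x = g x"
    "\<And>x y. set_integrable lborel {x..y} (\<lambda>t. (g t)\<^sup>2)"
proof -
  have f: "f \<in> borel_measurable lebesgue" "\<And>K. compact K \<Longrightarrow> set_integrable lebesgue K (\<lambda>x. (f x)\<^sup>2)"
    using assms by (auto simp: L2_loc_def)
  obtain g where g: "g \<in> borel_measurable lborel" "AE x in lborel. f x = g x"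
    using completion_ex_borel_measurable_real[OF f(1)] by auto
  then have g': "g \<in> borel_measurable borel" "AE x in lebesgue. f x = g x" by (auto intro: AE_completion)
  have "AE x in lebesgue. (f x)\<^sup>2 = (g x)\<^sup>2" using g'(2) by eventually_elim simp
  then have "set_integrable lborel {x..y} (\<lambda>t. (g t)\<^sup>2)" for x y
    using LINT_lebesgue_AE(2)[of "\<lambda>x. (g x)\<^sup>2" "\<lambda>x. (f x)\<^sup>2" "{x..y}"] g' f(2)[of "{x..y}"] by simp
  with g' show thesis by (rule that)
qed

lemma continuous_AE_eq:
  fixes f g :: "real \<Rightarrow> real"
  assumes "continuous_on UNIV f" "continuous_on UNIV g" "AE x in lebesgue. f x = g x"
  shows "f = g"
proof -
  have "open {x. f x \<noteq> g x}" using assms(1,2) by (rule open_Collect_neq)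
  moreover have "{x \<in> space lebesgue. \<not> f x = g x} \<in> null_sets lebesgue"
    using assms(3) by (rule iffD1[OF completion.AE_iff_null_sets])
  then have "negligible {x. f x \<noteq> g x}" by (simp add: negligible_iff_null_sets)
  ultimately show ?thesis using open_not_negligible by fastforce
qed

lemma primitive_exists:
  fixes g :: "real \<Rightarrow> real"
  assumes int: "\<And>x y. set_integrable lborel {x..y} g"
  shows "primitive_on UNIV (\<lambda>x. (LINT t:{0..x}|lborel. g t) - (LINT t:{x..0}|lborel. g t)) g"
  unfolding primitive_on_def
proof (intro ballI impI)
  fix x y :: real assume xy: "x \<le> y"
  define F where "F x = (LINT t:{0..x}|lborel. g t) - (LINT t:{x..0}|lborel. g t)" for x
  have pt: "(LINT t:{a..a}|lborel. g t) = 0" for a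
    using set_borel_integral_eq_integral(2)[OF int, of a a] by simp
  have emp: "(LINT t:{a..b}|lborel. g t) = 0" if "b < a" for a b using that by (simp add: set_lebesgue_integral_def)
  have "F x + (LINT t:{x..y}|lborel. g t) = F y"
  proof -
    have z: "0 \<le> a \<Longrightarrow> (LINT t:{a..0}|lborel. g t) = 0" "a \<le> 0 \<Longrightarrow> (LINT t:{0..a}|lborel. g t) = 0" for a
      using emp[of 0 a] emp[of a 0] pt[of 0] by (cases "a = 0"; simp)+
    consider "0 \<le> x" | "x \<le> 0" "0 \<le> y" | "y \<le> 0" using xy by linarith
    then show ?thesis
    proof cases
      case 1
      then show ?thesis using LINT_Icc_split[OF int, of 0 x y] xy z(1)[of x] z(1)[of y] unfolding F_def by linarith
    next
      case 2
      then show ?thesis using LINT_Icc_split[OF int, of x 0 y] xy z(2)[of x] z(1)[of y] unfolding F_def by linarith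
    next
      case 3
      then show ?thesis using LINT_Icc_split[OF int, of x y 0] xy z(2)[of x] z(2)[of y] unfolding F_def by linarith
    qed
  qed
  then show "set_integrable lborel {x..y} g \<and> (LINT t:{x..y}|lborel. g t) =
      (LINT t:{0..y}|lborel. g t) - (LINT t:{y..0}|lborel. g t) - ((LINT t:{0..x}|lborel. g t) - (LINT t:{x..0}|lborel. g t))"
    using int by (simp add: F_def)
qed

lemma test_function_bounded_support:
  fixes \<phi> :: "real \<Rightarrow> real"
  assumes "\<phi> C1_differentiable_on UNIV" "compact (closure {x. \<phi> x \<noteq> 0})"
  obtains N where "0 < N" "\<And>x. N \<le> \<bar>x\<bar> \<Longrightarrow> \<phi> x = 0" "\<And>x. N \<le> \<bar>x\<bar> \<Longrightarrow> deriv \<phi> x = 0"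
    "continuous_on UNIV (deriv \<phi>)" "\<And>x. (\<phi> has_real_derivative deriv \<phi> x) (at x)"
proof -
  obtain D where D: "\<And>x. (\<phi> has_vector_derivative D x) (at x)" "continuous_on UNIV D"
    using assms(1) unfolding C1_differentiable_on_def by blast
  then have der: "(\<phi> has_real_derivative D x) (at x)" for x by (simp add: has_real_derivative_iff_has_vector_derivative)
  have dD: "deriv \<phi> = D" by (intro ext DERIV_imp_deriv der)
  obtain b where b: "\<forall>x\<in>closure {x. \<phi> x \<noteq> 0}. norm x \<le> b"
    using compact_imp_bounded[OF assms(2), unfolded bounded_iff] by (rule exE)
  have z: "\<phi> x = 0" if "\<bar>b\<bar> < \<bar>x\<bar>" for x
  proof (rule ccontr)
    assume "\<phi> x \<noteq> 0"
    then have "x \<in> closure {x. \<phi> x \<noteq> 0}" by (intro subsetD[OF closure_subset]) simp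
    then have "norm x \<le> b" using b by simp
    then show False using that by simp
  qed
  have d: "D x = 0" if "\<bar>b\<bar> < \<bar>x\<bar>" for x
  proof -
    have "open {x. \<bar>b\<bar> < \<bar>x\<bar>}" by (intro open_Collect_less continuous_intros)
    then have "\<forall>\<^sub>F y in nhds x. y \<in> {x. \<bar>b\<bar> < \<bar>x\<bar>}" by (rule eventually_nhds_in_open) (use that in auto)
    then have "\<forall>\<^sub>F y in nhds x. \<phi> y = 0" by eventually_elim (use z in auto)
    then have "((\<lambda>_. 0) has_real_derivative D x) (at x)"
      using DERIV_cong_ev[of x x \<phi> "\<lambda>_. 0" "D x" "D x"] der[of x] by simp
    then show ?thesis by (rule DERIV_unique[OF _ DERIV_const])
  qed
  show thesis
  proof (rule that[of "\<bar>b\<bar> + 1"])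
    show "\<phi> x = 0" "deriv \<phi> x = 0" if "\<bar>b\<bar> + 1 \<le> \<bar>x\<bar>" for x
      using z[of x] d[of x] that unfolding dD by simp_all
    show "continuous_on UNIV (deriv \<phi>)" "(\<phi> has_real_derivative deriv \<phi> x) (at x)" for x
      using D(2) der unfolding dD by simp_all
  qed simp
qed

lemma LINT_supported:
  fixes f :: "real \<Rightarrow> real"
  assumes "\<And>x. x \<notin> S \<Longrightarrow> f x = 0"
  shows "(LINT x|M. f x) = (LINT x:S|M. f x)"
  unfolding set_lebesgue_integral_def by (rule Bochner_Integration.integral_cong) (auto simp: indicator_def assms)

text \<open>Integration by parts on an interval that contains the support of the test function.\<close>
lemma primitive_is_weak_deriv:
  assumes W: "primitive_on UNIV W G" and [measurable]: "G \<in> borel_measurable borel"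
  shows "is_weak_deriv W G"
  unfolding is_weak_deriv_def
proof (intro allI impI)
  fix \<phi> :: "real \<Rightarrow> real"
  assume "\<phi> C1_differentiable_on UNIV \<and> compact (closure {x. \<phi> x \<noteq> 0})"
  then obtain N where N: "0 < N" "\<And>x. N \<le> \<bar>x\<bar> \<Longrightarrow> \<phi> x = 0" "\<And>x. N \<le> \<bar>x\<bar> \<Longrightarrow> deriv \<phi> x = 0"
    "continuous_on UNIV (deriv \<phi>)" "\<And>x. (\<phi> has_real_derivative deriv \<phi> x) (at x)"
    using test_function_bounded_support by blast
  note cW = primitive_on_UNIV_continuous[OF W]
  have c\<phi>: "continuous_on S \<phi>" for S using N(5) DERIV_isCont by (auto intro!: continuous_at_imp_continuous_on)
  have [measurable]: "W \<in> borel_measurable borel" "\<phi> \<in> borel_measurable borel" "deriv \<phi> \<in> borel_measurable borel"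
    using borel_measurable_continuous_onI cW c\<phi> N(4) by auto
  obtain C where C: "\<And>t. t \<in> {- N..N} \<Longrightarrow> \<bar>deriv \<phi> t\<bar> \<le> C"
    using continuous_on_Icc_bounded[OF continuous_on_subset[OF N(4)], of "- N" N] by auto
  have P: "primitive_on {- N..N} \<phi> (deriv \<phi>)"
    by (rule primitive_onI_DERIV[of "{}"]) (use N C c\<phi> in auto)
  have "primitive_on {- N..N} (\<lambda>x. W x * \<phi> x) (\<lambda>x. G x * \<phi> x + W x * deriv \<phi> x)"
    by (rule primitive_on_mult[OF primitive_on_subset[OF W] P]) auto
  from primitive_onD(2)[OF this, of "- N" N] N(1) N(2)[of N] N(2)[of "- N"]
  have "(LINT x:{- N..N}|lborel. G x * \<phi> x + W x * deriv \<phi> x) = 0" by simp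
  moreover have "set_integrable lborel {- N..N} (\<lambda>x. G x * \<phi> x)"
    using primitive_onD(1)[OF W, of "- N" N] N(1) c\<phi> by (intro set_integrable_mult_continuous) auto
  moreover have "set_integrable lborel {- N..N} (\<lambda>x. W x * deriv \<phi> x)"
    by (rule set_integrable_mult_continuous[OF set_integrable_continuous_Icc[OF cW] continuous_on_subset[OF N(4)]]) simp
  ultimately have "(LINT x:{- N..N}|lborel. W x * deriv \<phi> x) = - (LINT x:{- N..N}|lborel. G x * \<phi> x)"
    by (simp add: set_integral_add)
  moreover have "x \<notin> {- N..N} \<Longrightarrow> N \<le> \<bar>x\<bar>" for x by auto
  then have "(LINT x|lebesgue. W x * deriv \<phi> x) = (LINT x:{- N..N}|lborel. W x * deriv \<phi> x)"
    "(LINT x|lebesgue. G x * \<phi> x) = (LINT x:{- N..N}|lborel. G x * \<phi> x)"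
    using N(2,3) by (auto simp: integral_completion intro!: LINT_supported)
  ultimately show "(LINT x|lebesgue. W x * deriv \<phi> x) = - (LINT x|lebesgue. G x * \<phi> x)" by simp
qed

lemma test_function_of_mean_zero:
  fixes \<psi> :: "real \<Rightarrow> real"
  assumes c: "continuous_on UNIV \<psi>" and N: "0 < N" "\<And>x. N \<le> \<bar>x\<bar> \<Longrightarrow> \<psi> x = 0" and z: "(LINT x:{- N..N}|lborel. \<psi> x) = 0"
  obtains \<phi> where "\<phi> C1_differentiable_on UNIV" "compact (closure {x. \<phi> x \<noteq> 0})" "deriv \<phi> = \<psi>"
proof -
  have int: "set_integrable lborel {x..y} \<psi>" for x y
    by (rule set_integrable_continuous_Icc[OF continuous_on_subset[OF c]]) auto
  \<comment> \<open>The lower limit is strictly to the left of the support, so that \<open>\<phi>\<close> is differentiable at \<open>- N\<close> too.\<close>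
  define \<phi> where "\<phi> x = integral {- N - 1..x} \<psi>" for x
  have out: "\<phi> x = 0" if x: "x \<le> - N" for x
  proof (cases "- N - 1 \<le> x")
    case True
    have "integral {- N - 1..x} \<psi> = integral {- N - 1..x} (\<lambda>_. 0)"
      by (rule Henstock_Kurzweil_Integration.integral_cong) (use x N in auto)
    then show ?thesis by (simp add: \<phi>_def)
  qed (simp add: \<phi>_def)
  have pr: "\<phi> y = \<phi> x + (LINT t:{x..y}|lborel. \<psi> t)" if "- N - 1 \<le> x" "x \<le> y" for x y
    using LINT_Icc_split[OF int that] unfolding \<phi>_def by (simp add: set_borel_integral_eq_integral(2)[OF int])
  have out': "\<phi> x = 0" if x: "N \<le> x" for x
  proof -
    have "\<phi> N = 0" using pr[of "- N" N] out[of "- N"] z N(1) by simp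
    moreover have "(LINT t:{N..x}|lborel. \<psi> t) = (LINT t:{N..x}|lborel. 0)"
      by (rule set_lebesgue_integral_cong) (use N in auto)
    ultimately show ?thesis using pr[of N x] x N(1) by simp
  qed
  have der: "(\<phi> has_real_derivative \<psi> x) (at x)" for x
  proof (cases "- N - 1 < x")
    case True
    have "(\<phi> has_real_derivative \<psi> x) (at x within {- N - 1..x + 1})"
      unfolding \<phi>_def using True by (intro integral_has_real_derivative continuous_on_subset[OF c]) auto
    moreover have "at x within {- N - 1..x + 1} = at x" using True by (intro at_within_interior) auto
    ultimately show ?thesis by simp
  next
    case False
    have "\<forall>\<^sub>F y in nhds x. y \<in> {..< - N}" by (rule eventually_nhds_in_open) (use False in auto)
    then have "\<forall>\<^sub>F y in nhds x. \<phi> y = 0" by eventually_elim (use out in auto)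
    then have "(\<phi> has_real_derivative 0) (at x)" using DERIV_cong_ev[of x x \<phi> "\<lambda>_. 0" 0 0] by auto
    then show ?thesis using N(2)[of x] False by (simp add: abs_if)
  qed
  have "\<phi> C1_differentiable_on UNIV"
    using der c by (auto simp: C1_differentiable_on_def has_real_derivative_iff_has_vector_derivative)
  moreover have "compact (closure {x. \<phi> x \<noteq> 0})"
  proof -
    have "{x. \<phi> x \<noteq> 0} \<subseteq> {- N..N}" 
    proof
      fix x assume "x \<in> {x. \<phi> x \<noteq> 0}"
      then have "\<not> x \<le> - N" "\<not> N \<le> x" using out[of x] out'[of x] by auto
      then show "x \<in> {- N..N}" by simp
    qed
    then have "closure {x. \<phi> x \<noteq> 0} \<subseteq> {- N..N}" by (rule closure_minimal) simp
    then show ?thesis using compact_Int_closed[of "{- N..N}" "closure {x. \<phi> x \<noteq> 0}"] by (simp add: Int_absorb1)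
  qed
  moreover have "deriv \<phi> = \<psi>" using der DERIV_imp_deriv by blast
  ultimately show thesis by (rule that)
qed

text \<open>Continuous approximations of the indicator function of \<open>[a, b]\<close>, with support in the
  \<open>1 / n\<close>-neighbourhood.\<close>
definition trap :: "real \<Rightarrow> real \<Rightarrow> real \<Rightarrow> real \<Rightarrow> real" where
  "trap a b n x = max 0 (min 1 (1 + n * min (x - a) (b - x)))"

text \<open>Subtracting a multiple of a fixed bump \<open>\<eta>\<close> from a continuous function of compact support leaves one with
  integral 0, hence the derivative of a test function. So, with \<open>c\<close> the mean of \<open>h\<close> with respect to \<open>\<eta>\<close>, the
  function \<open>h - c\<close> is orthogonal to all continuous functions of compact support, and the approximations of
  indicator functions show that it is 0 almost everywhere.\<close>
lemma constant_if_weak_deriv_0: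
  fixes h :: "real \<Rightarrow> real"
  assumes [measurable]: "h \<in> borel_measurable borel" and int: "\<And>x y. set_integrable lborel {x..y} h"
    and weak: "\<And>\<phi>::real \<Rightarrow> real. \<phi> C1_differentiable_on UNIV \<Longrightarrow> compact (closure {x. \<phi> x \<noteq> 0}) \<Longrightarrow> 
      (LINT x|lborel. h x * deriv \<phi> x) = 0"
  obtains c where "AE x in lborel. h x = c"
proof -
  have ctrap: "continuous_on S (trap a b n)" for S a b n unfolding trap_def by (intro continuous_intros)
  have [measurable]: "trap a b n \<in> borel_measurable borel" for a b n unfolding trap_def by measurable
  have trap01: "0 \<le> trap a b n x" "trap a b n x \<le> 1" for a b n x by (auto simp: trap_def)
  have out: "trap a b n x = 0" if "1 \<le> n" "x \<le> a - 1 \<or> b + 1 \<le> x" for a b n x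
  proof -
    have "min (x - a) (b - x) \<le> - 1" using that by auto
    then have "n * min (x - a) (b - x) \<le> n * - 1" using that by (intro mult_left_mono) auto
    also have "\<dots> \<le> - 1" using that by simp
    finally have "n * min (x - a) (b - x) \<le> - 1" .
    then show ?thesis by (simp add: trap_def)
  qed
  have inside: "trap a b n x = 1" if "0 \<le> n" "a \<le> x" "x \<le> b" for a b n x using that by (simp add: trap_def)
  define \<eta> where "\<eta> = trap 0 1 1"
  have \<eta>1: "1 \<le> (LINT x:{- M..M}|lborel. \<eta> x)" if "2 \<le> M" for M
  proof -
    have "(LINT x:{0..1::real}|lborel. 1) \<le> (LINT x:{0..1}|lborel. \<eta> x)"
    proof (rule set_integral_mono)
      show "set_integrable lborel {0..1::real} (\<lambda>_. 1::real)" by (rule set_integrable_continuous_Icc) auto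
      show "set_integrable lborel {0..1} \<eta>" unfolding \<eta>_def by (rule set_integrable_continuous_Icc[OF ctrap])
    qed (simp add: \<eta>_def inside)
    also have "\<dots> \<le> (LINT x:{- M..M}|lborel. \<eta> x)"
      by (rule LINT_Icc_mono_set) (use that in \<open>auto simp: \<eta>_def trap01 intro!: set_integrable_continuous_Icc ctrap\<close>)
    finally show ?thesis by (simp add: set_integral_const)
  qed
  have mult_int: "set_integrable lborel {x..y} (\<lambda>t. h t * \<psi> t)" if "continuous_on UNIV \<psi>" for x y \<psi>
    by (rule set_integrable_mult_continuous[OF int continuous_on_subset[OF that]]) auto
  have key: "(LINT x:{- M..M}|lborel. h x * \<psi> x) = 0"
    if c: "continuous_on UNIV \<psi>" and N: "0 < M" "\<And>x. M \<le> \<bar>x\<bar> \<Longrightarrow> \<psi> x = 0" "(LINT x:{- M..M}|lborel. \<psi> x) = 0" for \<psi> M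
  proof -
    obtain \<phi> where \<phi>: "\<phi> C1_differentiable_on UNIV" "compact (closure {x. \<phi> x \<noteq> 0})" "deriv \<phi> = \<psi>"
      using test_function_of_mean_zero[OF c N] .
    have "x \<notin> {- M..M} \<Longrightarrow> \<psi> x = 0" for x using N(2)[of x] by auto
    then have "(LINT x|lborel. h x * \<psi> x) = (LINT x:{- M..M}|lborel. h x * \<psi> x)" by (intro LINT_supported) auto
    then show ?thesis using weak[OF \<phi>(1,2)] \<phi>(3) by simp
  qed
  define I where "I M = (LINT x:{- M..M}|lborel. \<eta> x)" for M
  have supp\<eta>: "\<eta> x = 0" if "2 \<le> \<bar>x\<bar>" for x unfolding \<eta>_def by (rule out) (use that in auto)
  define c where "c = (LINT x:{- 2..2}|lborel. h x * \<eta> x) / I 2"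
  have ext: "(LINT x:{- M..M}|lborel. f x) = (LINT x:{- 2..2}|lborel. f x)" if "2 \<le> M" "\<And>x. 2 \<le> \<bar>x\<bar> \<Longrightarrow> f x = 0" for M and f :: "real \<Rightarrow> real"
    unfolding set_lebesgue_integral_def
    by (rule Bochner_Integration.integral_cong) (use that in \<open>auto simp: indicator_def\<close>)
  have trap0: "(LINT x:{- M..M}|lborel. (h x - c) * trap a b n x) = 0" if n: "1 \<le> n" and M: "\<bar>a\<bar> + 1 \<le> M" "\<bar>b\<bar> + 1 \<le> M" "2 \<le> M" for a b n M
  proof -
    define J where "J = (LINT x:{- M..M}|lborel. trap a b n x)"
    define \<psi> where "\<psi> x = trap a b n x - J / I 2 * \<eta> x" for x
    have c\<psi>: "continuous_on UNIV \<psi>" unfolding \<psi>_def \<eta>_def by (intro continuous_intros ctrap)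
    have I2: "I M = I 2" "0 < I 2" using ext[OF M(3), of \<eta>] supp\<eta> \<eta>1[of 2] by (auto simp: I_def)
    have it: "set_integrable lborel {- M..M} (trap a b n)" "set_integrable lborel {- M..M} \<eta>"
      unfolding \<eta>_def by (intro set_integrable_continuous_Icc ctrap)+
    have "(LINT x:{- M..M}|lborel. \<psi> x) = J - J / I 2 * I M"
      unfolding \<psi>_def J_def I_def using it by (simp add: set_integral_diff)
    then have z: "(LINT x:{- M..M}|lborel. \<psi> x) = 0" using I2 by simp
    have sup: "\<psi> x = 0" if "M \<le> \<bar>x\<bar>" for x
    proof -
      have "trap a b n x = 0" by (rule out[OF n]) (use that M in \<open>auto simp: abs_if split: if_splits\<close>)
      then show ?thesis using supp\<eta>[of x] that M by (simp add: \<psi>_def)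
    qed
    have 0: "(LINT x:{- M..M}|lborel. h x * \<psi> x) = 0" by (rule key[OF c\<psi> _ sup z]) (use M in auto)
    have ih: "set_integrable lborel {- M..M} (\<lambda>t. h t * trap a b n t)" "set_integrable lborel {- M..M} (\<lambda>t. h t * \<eta> t)"
      unfolding \<eta>_def by (intro mult_int ctrap)+
    have "(\<lambda>x. h x * \<psi> x) = (\<lambda>x. h x * trap a b n x - J / I 2 * (h x * \<eta> x))" by (auto simp: \<psi>_def algebra_simps)
    then have "(LINT x:{- M..M}|lborel. h x * \<psi> x)
       = (LINT x:{- M..M}|lborel. h x * trap a b n x) - J / I 2 * (LINT x:{- M..M}|lborel. h x * \<eta> x)"
      using ih by (simp add: set_integral_diff)
    moreover have "J / I 2 * (LINT x:{- M..M}|lborel. h x * \<eta> x) = c * J"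
      using ext[OF M(3), of "\<lambda>x. h x * \<eta> x"] supp\<eta> by (simp add: c_def)
    moreover have "(LINT x:{- M..M}|lborel. (h x - c) * trap a b n x) = (LINT x:{- M..M}|lborel. h x * trap a b n x) - c * J"
      unfolding J_def using ih it by (simp add: left_diff_distrib set_integral_diff)
    ultimately show ?thesis using 0 by simp
  qed
  have "AE x in lborel. h x - c = 0"
  proof (rule AE_eq_0_if_integrals_0)
    show i: "set_integrable lborel {a..b} (\<lambda>x. h x - c)" for a b
      by (intro set_integral_diff(1) int set_integrable_continuous_Icc) auto
    fix a b :: real assume ab: "a \<le> b"
    define M where "M = max 2 (max (\<bar>a\<bar> + 1) (\<bar>b\<bar> + 1))"
    have M: "\<bar>a\<bar> + 1 \<le> M" "\<bar>b\<bar> + 1 \<le> M" "2 \<le> M" by (auto simp: M_def)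
    have "(\<lambda>k. LINT x|lborel. indicator {- M..M} x *\<^sub>R ((h x - c) * trap a b (real k + 1) x)) \<longlonglongrightarrow>
       (LINT x|lborel. indicator {a..b} x *\<^sub>R (h x - c))"
    proof (rule integral_dominated_convergence[where w = "\<lambda>x. indicator {- M..M} x *\<^sub>R \<bar>h x - c\<bar>"])
      show "integrable lborel (\<lambda>x. indicator {- M..M} x *\<^sub>R \<bar>h x - c\<bar>)"
        using set_integrable_abs[OF i[of "- M" M]] by (simp add: set_integrable_def)
      show "AE x in lborel. (\<lambda>k. indicator {- M..M} x *\<^sub>R ((h x - c) * trap a b (real k + 1) x)) \<longlonglongrightarrow> indicator {a..b} x *\<^sub>R (h x - c)"
      proof (rule AE_I2)
        fix x
        show "(\<lambda>k. indicator {- M..M} x *\<^sub>R ((h x - c) * trap a b (real k + 1) x)) \<longlonglongrightarrow> indicator {a..b} x *\<^sub>R (h x - c)"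
        proof (cases "x \<in> {a..b}")
          case True
          then have "x \<in> {- M..M}" using M by (auto simp: abs_if split: if_splits)
          then show ?thesis using True inside[of "real _ + 1" a x b] by simp
        next
          case False
          define m where "m = min (x - a) (b - x)"
          have m: "m < 0" using False by (auto simp: m_def)
          obtain K :: nat where K: "1 / - m < real K" using reals_Archimedean2 by blast
          have "trap a b (real k + 1) x = 0" if "k \<ge> K" for k
          proof -
            have "1 / - m < real k + 1" using K that by linarith
            then have "1 < (real k + 1) * - m" by (rule iffD1[OF pos_divide_less_eq, rotated]) (use m in simp)
            then show ?thesis by (simp add: trap_def m_def)
          qed
          then have "\<forall>\<^sub>F k in sequentially. indicator {- M..M} x *\<^sub>R ((h x - c) * trap a b (real k + 1) x) = 0"
            by (auto simp: eventually_sequentially)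
          then show ?thesis using False by (simp add: tendsto_eventually)
        qed
      qed
      show "AE x in lborel. norm (indicator {- M..M} x *\<^sub>R ((h x - c) * trap a b (real k + 1) x)) \<le> indicator {- M..M} x *\<^sub>R \<bar>h x - c\<bar>" for k
        using trap01 by (auto simp: indicator_def abs_mult intro!: AE_I2 mult_left_le)
    qed auto
    moreover have "(LINT x|lborel. indicator {- M..M} x *\<^sub>R ((h x - c) * trap a b (real k + 1) x)) = 0" for k
      using trap0[OF _ M, of "real k + 1"] by (simp add: set_lebesgue_integral_def)
    ultimately have "(\<lambda>k::nat. 0) \<longlonglongrightarrow> (LINT x:{a..b}|lborel. h x - c)" by (simp add: set_lebesgue_integral_def)
    then show "(LINT x:{a..b}|lborel. h x - c) = 0" by (simp add: LIMSEQ_const_iff)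
  qed auto
  then have "AE x in lborel. h x = c" by eventually_elim simp
  then show thesis by (rule that)
qed

text \<open>The regular representatives: \<open>W\<close> is the continuous representative of an element of \<open>H1_loc\<close>, and
  \<open>G\<close> is a Borel representative of its weak derivative.\<close>
definition sobolev_pair :: "(real \<Rightarrow> real) \<Rightarrow> (real \<Rightarrow> real) \<Rightarrow> bool" where
  "sobolev_pair W G \<longleftrightarrow> primitive_on UNIV W G \<and> G \<in> borel_measurable borel \<and>
     (\<forall>x y. set_integrable lborel {x..y} (\<lambda>t. (G t)\<^sup>2))"

text \<open>A primitive \<open>F\<close> of the weak derivative has the same weak derivative, so \<open>w - F\<close> is constant.\<close>
lemma weak_deriv_imp_primitive:
  assumes w: "w \<in> L2_loc" and g: "g \<in> L2_loc" and weak: "is_weak_deriv w g"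
  obtains W G where "sobolev_pair W G" "AE x in lebesgue. w x = W x" "AE x in lebesgue. g x = G x"
proof -
  obtain w0 where w0 [measurable]: "w0 \<in> borel_measurable borel" and aw: "AE x in lebesgue. w x = w0 x"
    and w02: "\<And>x y. set_integrable lborel {x..y} (\<lambda>t. (w0 t)\<^sup>2)" using L2_locE[OF w] by blast
  obtain G where G [measurable]: "G \<in> borel_measurable borel" and ag: "AE x in lebesgue. g x = G x"
    and G2: "\<And>x y. set_integrable lborel {x..y} (\<lambda>t. (G t)\<^sup>2)" using L2_locE[OF g] by blast
  have iG: "set_integrable lborel {x..y} G" for x y by (rule set_integrable_of_square[OF G G2])
  have iw: "set_integrable lborel {x..y} w0" for x y by (rule set_integrable_of_square[OF w0 w02])
  obtain F where F: "primitive_on UNIV F G" using primitive_exists[OF iG] by blast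
  note cF = primitive_on_UNIV_continuous[OF F]
  have [measurable]: "F \<in> borel_measurable borel" by (rule borel_measurable_continuous_onI[OF cF])
  obtain c where c: "AE x in lborel. w0 x - F x = c"
  proof (rule constant_if_weak_deriv_0[of "\<lambda>x. w0 x - F x"])
    show "set_integrable lborel {x..y} (\<lambda>x. w0 x - F x)" for x y
      by (intro set_integral_diff(1) iw set_integrable_continuous_Icc cF)
    fix \<phi> :: "real \<Rightarrow> real"
    assume \<phi>: "\<phi> C1_differentiable_on UNIV" "compact (closure {x. \<phi> x \<noteq> 0})"
    then obtain N where N: "0 < N" "\<And>x. N \<le> \<bar>x\<bar> \<Longrightarrow> \<phi> x = 0" "\<And>x. N \<le> \<bar>x\<bar> \<Longrightarrow> deriv \<phi> x = 0"
      "continuous_on UNIV (deriv \<phi>)" "\<And>x. (\<phi> has_real_derivative deriv \<phi> x) (at x)"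
      using test_function_bounded_support by blast
    have c\<phi>: "continuous_on S \<phi>" for S using N(5) DERIV_isCont by (auto intro!: continuous_at_imp_continuous_on)
    have [measurable]: "\<phi> \<in> borel_measurable borel" "deriv \<phi> \<in> borel_measurable borel"
      using borel_measurable_continuous_onI c\<phi> N(4) by auto
    have out: "x \<notin> {- N..N} \<Longrightarrow> N \<le> \<bar>x\<bar>" for x by auto
    have "(LINT x|lebesgue. w x * deriv \<phi> x) = - (LINT x|lebesgue. g x * \<phi> x)"
      "(LINT x|lebesgue. F x * deriv \<phi> x) = - (LINT x|lebesgue. G x * \<phi> x)"
      using weak primitive_is_weak_deriv[OF F G] \<phi> by (auto simp: is_weak_deriv_def)
    moreover have "(LINT x|lebesgue. w x * deriv \<phi> x) = (LINT x:UNIV|lborel. w0 x * deriv \<phi> x)"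
    proof -
      have "AE x in lebesgue. w x * deriv \<phi> x = w0 x * deriv \<phi> x" using aw by eventually_elim simp
      then show ?thesis using LINT_lebesgue_AE(1)[of "\<lambda>x. w0 x * deriv \<phi> x" "\<lambda>x. w x * deriv \<phi> x" UNIV]
        by (simp add: set_lebesgue_integral_def)
    qed
    moreover have "(LINT x|lebesgue. g x * \<phi> x) = (LINT x:UNIV|lborel. G x * \<phi> x)"
    proof -
      have "AE x in lebesgue. g x * \<phi> x = G x * \<phi> x" using ag by eventually_elim simp
      then show ?thesis using LINT_lebesgue_AE(1)[of "\<lambda>x. G x * \<phi> x" "\<lambda>x. g x * \<phi> x" UNIV]
        by (simp add: set_lebesgue_integral_def)
    qed
    moreover have "(LINT x|lebesgue. G x * \<phi> x) = (LINT x|lborel. G x * \<phi> x)"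
      "(LINT x|lebesgue. F x * deriv \<phi> x) = (LINT x|lborel. F x * deriv \<phi> x)" by (auto simp: integral_completion)
    ultimately have eq: "(LINT x|lborel. w0 x * deriv \<phi> x) = (LINT x|lborel. F x * deriv \<phi> x)"
      by (simp add: set_lebesgue_integral_def)
    have "(LINT x|lborel. (w0 x - F x) * deriv \<phi> x) = (LINT x:{- N..N}|lborel. w0 x * deriv \<phi> x - F x * deriv \<phi> x)"
      using LINT_supported[of "{- N..N}" "\<lambda>x. (w0 x - F x) * deriv \<phi> x"] N(3) out by (simp add: left_diff_distrib)
    also have "\<dots> = (LINT x:{- N..N}|lborel. w0 x * deriv \<phi> x) - (LINT x:{- N..N}|lborel. F x * deriv \<phi> x)"
    proof (rule set_integral_diff(2))
      show "set_integrable lborel {- N..N} (\<lambda>x. w0 x * deriv \<phi> x)"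
        by (rule set_integrable_mult_continuous[OF iw continuous_on_subset[OF N(4)]]) simp
      show "set_integrable lborel {- N..N} (\<lambda>x. F x * deriv \<phi> x)"
        by (rule set_integrable_mult_continuous[OF set_integrable_continuous_Icc[OF cF] continuous_on_subset[OF N(4)]]) simp
    qed
    also have "\<dots> = (LINT x|lborel. w0 x * deriv \<phi> x) - (LINT x|lborel. F x * deriv \<phi> x)"
      using LINT_supported[of "{- N..N}" "\<lambda>x. w0 x * deriv \<phi> x"] LINT_supported[of "{- N..N}" "\<lambda>x. F x * deriv \<phi> x"] N(3) out by simp
    finally show "(LINT x|lborel. (w0 x - F x) * deriv \<phi> x) = 0" using eq by simp
  qed auto
  have "AE x in lebesgue. w x = F x + c" using aw AE_completion[OF c] by eventually_elim simp
  moreover have "primitive_on UNIV (\<lambda>x. F x + c) G" using F by (simp add: primitive_on_def)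
  ultimately show thesis using ag G G2 by (intro that[of "\<lambda>x. F x + c" G]) (auto simp: sobolev_pair_def)
qed

lemma sobolev_pairD:
  assumes "sobolev_pair W G"
  shows "primitive_on UNIV W G" "G \<in> borel_measurable borel" "set_integrable lborel {x..y} (\<lambda>t. (G t)\<^sup>2)"
    "continuous_on S W" "W \<in> borel_measurable borel"
proof -
  show c: "continuous_on S W" for S
    using assms primitive_on_UNIV_continuous unfolding sobolev_pair_def by blast
  show "W \<in> borel_measurable borel" by (rule borel_measurable_continuous_onI[OF c])
qed (use assms in \<open>auto simp: sobolev_pair_def\<close>)

lemma sobolev_pair_weak_deriv:
  assumes "sobolev_pair W G" and w: "AE x in lebesgue. w x = W x"
  shows "w \<in> L2_loc" "G \<in> L2_loc" "is_weak_deriv w G"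
proof -
  note WG = sobolev_pairD[OF assms(1)]
  note [measurable] = WG(2,5)
  show "w \<in> L2_loc" by (rule L2_locI[OF WG(5) w]) (intro set_integrable_continuous_Icc continuous_intros WG(4))
  show "G \<in> L2_loc" by (rule L2_locI[OF WG(2) _ WG(3)]) auto
  have weak: "is_weak_deriv W G" by (rule primitive_is_weak_deriv[OF WG(1,2)])
  show "is_weak_deriv w G" unfolding is_weak_deriv_def
  proof (intro allI impI)
    fix \<phi> :: "real \<Rightarrow> real"
    assume \<phi>: "\<phi> C1_differentiable_on UNIV \<and> compact (closure {x. \<phi> x \<noteq> 0})"
    then have "continuous_on UNIV (deriv \<phi>)" using test_function_bounded_support by blast
    then have [measurable]: "deriv \<phi> \<in> borel_measurable borel" by (rule borel_measurable_continuous_onI)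
    have "AE x in lebesgue. w x * deriv \<phi> x = W x * deriv \<phi> x" using w by eventually_elim simp
    then have "(LINT x|lebesgue. w x * deriv \<phi> x) = (LINT x:UNIV|lborel. W x * deriv \<phi> x)"
      using LINT_lebesgue_AE(1)[of "\<lambda>x. W x * deriv \<phi> x" "\<lambda>x. w x * deriv \<phi> x" UNIV]
      by (simp add: set_lebesgue_integral_def)
    also have "\<dots> = (LINT x|lebesgue. W x * deriv \<phi> x)" by (simp add: integral_completion set_lebesgue_integral_def)
    also have "\<dots> = - (LINT x|lebesgue. G x * \<phi> x)" using weak \<phi> unfolding is_weak_deriv_def by blast
    finally show "(LINT x|lebesgue. w x * deriv \<phi> x) = - (LINT x|lebesgue. G x * \<phi> x)" .
  qed
qed

lemma H1_loc_iff_sobolev_pair: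
  "w \<in> H1_loc \<longleftrightarrow> (\<exists>W G. sobolev_pair W G \<and> (AE x in lebesgue. w x = W x))"
proof
  assume "w \<in> H1_loc"
  then obtain g where g: "w \<in> L2_loc" "g \<in> L2_loc" "is_weak_deriv w g" unfolding H1_loc_def by blast
  obtain W G where "sobolev_pair W G" "AE x in lebesgue. w x = W x" "AE x in lebesgue. g x = G x"
    using weak_deriv_imp_primitive[OF g] .
  then show "\<exists>W G. sobolev_pair W G \<and> (AE x in lebesgue. w x = W x)" by blast
next
  assume "\<exists>W G. sobolev_pair W G \<and> (AE x in lebesgue. w x = W x)"
  then obtain W G where "sobolev_pair W G" "AE x in lebesgue. w x = W x" by blast
  from sobolev_pair_weak_deriv[OF this] show "w \<in> H1_loc" unfolding H1_loc_def by blast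
qed

text \<open>The choice made in the definition of the weak derivative is determined up to a null set.\<close>
lemma weak_deriv_sobolev_pair:
  assumes WG: "sobolev_pair W G" and w: "AE x in lebesgue. w x = W x"
  shows "AE x in lebesgue. weak_deriv w x = G x"
proof -
  have "\<exists>w'. w' \<in> L2_loc \<and> is_weak_deriv w w'" using sobolev_pair_weak_deriv[OF WG w] by blast
  then have "weak_deriv w \<in> L2_loc \<and> is_weak_deriv w (weak_deriv w)"
    unfolding weak_deriv_def by (rule someI_ex)
  then have wd: "weak_deriv w \<in> L2_loc" "is_weak_deriv w (weak_deriv w)" by auto
  obtain W' G' where WG': "sobolev_pair W' G'" and W': "AE x in lebesgue. w x = W' x" "AE x in lebesgue. weak_deriv w x = G' x"
    using weak_deriv_imp_primitive[OF sobolev_pair_weak_deriv(1)[OF WG w] wd] .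
  have "AE x in lebesgue. W' x = W x" using W'(1) w by eventually_elim simp
  then have "W' = W" by (rule continuous_AE_eq[OF sobolev_pairD(4)[OF WG'] sobolev_pairD(4)[OF WG]])
  then have "AE x in lborel. G' x = G x"
    using primitive_on_UNIV_unique[of W G' G] sobolev_pairD(1,2)[OF WG'] sobolev_pairD(1,2)[OF WG] by simp
  from AE_completion[OF this] W'(2) show ?thesis by eventually_elim simp
qed


section \<open>The change of variable\<close>

lemma AE_lebesgue_shift:
  fixes P :: "real \<Rightarrow> bool"
  assumes "AE x in lebesgue. P x"
  shows "AE x in lebesgue. P (x + c)"
proof -
  have "AE x in lborel. P x" using assms by (simp only: AE_completion_iff)
  then obtain N where N: "{x \<in> space lborel. \<not> P x} \<subseteq> N" "emeasure lborel N = 0" "N \<in> sets lborel"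
    by (rule AE_E)
  have "AE x in lborel. x \<notin> N" by (rule AE_not_in) (use N in auto)
  then have "AE x in lborel. c + 1 * x \<notin> N" by (rule AE_borel_affine[rotated 2]) (use N in auto)
  then have "AE x in lborel. P (x + c)" by eventually_elim (use N(1) in \<open>auto simp: add.commute\<close>)
  then show ?thesis by (rule AE_completion)
qed

text \<open>Almost every point satisfies the periodicity relation at all its translates by multiples of \<open>l\<close>
  simultaneously. There \<open>g\<close> agrees with the periodic extension of its restriction to one period.\<close>
lemma periodic_representative:
  fixes g :: "real \<Rightarrow> real"
  assumes l: "0 < l" and [measurable]: "g \<in> borel_measurable borel" and per: "AE t in lborel. g (t + l) = g t"
  obtains g0 where "g0 \<in> borel_measurable borel" "\<And>t. g0 (t + l) = g0 t" "AE t in lborel. g t = g0 t"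
proof -
  define g0 where "g0 t = g (t - l * of_int \<lfloor>t / l\<rfloor>)" for t
  have meas: "g0 \<in> borel_measurable borel" unfolding g0_def by measurable
  have "g0 (t + l) = g0 t" for t
  proof -
    have "\<lfloor>(t + l) / l\<rfloor> = \<lfloor>t / l\<rfloor> + 1" using l by (simp add: add_divide_distrib)
    then show ?thesis by (simp add: g0_def algebra_simps)
  qed
  moreover have "AE t in lborel. g (of_int n * l + 1 * t + l) = g (of_int n * l + 1 * t)" for n :: int
    by (rule AE_borel_affine[OF _ _ per]) auto
  then have "AE t in lborel. \<forall>n::int. g (of_int n * l + 1 * t + l) = g (of_int n * l + 1 * t)"
    unfolding AE_all_countable by blast
  then have "AE t in lborel. g t = g0 t"
  proof eventually_elim
    case (elim t)
    have step: "g (t + of_int (n + 1) * l) = g (t + of_int n * l)" for n :: int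
      using elim[rule_format, of n] by (simp add: algebra_simps)
    have "g (t + of_int n * l) = g t" for n :: int
    proof (induction n rule: int_induct[where k = 0])
      case (step1 i) then show ?case using step[of i] by simp
    next
      case (step2 i) then show ?case using step[of "i - 1"] by simp
    qed simp
    from this[of "- \<lfloor>t / l\<rfloor>"] show ?case by (simp add: g0_def mult.commute)
  qed
  ultimately show thesis using meas by (intro that)
qed

context bang_bang begin

lemma integral_BU_period: "(LINT t:{x..x + 8 * al}|lborel. B t * U t) = 0"
proof -
  have "(LINT t:{x..x + 8 * al}|lborel. - (B t * U t)) = V (x + 8 * al) - V x"
    using primitive_onD(2)[OF primitive_V, of x "x + 8 * al"] al_pos by simp
  then show ?thesis using V_shift8[of x] by (simp add: set_lebesgue_integral_def)
qed

text \<open>The derivative of \<open>U V\<close> is \<open>V\<^sup>2 / B - B U\<^sup>2\<close>, and its integral over a period is 0.\<close>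
lemma profile_energy:
  shows "(LINT t:{x..x + 8 * al}|lborel. B t * (U t)\<^sup>2) = (LINT t:{x..x + 8 * al}|lborel. B t * (V t / B t)\<^sup>2)"
    and "0 < (LINT t:{x..x + 8 * al}|lborel. B t * (U t)\<^sup>2)"
proof -
  have wB: "weight B" using B_bounds by (simp add: weight_def)
  have i1: "set_integrable lborel {a..b} (\<lambda>t. B t * (U t)\<^sup>2)" for a b
    by (intro weight_mult_integrable[OF wB] set_integrable_continuous_Icc continuous_intros continuous_on_U)
  have "primitive_on {x..x + 8 * al} (\<lambda>t. U t * V t) (\<lambda>t. V t / B t * V t + U t * - (B t * U t))"
    by (intro primitive_on_mult primitive_on_subset[OF primitive_U] primitive_on_subset[OF primitive_V]) auto
  from primitive_onD[OF this, of x "x + 8 * al"] al_pos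
  have P: "set_integrable lborel {x..x + 8 * al} (\<lambda>t. V t / B t * V t + U t * - (B t * U t))"
    "(LINT t:{x..x + 8 * al}|lborel. V t / B t * V t + U t * - (B t * U t)) = 0"
    using U_shift8[of x] V_shift8[of x] by auto
  have eq: "B t * (V t / B t)\<^sup>2 = (V t / B t * V t + U t * - (B t * U t)) + B t * (U t)\<^sup>2" for t
    using B_bounds(3)[of t] by (simp add: power2_eq_square field_simps)
  show "(LINT t:{x..x + 8 * al}|lborel. B t * (U t)\<^sup>2) = (LINT t:{x..x + 8 * al}|lborel. B t * (V t / B t)\<^sup>2)"
    unfolding eq set_integral_add(2)[OF P(1) i1] P(2) by simp
  have per: "(LINT t:{x..x + 8 * al}|lborel. B t * (U t)\<^sup>2) \<ge> (LINT t:{y..y + al}|lborel. B t * (U t)\<^sup>2)"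
    if "x \<le> y" "y + al \<le> x + 8 * al" for y
    by (rule LINT_Icc_mono_set[OF i1]) (use that B_bounds(3) in \<open>auto simp: less_imp_le\<close>)
  obtain n :: int where n: "x \<le> 0 + of_int n * (4 * al)" "0 + of_int n * (4 * al) < x + 4 * al"
    using ex_period_window[of "4 * al" x 0] al_pos by auto
  \<comment> \<open>On \<open>[y, y + al]\<close>, the left half of an odd cell, \<open>\<bar>U\<bar>\<close> is at least \<open>cos al / s\<close>.\<close>
  define y where "y = of_int n * (4 * al) + al"
  have U2: "(U (t + of_int n * (4 * al)))\<^sup>2 = (U t)\<^sup>2" for t
    using periodic_int[of "\<lambda>t. (U t)\<^sup>2" "4 * al" t n] by (simp add: U_shift4)
  have c: "cos al / s \<le> U t" if "t \<in> {al..2 * al}" for t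
  proof -
    have "U t = cos (t - 2 * al) / s" using U_eq_piece[of 1 t] that by (simp add: piece_def)
    moreover have "cos al \<le> cos (2 * al - t)" using that al_lt by (intro cos_monotone_0_pi_le) auto
    then have "cos al \<le> cos (t - 2 * al)" using cos_minus[of "t - 2 * al"] by simp
    ultimately show ?thesis using s_pos by (simp add: divide_right_mono)
  qed
  have cp: "0 < cos al / s" using cos_al_pos s_pos by simp
  have e1: "(LINT t:{y..y + al}|lborel. (cos al / s)\<^sup>2) \<le> (LINT t:{y..y + al}|lborel. B t * (U t)\<^sup>2)"
  proof (rule set_integral_mono[OF _ i1])
    show "set_integrable lborel {y..y + al} (\<lambda>t. (cos al / s)\<^sup>2)" by (rule set_integrable_continuous_Icc) auto
    fix t assume "t \<in> {y..y + al}"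
    then have "t - of_int n * (4 * al) \<in> {al..2 * al}" by (auto simp: y_def)
    from c[OF this] cp have "(cos al / s)\<^sup>2 \<le> (U (t - of_int n * (4 * al)))\<^sup>2" by (intro power_mono) auto
    also have "\<dots> = (U t)\<^sup>2" using U2[of "t - of_int n * (4 * al)"] by simp
    also have "\<dots> \<le> B t * (U t)\<^sup>2" using mult_right_mono[OF B_bounds(1)[of t], of "(U t)\<^sup>2"] by simp
    finally show "(cos al / s)\<^sup>2 \<le> B t * (U t)\<^sup>2" .
  qed
  have e2: "0 < (LINT t:{y..y + al}|lborel. (cos al / s)\<^sup>2)"
  proof -
    have "(LINT t:{y..y + al}|lborel. (cos al / s)\<^sup>2) = measure lborel {y..y + al} * (cos al / s)\<^sup>2"
      by (subst set_integral_const) (auto simp: emeasure_lborel_Icc_eq)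
    also have "\<dots> = al * (cos al / s)\<^sup>2" using al_pos by simp
    finally have "(LINT t:{y..y + al}|lborel. (cos al / s)\<^sup>2) = al * (cos al / s)\<^sup>2" .
    then show ?thesis using mult_pos_pos[OF al_pos zero_less_power[OF cp, of 2]] by (simp only:)
  qed
  have y: "x \<le> y" "y + al \<le> x + 8 * al" using n al_pos unfolding y_def by linarith+
  show "0 < (LINT t:{x..x + 8 * al}|lborel. B t * (U t)\<^sup>2)"
    by (rule less_le_trans[OF e2 order_trans[OF e1 per[OF y]]])
qed

end

text \<open>The pointwise regularity that an element of the coefficient class has after a change on a null set.\<close>
locale coefficient =
  fixes M p q :: real and \<gamma> :: "real \<Rightarrow> real"
  assumes M_gt_1: "1 < M" and pq: "0 \<le> p + q"
    and \<gamma>_measurable [measurable]: "\<gamma> \<in> borel_measurable borel"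
    and \<gamma>_bounds: "1 \<le> \<gamma> t" "\<gamma> t \<le> M"
    and \<gamma>_periodic: "\<gamma> (t + 2 * pi) = \<gamma> t"
begin

text \<open>The largest value of the weight \<open>\<gamma> powr ((p + q) / 2)\<close> is the square of this number.\<close>
definition ss :: real where "ss = M powr ((p + q) / 4)"

lemma ss_ge_1: "1 \<le> ss" using M_gt_1 pq by (simp add: ss_def ge_one_powr_ge_zero)

sublocale bang_bang ss by unfold_locales (rule ss_ge_1)

text \<open>The density \<open>sqrt (a / b)\<close> for \<open>a = \<gamma> powr p\<close> and \<open>b = \<gamma> powr q\<close>. In the variable with this density, both
  quadratic forms have the weight \<open>sqrt (a * b) = \<gamma> powr ((p + q) / 2)\<close>.\<close>
definition k :: "real \<Rightarrow> real" where "k t = \<gamma> t powr ((p - q) / 2)"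

definition period :: real where "period = (LINT t:{0..2 * pi}|lborel. k t)"

text \<open>The factor that gives the new variable the period \<open>8 * al\<close> of the extremal profile.\<close>
definition om :: real where "om = 8 * al / period"

definition phase :: "real \<Rightarrow> real" where
  "phase x = om * ((LINT t:{0..x}|lborel. k t) - (LINT t:{x..0}|lborel. k t))"

lemma \<gamma>_pos: "0 < \<gamma> t" using \<gamma>_bounds(1)[of t] by simp

lemma powr_bounds: "\<exists>c C. 0 < c \<and> (\<forall>t. c \<le> \<gamma> t powr r \<and> \<gamma> t powr r \<le> C)"
proof (cases "0 \<le> r")
  case True
  then have "1 \<le> \<gamma> t powr r \<and> \<gamma> t powr r \<le> M powr r" for t
    using \<gamma>_bounds[of t] by (auto intro: ge_one_powr_ge_zero powr_mono2)
  then show ?thesis by (intro exI[of _ 1] exI[of _ "M powr r"]) simp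
next
  case False
  then have "M powr r \<le> \<gamma> t powr r \<and> \<gamma> t powr r \<le> 1" for t
    using \<gamma>_bounds[of t] powr_mono2'[of r 1 "\<gamma> t"] powr_mono2'[of r "\<gamma> t" M] by auto
  then show ?thesis using M_gt_1 by (intro exI[of _ "M powr r"] exI[of _ 1]) simp
qed

lemma k_measurable [measurable]: "k \<in> borel_measurable borel" unfolding k_def by measurable

lemma k_pos: "0 < k t" using \<gamma>_pos[of t] by (simp add: k_def)

lemma k_integrable: "set_integrable lborel {x..y} k"
proof -
  obtain C where "\<forall>t. \<gamma> t powr ((p - q) / 2) \<le> C" using powr_bounds[of "(p - q) / 2"] by auto
  then show ?thesis
    by (intro set_integrable_Icc_bounded[of _ _ _ C]) (auto simp: k_def set_borel_measurable_def)
qed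

lemma k_periodic: "k (t + 2 * pi) = k t" by (simp add: k_def \<gamma>_periodic)

lemma k_integral_lower: "\<exists>c>0. \<forall>x y. x \<le> y \<longrightarrow> c * (y - x) \<le> (LINT t:{x..y}|lborel. k t)"
proof -
  obtain c where c: "0 < c" "\<forall>t. c \<le> k t" using powr_bounds[of "(p - q) / 2"] unfolding k_def by auto
  have "c * (y - x) \<le> (LINT t:{x..y}|lborel. k t)" if "x \<le> y" for x y
  proof -
    have "(LINT t:{x..y}|lborel. c) \<le> (LINT t:{x..y}|lborel. k t)"
    proof (rule set_integral_mono[OF _ k_integrable])
      show "set_integrable lborel {x..y} (\<lambda>_. c)" by (rule set_integrable_continuous_Icc) auto
    qed (simp add: c)
    then show ?thesis using that by (simp add: set_integral_const mult.commute)
  qed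
  then show ?thesis using c(1) by blast
qed

lemma period_pos: "0 < period"
proof -
  obtain c where c: "0 < c" "\<forall>x y. x \<le> y \<longrightarrow> c * (y - x) \<le> (LINT t:{x..y}|lborel. k t)" using k_integral_lower by blast
  from c(2)[rule_format, of 0 "2 * pi"] have "c * (2 * pi) \<le> period" by (simp add: period_def)
  moreover have "0 < c * (2 * pi)" using \<open>0 < c\<close> by simp
  ultimately show ?thesis by linarith
qed

lemma om_pos: "0 < om" using period_pos al_pos by (simp add: om_def)

lemma phase_primitive: "primitive_on UNIV phase (\<lambda>t. om * k t)"
  using primitive_on_linear[OF primitive_exists[OF k_integrable] primitive_exists[OF k_integrable], of om 0]
  by (simp add: phase_def[abs_def])

lemma phase_diff: "x \<le> y \<Longrightarrow> phase y - phase x = om * (LINT t:{x..y}|lborel. k t)"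
  using primitive_onD(2)[OF phase_primitive, of x y] by simp

lemma phase_0: "phase 0 = 0" by (simp add: phase_def)

lemma phase_continuous: "continuous_on S phase" by (rule primitive_on_UNIV_continuous[OF phase_primitive])

lemma phase_lower: "\<exists>c>0. \<forall>x y. x \<le> y \<longrightarrow> c * (y - x) \<le> phase y - phase x"
proof -
  obtain c where c: "0 < c" "\<forall>x y. x \<le> y \<longrightarrow> c * (y - x) \<le> (LINT t:{x..y}|lborel. k t)" using k_integral_lower by blast
  have "om * c * (y - x) \<le> phase y - phase x" if "x \<le> y" for x y
    using mult_left_mono[OF c(2)[rule_format, OF that], of om] om_pos phase_diff[OF that] by (simp add: mult.assoc)
  moreover have "0 < om * c" using om_pos c by simp
  ultimately show ?thesis by blast
qed

lemma phase_strict_mono: "x < y \<Longrightarrow> phase x < phase y"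
proof -
  assume "x < y"
  obtain c where c: "0 < c" "\<forall>x y. x \<le> y \<longrightarrow> c * (y - x) \<le> phase y - phase x" using phase_lower by blast
  have "0 < c * (y - x)" using c \<open>x < y\<close> by simp
  then show ?thesis using c(2)[rule_format, of x y] \<open>x < y\<close> by linarith
qed

lemma phase_less_iff: "phase x < phase y \<longleftrightarrow> x < y" and phase_le_iff: "phase x \<le> phase y \<longleftrightarrow> x \<le> y"
  using phase_strict_mono[of x y] phase_strict_mono[of y x] by (metis less_asym linorder_neqE_linordered_idom not_le)+

lemma phase_surj: "\<exists>x. phase x = y"
proof -
  obtain c where c: "0 < c" "\<forall>x y. x \<le> y \<longrightarrow> c * (y - x) \<le> phase y - phase x" using phase_lower by blast
  define b where "b = \<bar>y\<bar> / c"
  have b: "0 \<le> b" "c * b = \<bar>y\<bar>" using c(1) by (auto simp: b_def)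
  have "phase (- b) \<le> y" "y \<le> phase b"
    using c(2)[rule_format, of "- b" 0] c(2)[rule_format, of 0 b] b phase_0 by auto
  then show ?thesis using IVT'[of phase "- b" y b] b phase_continuous by auto
qed

definition unphase :: "real \<Rightarrow> real" where "unphase = inv phase"

lemma phase_unphase [simp]: "phase (unphase y) = y"
  unfolding unphase_def using phase_surj by (metis f_inv_into_f rangeI)

lemma inj_phase: "inj phase" by (rule injI) (metis phase_le_iff order_antisym order_refl)

lemma unphase_phase [simp]: "unphase (phase x) = x"
  unfolding unphase_def by (rule inv_f_f[OF inj_phase])

lemma unphase_mono: "mono unphase"
  by (rule monoI) (metis phase_unphase phase_le_iff)

lemma unphase_measurable [measurable]: "unphase \<in> borel_measurable borel"
  by (rule borel_measurable_mono[OF unphase_mono])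

lemma phase_measurable [measurable]: "phase \<in> borel_measurable borel"
  by (rule borel_measurable_continuous_onI[OF phase_continuous])

lemma phase_periodic: "phase (t + 2 * pi) = phase t + 8 * al"
proof -
  have win: "(LINT t:{x..x + 2 * pi}|lborel. k t) = period" if "0 \<le> x" "x \<le> 2 * pi" for x
    unfolding period_def by (rule LINT_period[OF k_integrable k_periodic that])
  obtain n :: int where n: "0 \<le> t + of_int n * (2 * pi)" "t + of_int n * (2 * pi) < 0 + 2 * pi"
    using ex_period_window[of "2 * pi" 0 t] by auto
  define x where "x = t + of_int n * (2 * pi)"
  have "(LINT u:{t..t + 2 * pi}|lborel. k u) = (LINT u:{t..t + 2 * pi}|lborel. k (u + of_int n * (2 * pi)))"
    using periodic_int[of k "2 * pi" _ n] k_periodic by simp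
  also have "\<dots> = (LINT u:{x..x + 2 * pi}|lborel. k u)"
    unfolding LINT_shift by (simp add: x_def algebra_simps)
  also have "\<dots> = period" by (rule win) (use n in \<open>auto simp: x_def\<close>)
  finally have "phase (t + 2 * pi) - phase t = om * period" using phase_diff[of t "t + 2 * pi"] by simp
  then show ?thesis using period_pos by (simp add: om_def)
qed

lemma phase_2pi: "phase (2 * pi) = 8 * al" using phase_periodic[of 0] phase_0 by simp

lemma unphase_periodic: "unphase (y + 8 * al) = unphase y + 2 * pi"
  using phase_periodic[of "unphase y"] by (metis phase_unphase unphase_phase)

text \<open>The substitution rule as an identity of measures, which has to be checked on intervals only.\<close>
lemma lborel_phase: "lborel = distr (density lborel (\<lambda>t. ennreal (om * k t))) borel phase"
proof (rule lborel_eqI)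
  fix l u :: real
  assume "\<And>b. b \<in> Basis \<Longrightarrow> l \<bullet> b \<le> u \<bullet> b"
  then have lu: "l \<le> u" by simp
  define x where "x = unphase l"
  define y where "y = unphase u"
  have xy: "x \<le> y" unfolding x_def y_def using unphase_mono lu by (rule monoD)
  have pre: "phase -` box l u = box x y"
  proof -
    have "l < phase t \<longleftrightarrow> x < t" "phase t < u \<longleftrightarrow> t < y" for t
      using phase_less_iff[of x t] phase_less_iff[of t y] by (simp_all add: x_def y_def)
    then show ?thesis by (auto simp: box_def)
  qed
  have "emeasure (distr (density lborel (\<lambda>t. ennreal (om * k t))) borel phase) (box l u)
     = emeasure (density lborel (\<lambda>t. ennreal (om * k t))) (box x y)"
    by (subst emeasure_distr) (auto simp: pre[simplified])
  also have "\<dots> = (\<integral>\<^sup>+t. ennreal (om * k t) * indicator (box x y) t \<partial>lborel)"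
    by (subst emeasure_density) auto
  also have "\<dots> = (\<integral>\<^sup>+t. ennreal (indicator {x..y} t *\<^sub>R (om * k t)) \<partial>lborel)"
  proof (rule nn_integral_cong_AE)
    have "AE t in lborel. t \<notin> {x, y}" by (rule AE_not_in) (auto intro: countable_imp_null_set_lborel)
    then show "AE t in lborel. ennreal (om * k t) * indicator (box x y) t = ennreal (indicator {x..y} t *\<^sub>R (om * k t))"
      by eventually_elim (auto simp: indicator_def)
  qed
  also have "\<dots> = ennreal (LINT t:{x..y}|lborel. om * k t)"
    unfolding set_lebesgue_integral_def
  proof (rule nn_integral_eq_integral)
    show "integrable lborel (\<lambda>t. indicator {x..y} t *\<^sub>R (om * k t))"
      using primitive_onD(1)[OF phase_primitive, of x y] xy by (simp add: set_integrable_def)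
    show "AE t in lborel. 0 \<le> indicator {x..y} t *\<^sub>R (om * k t)"
      using om_pos k_pos by (auto simp: indicator_def less_imp_le)
  qed
  also have "(LINT t:{x..y}|lborel. om * k t) = u - l"
    using primitive_onD(2)[OF phase_primitive, of x y] xy by (simp add: x_def y_def)
  finally show "emeasure (distr (density lborel (\<lambda>t. ennreal (om * k t))) borel phase) (box l u) = ennreal (\<Prod>b\<in>Basis. (u - l) \<bullet> b)"
    by simp
qed simp

lemma AE_phase:
  assumes [measurable]: "Measurable.pred borel Q"
  shows "(AE x in lborel. Q x) \<longleftrightarrow> (AE t in lborel. Q (phase t))"
proof -
  have "(AE x in lborel. Q x) \<longleftrightarrow> (AE x in distr (density lborel (\<lambda>t. ennreal (om * k t))) borel phase. Q x)"
    by (rule arg_cong[OF lborel_phase, of "\<lambda>m. AE x in m. Q x"])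
  also have "\<dots> \<longleftrightarrow> (AE t in density lborel (\<lambda>t. ennreal (om * k t)). Q (phase t))"
    by (subst AE_distr_iff) auto
  also have "\<dots> \<longleftrightarrow> (AE t in lborel. 0 < ennreal (om * k t) \<longrightarrow> Q (phase t))"
    by (subst AE_density) auto
  also have "\<dots> \<longleftrightarrow> (AE t in lborel. Q (phase t))" using om_pos k_pos by simp
  finally show ?thesis .
qed

lemma substitution:
  assumes [measurable]: "f \<in> borel_measurable borel"
  shows "set_integrable lborel {phase x..phase y} f \<longleftrightarrow> set_integrable lborel {x..y} (\<lambda>t. om * k t * f (phase t))"
    and "(LINT u:{phase x..phase y}|lborel. f u) = (LINT t:{x..y}|lborel. om * k t * f (phase t))"
proof -
  let ?f = "\<lambda>u. indicator {phase x..phase y} u *\<^sub>R f u"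
  let ?D = "density lborel (\<lambda>t. ennreal (om * k t))"
  have [measurable]: "?f \<in> borel_measurable borel" by measurable
  have e: "(\<lambda>t. (om * k t) *\<^sub>R ?f (phase t)) = (\<lambda>t. indicator {x..y} t *\<^sub>R (om * k t * f (phase t)))"
    using phase_le_iff by (auto simp: indicator_def)
  have nn: "AE t in lborel. 0 \<le> om * k t" using om_pos k_pos by (auto simp: less_imp_le)
  have "integrable lborel ?f \<longleftrightarrow> integrable (distr ?D borel phase) ?f"
    by (rule arg_cong[OF lborel_phase, of "\<lambda>m. integrable m ?f"])
  also have "\<dots> \<longleftrightarrow> integrable ?D (\<lambda>t. ?f (phase t))" by (rule integrable_distr_eq) auto
  also have "\<dots> \<longleftrightarrow> integrable lborel (\<lambda>t. (om * k t) *\<^sub>R ?f (phase t))"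
    by (rule integrable_density[OF _ _ nn]) measurable
  finally show "set_integrable lborel {phase x..phase y} f \<longleftrightarrow> set_integrable lborel {x..y} (\<lambda>t. om * k t * f (phase t))"
    unfolding set_integrable_def e .
  have "integral\<^sup>L lborel ?f = integral\<^sup>L (distr ?D borel phase) ?f"
    by (rule arg_cong[OF lborel_phase, of "\<lambda>m. integral\<^sup>L m ?f"])
  also have "\<dots> = integral\<^sup>L ?D (\<lambda>t. ?f (phase t))" by (rule integral_distr) auto
  also have "\<dots> = integral\<^sup>L lborel (\<lambda>t. (om * k t) *\<^sub>R ?f (phase t))"
    by (rule integral_density[OF _ _ nn]) measurable
  finally show "(LINT u:{phase x..phase y}|lborel. f u) = (LINT t:{x..y}|lborel. om * k t * f (phase t))"
    unfolding set_lebesgue_integral_def e .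
qed

definition A :: "real \<Rightarrow> real" where "A u = \<gamma> (unphase u) powr ((p + q) / 2)"

lemma A_measurable [measurable]: "A \<in> borel_measurable borel" unfolding A_def by measurable

lemma A_phase: "A (phase t) = \<gamma> t powr ((p + q) / 2)" by (simp add: A_def)

lemma ss2: "ss\<^sup>2 = M powr ((p + q) / 2)"
proof -
  have "(p + q) / 4 + (p + q) / 4 = (p + q) / 2" by simp
  then show ?thesis unfolding ss_def power2_eq_square powr_add[symmetric] by simp
qed

lemma periodic_weight_A: "periodic_weight A"
proof -
  have "1 \<le> \<gamma> t powr ((p + q) / 2)" "\<gamma> t powr ((p + q) / 2) \<le> M powr ((p + q) / 2)" for t
    using \<gamma>_bounds[of t] pq by (auto intro: ge_one_powr_ge_zero powr_mono2)
  then show ?thesis unfolding periodic_weight_def weight_def ss2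
    by (auto simp: A_def unphase_periodic \<gamma>_periodic)
qed

text \<open>The point is \<open>k * sqrt (a * b) = a\<close>.\<close>
lemma transfer:
  assumes [measurable]: "F \<in> borel_measurable borel"
  shows "(LINT u:{0..8 * al}|lborel. A u * F u) = om * (LINT t:{0..2 * pi}|lborel. \<gamma> t powr p * F (phase t))"
proof -
  have e: "om * k t * (A (phase t) * F (phase t)) = om * (\<gamma> t powr p * F (phase t))" for t
  proof -
    have "k t * A (phase t) = \<gamma> t powr p"
      unfolding k_def A_phase powr_add[symmetric] by (simp add: field_simps)
    then show ?thesis by (metis mult.assoc)
  qed
  show ?thesis using substitution(2)[of "\<lambda>u. A u * F u" 0 "2 * pi"] by (simp add: e phase_0 phase_2pi)
qed

text \<open>The point is \<open>b * k\<^sup>2 = a\<close>, where one factor \<open>k\<close> comes from the chain rule and one from the density.\<close>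
lemma transfer_deriv:
  assumes [measurable]: "G \<in> borel_measurable borel"
  shows "(LINT t:{0..2 * pi}|lborel. \<gamma> t powr q * (om * k t * G (phase t))\<^sup>2) = om * (LINT u:{0..8 * al}|lborel. A u * (G u)\<^sup>2)"
proof -
  have e: "\<gamma> t powr q * (om * k t * G (phase t))\<^sup>2 = om\<^sup>2 * (\<gamma> t powr p * (G (phase t))\<^sup>2)" for t
  proof -
    have "(k t)\<^sup>2 = \<gamma> t powr (p - q)" 
    proof -
      have "(p - q) / 2 + (p - q) / 2 = p - q" by simp
      then show ?thesis unfolding k_def power2_eq_square powr_add[symmetric] by simp
    qed
    then have "\<gamma> t powr q * (k t)\<^sup>2 = \<gamma> t powr p" by (simp add: powr_add[symmetric])
    then show ?thesis by (simp add: power_mult_distrib mult.left_commute mult.assoc[symmetric])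
  qed
  show ?thesis unfolding e using transfer[of "\<lambda>u. (G u)\<^sup>2"] by (simp add: power2_eq_square)
qed

end


section \<open>The best constant and its extremal functions\<close>

lemma sobolev_pair_cong_AE:
  assumes W: "sobolev_pair W G" and [measurable]: "g \<in> borel_measurable borel" and ae: "AE t in lborel. G t = g t"
  shows "sobolev_pair W g"
proof -
  note [measurable] = sobolev_pairD(2)[OF W]
  have sq: "AE t in lborel. (G t)\<^sup>2 = (g t)\<^sup>2" using ae by eventually_elim simp
  have "set_integrable lborel {x..y} (\<lambda>t. (g t)\<^sup>2)" for x y
  proof -
    have "set_integrable lborel {x..y} (\<lambda>t. (G t)\<^sup>2) \<longleftrightarrow> set_integrable lborel {x..y} (\<lambda>t. (g t)\<^sup>2)"
      by (rule set_integrable_cong_AE) (use sq in auto)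
    then show ?thesis using sobolev_pairD(3)[OF W] by simp
  qed
  moreover have "primitive_on UNIV W g" unfolding primitive_on_def
  proof (intro ballI impI)
    fix x y :: real assume xy: "x \<le> y"
    have "set_integrable lborel {x..y} G \<longleftrightarrow> set_integrable lborel {x..y} g"
      by (rule set_integrable_cong_AE) (use ae in auto)
    moreover have "(LINT t:{x..y}|lborel. G t) = (LINT t:{x..y}|lborel. g t)"
      by (rule set_lebesgue_integral_cong_AE) (use ae in auto)
    ultimately show "set_integrable lborel {x..y} g \<and> (LINT t:{x..y}|lborel. g t) = W y - W x"
      using primitive_onD[OF sobolev_pairD(1)[OF W], of x y] xy by simp
  qed
  ultimately show ?thesis by (simp add: sobolev_pair_def)
qed

lemma ae_periodic_cong:
  assumes "AE t in lebesgue. w t = W t"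
  shows "ae_periodic w \<longleftrightarrow> ae_periodic W"
proof -
  note ae = assms AE_lebesgue_shift[OF assms, of "2 * pi"]
  show ?thesis unfolding ae_periodic_def
  proof
    assume "AE x in lebesgue. w (x + 2 * pi) = w x"
    with ae show "AE x in lebesgue. W (x + 2 * pi) = W x" by eventually_elim simp
  next
    assume "AE x in lebesgue. W (x + 2 * pi) = W x"
    with ae show "AE x in lebesgue. w (x + 2 * pi) = w x" by eventually_elim simp
  qed
qed

definition periodic_sobolev_pair :: "(real \<Rightarrow> real) \<Rightarrow> (real \<Rightarrow> real) \<Rightarrow> bool" where
  "periodic_sobolev_pair W G \<longleftrightarrow> sobolev_pair W G \<and> (\<forall>t. W (t + 2 * pi) = W t \<and> G (t + 2 * pi) = G t)"

lemma periodic_H1_representative: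
  assumes "w \<in> H1_loc" "ae_periodic w"
  shows "\<exists>W G. periodic_sobolev_pair W G \<and> (AE t in lebesgue. w t = W t)"
proof -
  obtain W G where WG: "sobolev_pair W G" and w: "AE t in lebesgue. w t = W t"
    using assms(1) unfolding H1_loc_iff_sobolev_pair by blast
  have "AE t in lebesgue. W (t + 2 * pi) = W t" using assms(2) ae_periodic_cong[OF w] by (simp add: ae_periodic_def)
  moreover have "continuous_on UNIV (\<lambda>t. W (t + 2 * pi))"
    by (intro continuous_on_compose2[OF sobolev_pairD(4)[OF WG, of UNIV]] continuous_intros) auto
  ultimately have "(\<lambda>t. W (t + 2 * pi)) = W" using continuous_AE_eq sobolev_pairD(4)[OF WG] by blast
  then have Wp: "W (t + 2 * pi) = W t" for t by (rule fun_cong)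
  have "primitive_on UNIV (\<lambda>t. W (t + 2 * pi)) (\<lambda>t. G (t + 2 * pi))"
    using primitive_on_shift[of _ _ W "2 * pi" G] primitive_on_subset[OF sobolev_pairD(1)[OF WG]]
    by (intro primitive_on_UNIV_I) auto
  then have "primitive_on UNIV W (\<lambda>t. G (t + 2 * pi))" by (simp add: Wp)
  then have "AE t in lborel. G (t + 2 * pi) = G t"
    using primitive_on_UNIV_unique[of W "\<lambda>t. G (t + 2 * pi)" G] sobolev_pairD(1,2)[OF WG] by simp
  then obtain g where g: "g \<in> borel_measurable borel" "\<And>t. g (t + 2 * pi) = g t" "AE t in lborel. G t = g t"
    using periodic_representative[of "2 * pi" G] sobolev_pairD(2)[OF WG] by auto
  have "sobolev_pair W g" by (rule sobolev_pair_cong_AE[OF WG g(1,3)])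
  then have "periodic_sobolev_pair W g" using Wp g(2) by (simp add: periodic_sobolev_pair_def)
  with w show ?thesis by blast
qed

context coefficient begin

lemma admissible_iff:
  "w \<in> admissible (\<lambda>t. \<gamma> t powr p) \<longleftrightarrow> (\<exists>W G. periodic_sobolev_pair W G \<and> (AE t in lebesgue. w t = W t) \<and>
     (LINT t:{0..2 * pi}|lborel. \<gamma> t powr p * W t) = 0)"
proof -
  have int: "(LINT x:{0..2 * pi}|lebesgue. \<gamma> x powr p * w x) = (LINT t:{0..2 * pi}|lborel. \<gamma> t powr p * W t)"
    if "sobolev_pair W G" "AE t in lebesgue. w t = W t" for W G
  proof (rule LINT_lebesgue_AE(1))
    show "AE t in lebesgue. \<gamma> t powr p * w t = \<gamma> t powr p * W t" using that(2) by eventually_elim simp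
    show "(\<lambda>t. \<gamma> t powr p * W t) \<in> borel_measurable borel" using sobolev_pairD(5)[OF that(1)] by measurable
  qed simp
  show ?thesis
  proof
    assume w: "w \<in> admissible (\<lambda>t. \<gamma> t powr p)"
    then obtain W G where WG: "periodic_sobolev_pair W G" "AE t in lebesgue. w t = W t"
      using periodic_H1_representative unfolding admissible_def by blast
    have "(LINT t:{0..2 * pi}|lborel. \<gamma> t powr p * W t) = 0"
      using int[of W G] WG w by (simp add: admissible_def periodic_sobolev_pair_def)
    with WG show "\<exists>W G. periodic_sobolev_pair W G \<and> (AE t in lebesgue. w t = W t) \<and>
       (LINT t:{0..2 * pi}|lborel. \<gamma> t powr p * W t) = 0" by blast
  next
    assume "\<exists>W G. periodic_sobolev_pair W G \<and> (AE t in lebesgue. w t = W t) \<and>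
       (LINT t:{0..2 * pi}|lborel. \<gamma> t powr p * W t) = 0"
    then obtain W G where WG: "periodic_sobolev_pair W G" "AE t in lebesgue. w t = W t"
      "(LINT t:{0..2 * pi}|lborel. \<gamma> t powr p * W t) = 0" by blast
    have s: "sobolev_pair W G" using WG(1) by (simp add: periodic_sobolev_pair_def)
    have "w \<in> H1_loc" unfolding H1_loc_iff_sobolev_pair using s WG(2) by blast
    moreover have "ae_periodic w"
      unfolding ae_periodic_cong[OF WG(2)] using WG(1) by (simp add: ae_periodic_def periodic_sobolev_pair_def)
    ultimately show "w \<in> admissible (\<lambda>t. \<gamma> t powr p)"
      using int[OF s WG(2)] WG(3) by (simp add: admissible_def)
  qed
qed

lemma energies:
  assumes WG: "sobolev_pair W G" and w: "AE t in lebesgue. w t = W t"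
  shows "(LINT x:{0..2 * pi}|lebesgue. \<gamma> x powr p * (w x)\<^sup>2) = (LINT t:{0..2 * pi}|lborel. \<gamma> t powr p * (W t)\<^sup>2)"
    and "(LINT x:{0..2 * pi}|lebesgue. \<gamma> x powr q * (weak_deriv w x)\<^sup>2) = (LINT t:{0..2 * pi}|lborel. \<gamma> t powr q * (G t)\<^sup>2)"
proof -
  note [measurable] = sobolev_pairD(2,5)[OF WG]
  show "(LINT x:{0..2 * pi}|lebesgue. \<gamma> x powr p * (w x)\<^sup>2) = (LINT t:{0..2 * pi}|lborel. \<gamma> t powr p * (W t)\<^sup>2)"
  proof (rule LINT_lebesgue_AE(1))
    show "AE t in lebesgue. \<gamma> t powr p * (w t)\<^sup>2 = \<gamma> t powr p * (W t)\<^sup>2" using w by eventually_elim simp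
  qed measurable
  show "(LINT x:{0..2 * pi}|lebesgue. \<gamma> x powr q * (weak_deriv w x)\<^sup>2) = (LINT t:{0..2 * pi}|lborel. \<gamma> t powr q * (G t)\<^sup>2)"
  proof (rule LINT_lebesgue_AE(1))
    show "AE t in lebesgue. \<gamma> t powr q * (weak_deriv w t)\<^sup>2 = \<gamma> t powr q * (G t)\<^sup>2"
      using weak_deriv_sobolev_pair[OF WG w] by eventually_elim simp
  qed measurable
qed

lemma to_competitor:
  assumes WG: "periodic_sobolev_pair W G" and z: "(LINT t:{0..2 * pi}|lborel. \<gamma> t powr p * W t) = 0"
  defines "H \<equiv> \<lambda>u. G (unphase u) / (om * k (unphase u))"
  shows "competitor A (\<lambda>u. W (unphase u)) H"
    and "(LINT u:{0..8 * al}|lborel. A u * (W (unphase u))\<^sup>2) = om * (LINT t:{0..2 * pi}|lborel. \<gamma> t powr p * (W t)\<^sup>2)"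
    and "(LINT t:{0..2 * pi}|lborel. \<gamma> t powr q * (G t)\<^sup>2) = om * (LINT u:{0..8 * al}|lborel. A u * (H u)\<^sup>2)"
proof -
  have s: "sobolev_pair W G" and per: "\<And>t. W (t + 2 * pi) = W t" "\<And>t. G (t + 2 * pi) = G t"
    using WG by (auto simp: periodic_sobolev_pair_def)
  note [measurable] = sobolev_pairD(2,5)[OF s]
  have [measurable]: "H \<in> borel_measurable borel" unfolding H_def by measurable
  have HG: "om * k t * H (phase t) = G t" for t using om_pos k_pos[of t] by (simp add: H_def)
  show "(LINT u:{0..8 * al}|lborel. A u * (W (unphase u))\<^sup>2) = om * (LINT t:{0..2 * pi}|lborel. \<gamma> t powr p * (W t)\<^sup>2)"
    using transfer[of "\<lambda>u. (W (unphase u))\<^sup>2"] by simp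
  show "(LINT t:{0..2 * pi}|lborel. \<gamma> t powr q * (G t)\<^sup>2) = om * (LINT u:{0..8 * al}|lborel. A u * (H u)\<^sup>2)"
    using transfer_deriv[of H] by (simp add: HG)
  have prim: "primitive_on UNIV (\<lambda>u. W (unphase u)) H" unfolding primitive_on_def
  proof (intro ballI impI)
    fix x y :: real assume "x \<le> y"
    then have le: "unphase x \<le> unphase y" by (rule monoD[OF unphase_mono])
    have "set_integrable lborel {unphase x..unphase y} G \<and> (LINT t:{unphase x..unphase y}|lborel. G t) = W (unphase y) - W (unphase x)"
      using primitive_onD[OF sobolev_pairD(1)[OF s] _ _ le] by simp
    then show "set_integrable lborel {x..y} H \<and> (LINT t:{x..y}|lborel. H t) = W (unphase y) - W (unphase x)"
      using substitution[of H "unphase x" "unphase y"] by (simp add: HG)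
  qed
  have "set_integrable lborel {x..y} (\<lambda>u. (H u)\<^sup>2)" for x y
  proof -
    obtain c where c: "0 < c" "\<forall>t. c \<le> k t" using powr_bounds[of "(p - q) / 2"] unfolding k_def by auto
    have "om * k t * (H (phase t))\<^sup>2 = (G t)\<^sup>2 * (1 / (om * k t))" for t
      using om_pos k_pos[of t] by (simp add: H_def power2_eq_square)
    moreover have "set_integrable lborel {unphase x..unphase y} (\<lambda>t. (G t)\<^sup>2 * (1 / (om * k t)))"
    proof (rule set_integrable_mult_bounded[OF sobolev_pairD(3)[OF s]])
      show "\<bar>1 / (om * k t)\<bar> \<le> 1 / (om * c)" for t
      proof -
        have "1 / (om * k t) \<le> 1 / (om * c)" using c om_pos by (intro divide_left_mono mult_left_mono mult_pos_pos k_pos) auto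
        then show ?thesis using om_pos k_pos[of t] by simp
      qed
    qed (simp add: set_borel_measurable_def)
    ultimately show ?thesis using substitution(1)[of "\<lambda>u. (H u)\<^sup>2" "unphase x" "unphase y"] by simp
  qed
  moreover have "(LINT u:{0..8 * al}|lborel. A u * W (unphase u)) = 0"
    using transfer[of "\<lambda>u. W (unphase u)"] z by simp
  ultimately show "competitor A (\<lambda>u. W (unphase u)) H"
    unfolding competitor_def using prim by (simp add: unphase_periodic per H_def k_periodic)
qed

lemma from_competitor:
  assumes WG: "competitor A W G"
  shows "periodic_sobolev_pair (\<lambda>t. W (phase t)) (\<lambda>t. om * k t * G (phase t))"
    and "(LINT t:{0..2 * pi}|lborel. \<gamma> t powr p * W (phase t)) = 0"
proof -
  note [measurable] = competitorD(2,8)[OF WG]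
  have prim: "primitive_on UNIV (\<lambda>t. W (phase t)) (\<lambda>t. om * k t * G (phase t))" unfolding primitive_on_def
  proof (intro ballI impI)
    fix x y :: real assume "x \<le> y"
    then have le: "phase x \<le> phase y" by (simp add: phase_le_iff)
    show "set_integrable lborel {x..y} (\<lambda>t. om * k t * G (phase t)) \<and>
        (LINT t:{x..y}|lborel. om * k t * G (phase t)) = W (phase y) - W (phase x)"
      using primitive_onD[OF competitorD(1)[OF WG] _ _ le] substitution[of G x y] by simp
  qed
  have sq: "set_integrable lborel {x..y} (\<lambda>t. (om * k t * G (phase t))\<^sup>2)" for x y
  proof -
    obtain C where C: "\<forall>t. \<gamma> t powr ((p - q) / 2) \<le> C" using powr_bounds[of "(p - q) / 2"] by auto
    have "set_integrable lborel {x..y} (\<lambda>t. om * k t * (G (phase t))\<^sup>2)"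
      using substitution(1)[of "\<lambda>u. (G u)\<^sup>2" x y] competitorD(3)[OF WG] by simp
    then have "set_integrable lborel {x..y} (\<lambda>t. om * k t * (G (phase t))\<^sup>2 * (om * k t))"
    proof (rule set_integrable_mult_bounded)
      show "\<bar>om * k t\<bar> \<le> om * C" for t
        using om_pos k_pos[of t] C[rule_format, of t] by (simp add: k_def abs_mult)
    qed (simp add: set_borel_measurable_def)
    then show ?thesis by (simp add: power2_eq_square mult_ac)
  qed
  show "periodic_sobolev_pair (\<lambda>t. W (phase t)) (\<lambda>t. om * k t * G (phase t))"
    unfolding periodic_sobolev_pair_def sobolev_pair_def
    using prim sq by (simp add: phase_periodic k_periodic competitorD(4,5)[OF WG])
  show "(LINT t:{0..2 * pi}|lborel. \<gamma> t powr p * W (phase t)) = 0"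
    using transfer[of W] competitorD(6)[OF WG] om_pos by simp
qed

abbreviation best :: real where
  "best \<equiv> wirtinger_const (\<lambda>t. \<gamma> t powr p) (\<lambda>t. \<gamma> t powr q)"

definition bound :: real where "bound = 1 / om\<^sup>2"

lemma bound_pos: "0 < bound" using om_pos by (simp add: bound_def)

lemma weighted_wirtinger:
  assumes "w \<in> admissible (\<lambda>t. \<gamma> t powr p)"
  shows "(LINT x:{0..2 * pi}|lebesgue. \<gamma> x powr p * (w x)\<^sup>2)
    \<le> bound * (LINT x:{0..2 * pi}|lebesgue. \<gamma> x powr q * (weak_deriv w x)\<^sup>2)"
proof -
  obtain W G where WG: "periodic_sobolev_pair W G" "AE t in lebesgue. w t = W t"
     "(LINT t:{0..2 * pi}|lborel. \<gamma> t powr p * W t) = 0" using assms unfolding admissible_iff by blast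
  have s: "sobolev_pair W G" using WG(1) by (simp add: periodic_sobolev_pair_def)
  note tc = to_competitor[OF WG(1,3)]
  show ?thesis unfolding energies[OF s WG(2)]
    using periodic_inequality[OF periodic_weight_A tc(1)] tc(2,3) om_pos
    by (simp add: bound_def field_simps power2_eq_square)
qed

lemma best_le_bound: "best \<le> bound"
  unfolding wirtinger_const_def
  by (rule cInf_lower) (use weighted_wirtinger bound_pos in \<open>auto intro!: bdd_belowI[of _ 0]\<close>)

text \<open>The weight is the worst one, with a zero of the profile at the phase \<open>x\<close>.\<close>
definition matches :: "real \<Rightarrow> bool" where
  "matches x \<longleftrightarrow> (AE t in lborel. \<gamma> t powr ((p + q) / 2) = B (phase t - x))"

lemma matches_iff: "matches x \<longleftrightarrow> (AE u in lborel. A u = B (u - x))"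
  using AE_phase[of "\<lambda>u. A u = B (u - x)"] by (simp add: matches_def A_phase)

lemma profile_competitor:
  assumes "matches x"
  shows "competitor A (\<lambda>u. U (u - x)) (\<lambda>u. V (u - x) / B (u - x))"
    and "(LINT u:{0..8 * al}|lborel. A u * (U (u - x))\<^sup>2) = (LINT u:{0..8 * al}|lborel. A u * (V (u - x) / B (u - x))\<^sup>2)"
    and "0 < (LINT u:{0..8 * al}|lborel. A u * (U (u - x))\<^sup>2)"
proof -
  have ae: "AE u in lborel. A u = B (u - x)" using assms by (simp add: matches_iff)
  have tr: "(LINT u:{0..8 * al}|lborel. A u * f (u - x)) = (LINT u:{- x..- x + 8 * al}|lborel. B u * f u)"
    if [measurable]: "f \<in> borel_measurable borel" for f
  proof -
    have "(LINT u:{0..8 * al}|lborel. A u * f (u - x)) = (LINT u:{0..8 * al}|lborel. B (u - x) * f (u - x))"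
      by (rule set_lebesgue_integral_cong_AE) (use ae in auto)
    also have "\<dots> = (LINT u:{- x..- x + 8 * al}|lborel. B u * f u)"
      using LINT_shift[of 0 "8 * al" "\<lambda>u. B u * f u" "- x"] by (simp add: add.commute)
    finally show ?thesis .
  qed
  have t2: "(LINT u:{0..8 * al}|lborel. A u * (U (u - x))\<^sup>2) = (LINT u:{- x..- x + 8 * al}|lborel. B u * (U u)\<^sup>2)"
    "(LINT u:{0..8 * al}|lborel. A u * (V (u - x) / B (u - x))\<^sup>2) = (LINT u:{- x..- x + 8 * al}|lborel. B u * (V u / B u)\<^sup>2)"
    by (rule tr, measurable)+
  show "(LINT u:{0..8 * al}|lborel. A u * (U (u - x))\<^sup>2) = (LINT u:{0..8 * al}|lborel. A u * (V (u - x) / B (u - x))\<^sup>2)"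
    "0 < (LINT u:{0..8 * al}|lborel. A u * (U (u - x))\<^sup>2)"
    unfolding t2 by (rule profile_energy)+
  have prim: "primitive_on UNIV (\<lambda>u. U (u - x)) (\<lambda>u. V (u - x) / B (u - x))"
    using primitive_on_shift[of _ _ U "- x" "\<lambda>u. V u / B u"] primitive_on_subset[OF primitive_U]
    by (intro primitive_on_UNIV_I) auto
  have sq: "set_integrable lborel {a..b} (\<lambda>u. (V (u - x) / B (u - x))\<^sup>2)" for a b
  proof (rule set_integrable_Icc_bounded)
    fix t
    have "\<bar>V (t - x)\<bar> / B (t - x) \<le> ss / 1" using abs_V_le B_bounds s_pos by (intro frac_le) auto
    moreover define d where "d = V (t - x) / B (t - x)"
    ultimately have "\<bar>d\<bar> \<le> ss" using B_bounds(3)[of "t - x"] by simp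
    then show "\<bar>(V (t - x) / B (t - x))\<^sup>2\<bar> \<le> ss\<^sup>2"
      using power_mono[of "\<bar>d\<bar>" ss 2] by (simp add: d_def[symmetric])
  qed (simp add: set_borel_measurable_def)
  have z: "(LINT u:{0..8 * al}|lborel. A u * U (u - x)) = 0"
    using integral_BU_period[of "- x"] by (subst tr) simp_all
  have per: "U (u + 8 * al - x) = U (u - x)" "V (u + 8 * al - x) = V (u - x)" "B (u + 8 * al - x) = B (u - x)" for u
    using U_shift8[of "u - x"] V_shift8[of "u - x"] B_shift8[of "u - x"] by (simp_all add: algebra_simps)
  show "competitor A (\<lambda>u. U (u - x)) (\<lambda>u. V (u - x) / B (u - x))"
    unfolding competitor_def using prim sq z per by simp
qed

lemma profile_in_time:
  assumes "matches x" and w: "AE t in lebesgue. w t = K * U (phase t - x)"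
  shows "w \<in> admissible (\<lambda>t. \<gamma> t powr p)"
    and "(LINT t:{0..2 * pi}|lebesgue. \<gamma> t powr p * (w t)\<^sup>2)
      = bound * (LINT t:{0..2 * pi}|lebesgue. \<gamma> t powr q * (weak_deriv w t)\<^sup>2)"
    and "K \<noteq> 0 \<Longrightarrow> 0 < (LINT t:{0..2 * pi}|lebesgue. \<gamma> t powr p * (w t)\<^sup>2)"
proof -
  note pc = profile_competitor[OF assms(1)]
  have c: "competitor A (\<lambda>u. K * U (u - x)) (\<lambda>u. K * (V (u - x) / B (u - x)))"
    using competitor_linear[OF periodic_weight_A pc(1) pc(1), of K 0] by simp
  note fc = from_competitor[OF c]
  show "w \<in> admissible (\<lambda>t. \<gamma> t powr p)" unfolding admissible_iff using fc w by blast
  have s: "sobolev_pair (\<lambda>t. K * U (phase t - x)) (\<lambda>t. om * k t * (K * (V (phase t - x) / B (phase t - x))))"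
    using fc(1) by (simp add: periodic_sobolev_pair_def)
  have e: "(\<lambda>u. A u * (K * f u)\<^sup>2) = (\<lambda>u. K\<^sup>2 * (A u * (f u)\<^sup>2))" for f by (auto simp: power_mult_distrib)
  have 1: "om * (LINT t:{0..2 * pi}|lborel. \<gamma> t powr p * (K * U (phase t - x))\<^sup>2) = K\<^sup>2 * (LINT u:{0..8 * al}|lborel. A u * (U (u - x))\<^sup>2)"
    using transfer[of "\<lambda>u. (K * U (u - x))\<^sup>2"] e[of "\<lambda>u. U (u - x)"] by simp
  have 2: "(LINT t:{0..2 * pi}|lborel. \<gamma> t powr q * (om * k t * (K * (V (phase t - x) / B (phase t - x))))\<^sup>2)
      = om * (K\<^sup>2 * (LINT u:{0..8 * al}|lborel. A u * (V (u - x) / B (u - x))\<^sup>2))"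
    using transfer_deriv[of "\<lambda>u. K * (V (u - x) / B (u - x))"] e[of "\<lambda>u. V (u - x) / B (u - x)"] by simp
  show "(LINT t:{0..2 * pi}|lebesgue. \<gamma> t powr p * (w t)\<^sup>2)
      = bound * (LINT t:{0..2 * pi}|lebesgue. \<gamma> t powr q * (weak_deriv w t)\<^sup>2)"
    unfolding energies[OF s w] 2 using 1 pc(2) om_pos by (simp add: bound_def field_simps power2_eq_square)
  assume "K \<noteq> 0"
  then have "0 < om * (LINT t:{0..2 * pi}|lborel. \<gamma> t powr p * (K * U (phase t - x))\<^sup>2)" unfolding 1 using pc(3) by simp
  then show "0 < (LINT t:{0..2 * pi}|lebesgue. \<gamma> t powr p * (w t)\<^sup>2)"
    unfolding energies[OF s w] using om_pos by (simp add: zero_less_mult_iff)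
qed

text \<open>The profile itself is a test function that turns the inequality into an equality.\<close>
lemma best_eq_bound_if_matches:
  assumes "matches x"
  shows "best = bound"
proof (rule antisym[OF best_le_bound])
  define w where "w t = 1 * U (phase t - x)" for t
  have "AE t in lebesgue. w t = 1 * U (phase t - x)" by (simp add: w_def)
  note pt = profile_in_time[OF assms this]
  show "bound \<le> best" unfolding wirtinger_const_def
  proof (rule cInf_greatest)
    show "{C. 0 < C \<and> (\<forall>w\<in>admissible (\<lambda>t. \<gamma> t powr p). (LINT x:{0..2 * pi}|lebesgue. \<gamma> x powr p * (w x)\<^sup>2)
        \<le> C * (LINT x:{0..2 * pi}|lebesgue. \<gamma> x powr q * (weak_deriv w x)\<^sup>2))} \<noteq> {}"
      using weighted_wirtinger bound_pos by blast
    fix C assume "C \<in> {C. 0 < C \<and> (\<forall>w\<in>admissible (\<lambda>t. \<gamma> t powr p). (LINT x:{0..2 * pi}|lebesgue. \<gamma> x powr p * (w x)\<^sup>2)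
        \<le> C * (LINT x:{0..2 * pi}|lebesgue. \<gamma> x powr q * (weak_deriv w x)\<^sup>2))}"
    then have "(LINT x:{0..2 * pi}|lebesgue. \<gamma> x powr p * (w x)\<^sup>2)
        \<le> C * (LINT x:{0..2 * pi}|lebesgue. \<gamma> x powr q * (weak_deriv w x)\<^sup>2)" using pt(1) by simp
    then have "bound * (LINT x:{0..2 * pi}|lebesgue. \<gamma> x powr q * (weak_deriv w x)\<^sup>2)
        \<le> C * (LINT x:{0..2 * pi}|lebesgue. \<gamma> x powr q * (weak_deriv w x)\<^sup>2)" unfolding pt(2) .
    moreover have "0 < (LINT x:{0..2 * pi}|lebesgue. \<gamma> x powr q * (weak_deriv w x)\<^sup>2)"
      using pt(3) bound_pos unfolding pt(2) by (simp add: zero_less_mult_iff)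
    ultimately show "bound \<le> C" by (rule mult_right_le_imp_le)
  qed
qed

lemma equality_case:
  assumes "competitor A W G" "W u0 \<noteq> 0"
    and "(LINT u:{0..8 * al}|lborel. A u * (W u)\<^sup>2) = (LINT u:{0..8 * al}|lborel. A u * (G u)\<^sup>2)"
  shows "\<exists>K x. K \<noteq> 0 \<and> matches x \<and> (\<forall>u. W u = K * U (u - x))"
proof (rule periodic_equality[OF periodic_weight_A assms(1,3,2)])
  fix K x assume "K \<noteq> 0" "\<And>u. W u = K * U (u - x)" "AE u in lborel. A u = B (u - x)"
  then show ?thesis unfolding matches_iff by (intro exI[of _ K] exI[of _ x]) simp
qed

text \<open>If the best constant is not smaller than the bound, there are test functions whose quotients come
  arbitrarily close to it. They form a minimising sequence of the normalised problem, whose limit is a case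
  of equality.\<close>
lemma matches_if_best_eq_bound:
  assumes "best = bound"
  shows "\<exists>x. matches x"
proof -
  have "\<exists>W G. competitor A W G \<and> 0 < (LINT t:{0..8 * al}|lborel. A t * (W t)\<^sup>2) \<and>
      (LINT t:{0..8 * al}|lborel. A t * (G t)\<^sup>2) \<le> (1 + e) * (LINT t:{0..8 * al}|lborel. A t * (W t)\<^sup>2)" if e: "0 < e" for e
  proof -
    \<comment> \<open>A constant smaller than the best one, hence violated by some test function.\<close>
    define C where "C = bound / (1 + e)"
    have C: "0 < C" "C < bound" using bound_pos e by (simp_all add: C_def field_simps)
    have "\<exists>w\<in>admissible (\<lambda>t. \<gamma> t powr p). \<not> (LINT x:{0..2 * pi}|lebesgue. \<gamma> x powr p * (w x)\<^sup>2)
        \<le> C * (LINT x:{0..2 * pi}|lebesgue. \<gamma> x powr q * (weak_deriv w x)\<^sup>2)"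
    proof (rule ccontr)
      assume "\<not> ?thesis"
      then have "best \<le> C" unfolding wirtinger_const_def
        by (intro cInf_lower) (use C in \<open>auto intro!: bdd_belowI[of _ 0]\<close>)
      then show False using assms C by simp
    qed
    then obtain w where w: "w \<in> admissible (\<lambda>t. \<gamma> t powr p)" and
      less: "C * (LINT x:{0..2 * pi}|lebesgue. \<gamma> x powr q * (weak_deriv w x)\<^sup>2) < (LINT x:{0..2 * pi}|lebesgue. \<gamma> x powr p * (w x)\<^sup>2)"
      by (auto simp: not_le)
    obtain W G where WG: "periodic_sobolev_pair W G" "AE t in lebesgue. w t = W t"
       "(LINT t:{0..2 * pi}|lborel. \<gamma> t powr p * W t) = 0" using w unfolding admissible_iff by blast
    have s: "sobolev_pair W G" using WG(1) by (simp add: periodic_sobolev_pair_def)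
    define H where "H u = G (unphase u) / (om * k (unphase u))" for u
    note tc = to_competitor[OF WG(1,3), folded H_def]
    let ?X = "LINT u:{0..8 * al}|lborel. A u * (W (unphase u))\<^sup>2"
    let ?Y = "LINT u:{0..8 * al}|lborel. A u * (H u)\<^sup>2"
    have X: "(LINT t:{0..2 * pi}|lborel. \<gamma> t powr p * (W t)\<^sup>2) = ?X / om" using tc(2) om_pos by simp
    have "C * (om * ?Y) < ?X / om" using less unfolding energies[OF s WG(2)] tc(3) X .
    then have "(C * (om * ?Y)) * (om * (1 + e)) < (?X / om) * (om * (1 + e))"
      using om_pos e by (intro mult_strict_right_mono) auto
    moreover define D where "D = 1 + e"
    ultimately have "1 / om\<^sup>2 / D * (om * ?Y) * (om * D) < ?X / om * (om * D)" "0 < D"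
      using e by (simp_all add: C_def bound_def)
    then have le: "?Y < (1 + e) * ?X"
      using om_pos by (simp add: power2_eq_square mult.commute D_def[symmetric])
    have "0 \<le> ?Y" unfolding set_lebesgue_integral_def
      by (rule Bochner_Integration.integral_nonneg) (simp add: A_def)
    then have "0 < (1 + e) * ?X" using le by linarith
    then have "0 < ?X" using e by (simp add: zero_less_mult_iff)
    with tc(1) le show ?thesis by (intro exI[of _ "\<lambda>u. W (unphase u)"] exI[of _ H]) simp
  qed
  then show ?thesis
  proof (rule minimiser_exists[OF periodic_weight_A])
    fix W G assume c: "competitor A W G" and W: "(LINT t:{0..8 * al}|lborel. A t * (W t)\<^sup>2) = 1"
      and G: "(LINT t:{0..8 * al}|lborel. A t * (G t)\<^sup>2) = 1"
    have "\<exists>u. W u \<noteq> 0"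
    proof (rule ccontr)
      assume "\<nexists>u. W u \<noteq> 0"
      then show False using W by simp
    qed
    then obtain u where "W u \<noteq> 0" by blast
    from equality_case[OF c this] W G show ?thesis by auto
  qed
qed

lemma extremal_iff_profile:
  assumes "matches x0"
  shows "extremal (\<lambda>t. \<gamma> t powr p) (\<lambda>t. \<gamma> t powr q) w \<longleftrightarrow>
    (\<exists>K x. K \<noteq> 0 \<and> matches x \<and> (AE t in lebesgue. w t = K * U (phase t - x)))"
proof
  assume "\<exists>K x. K \<noteq> 0 \<and> matches x \<and> (AE t in lebesgue. w t = K * U (phase t - x))"
  then obtain K x where K: "K \<noteq> 0" "matches x" "AE t in lebesgue. w t = K * U (phase t - x)" by blast
  note pt = profile_in_time[OF K(2,3)]
  have "\<not> (AE t in lebesgue. w t = 0)"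
  proof
    assume z: "AE t in lebesgue. w t = 0"
    have "AE t in lebesgue. \<gamma> t powr p * (w t)\<^sup>2 = 0" using z by eventually_elim simp
    then have "(LINT t:{0..2 * pi}|lebesgue. \<gamma> t powr p * (w t)\<^sup>2) = (LINT t:{0..2 * pi}|lborel. 0)"
      by (intro LINT_lebesgue_AE(1)) auto
    then show False using pt(3)[OF K(1)] by simp
  qed
  then show "extremal (\<lambda>t. \<gamma> t powr p) (\<lambda>t. \<gamma> t powr q) w"
    using pt(1,2) best_eq_bound_if_matches[OF assms] by (simp add: extremal_def)
next
  assume ex: "extremal (\<lambda>t. \<gamma> t powr p) (\<lambda>t. \<gamma> t powr q) w"
  then have w: "w \<in> admissible (\<lambda>t. \<gamma> t powr p)" "\<not> (AE t in lebesgue. w t = 0)"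
    and eq: "(LINT t:{0..2 * pi}|lebesgue. \<gamma> t powr p * (w t)\<^sup>2)
       = bound * (LINT t:{0..2 * pi}|lebesgue. \<gamma> t powr q * (weak_deriv w t)\<^sup>2)"
    using best_eq_bound_if_matches[OF assms] by (auto simp: extremal_def)
  obtain W G where WG: "periodic_sobolev_pair W G" "AE t in lebesgue. w t = W t"
     "(LINT t:{0..2 * pi}|lborel. \<gamma> t powr p * W t) = 0" using w(1) unfolding admissible_iff by blast
  have s: "sobolev_pair W G" using WG(1) by (simp add: periodic_sobolev_pair_def)
  define H where "H u = G (unphase u) / (om * k (unphase u))" for u
  note tc = to_competitor[OF WG(1,3), folded H_def]
  let ?X = "LINT u:{0..8 * al}|lborel. A u * (W (unphase u))\<^sup>2"
  let ?Y = "LINT u:{0..8 * al}|lborel. A u * (H u)\<^sup>2"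
  have X: "(LINT t:{0..2 * pi}|lborel. \<gamma> t powr p * (W t)\<^sup>2) = ?X / om" using tc(2) om_pos by simp
  have "?X / om = bound * (om * ?Y)" using eq unfolding energies[OF s WG(2)] tc(3) X .
  then have XY: "?X = ?Y" using om_pos by (simp add: bound_def field_simps power2_eq_square)
  have nz: "\<exists>t0. W (unphase t0) \<noteq> 0"
  proof (rule ccontr)
    assume "\<nexists>t0. W (unphase t0) \<noteq> 0"
    then have "W t = 0" for t using unphase_phase by metis
    then show False using WG(2) w(2) by simp
  qed
  then obtain t0 where "W (unphase t0) \<noteq> 0" by blast
  from equality_case[OF tc(1) this XY] obtain K x where K: "K \<noteq> 0" "matches x" "\<forall>u. W (unphase u) = K * U (u - x)"
    by blast
  have "W t = K * U (phase t - x)" for t using K(3)[rule_format, of "phase t"] by simp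
  then have "AE t in lebesgue. w t = K * U (phase t - x)" using WG(2) by simp
  then show "\<exists>K x. K \<noteq> 0 \<and> matches x \<and> (AE t in lebesgue. w t = K * U (phase t - x))"
    using K(1,2) by blast
qed

end


section \<open>The coefficient that attains the bound\<close>

lemma AE_interval_contradiction:
  fixes a b :: real
  assumes "AE x in lborel. P x" "\<And>x. a < x \<Longrightarrow> x < b \<Longrightarrow> \<not> P x"
  shows "b \<le> a"
proof (rule ccontr)
  assume "\<not> b \<le> a"
  have "AE x in lborel. \<not> (x \<in> {a<..<b})" using assms(1) by eventually_elim (use assms(2) in auto)
  then have "emeasure lborel {x \<in> space lborel. x \<in> {a<..<b}} = 0" by (rule emeasure_eq_0_AE)
  moreover have "{x \<in> space lborel. x \<in> {a<..<b}} = {a<..<b}" by auto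
  ultimately have "emeasure lborel {a<..<b} = 0" by simp
  then show False using \<open>\<not> b \<le> a\<close> by simp
qed

context bang_bang begin

lemma U_shift_multiple: "(\<forall>u. U (u + 4 * al * of_int n) = U u) \<or> (\<forall>u. U (u + 4 * al * of_int n) = - U u)"
proof -
  have e: "U (u + of_int m * (8 * al)) = U u" for u and m :: int
    by (rule periodic_int) (rule U_shift8)
  show ?thesis
  proof (cases "even n")
    case True
    then obtain m where "n = 2 * m" by blast
    then have "U (u + 4 * al * of_int n) = U u" for u using e[of u m] by (simp add: algebra_simps)
    then show ?thesis by blast
  next
    case False
    then obtain m where "n = 2 * m + 1" by (rule oddE)
    then have "U (u + 4 * al * of_int n) = - U u" for u
      using e[of "u + 4 * al" m] U_shift4[of u] by (simp add: algebra_simps)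
    then show ?thesis by blast
  qed
qed

text \<open>Reduce \<open>d\<close> modulo the period \<open>4 * al\<close> of \<open>B\<close> to \<open>e\<close>. Unless \<open>e = 0\<close>, an interval at one of the ends of the even
  cell 0 is moved by \<open>e\<close> into the odd cell 1: at the right end if \<open>e \<le> 2 * al\<close>, at the left end otherwise.\<close>
lemma B_shift_rigid:
  assumes "1 < s" and ae: "AE u in lborel. B (u + d) = B u"
  shows "\<exists>n::int. d = 4 * al * of_int n"
proof -
  obtain n :: int where n: "0 \<le> d + of_int n * (4 * al)" "d + of_int n * (4 * al) < 0 + 4 * al"
    using ex_period_window[of "4 * al" 0 d] al_pos by auto
  define e where "e = d + of_int n * (4 * al)"
  have e: "0 \<le> e" "e < 4 * al" using n by (auto simp: e_def)
  have "B (u + of_int n * (4 * al)) = B u" for u by (rule periodic_int) (rule B_shift4)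
  from this[of "u + d" for u] have "B (u + e) = B (u + d)" for u by (simp add: e_def add.assoc)
  then have aee: "AE u in lborel. B (u + e) = B u" using ae by simp
  have s2: "s\<^sup>2 \<noteq> 1" using assms(1) by (simp add: power2_eq_1_iff)
  have B1: "B u = 1" if "- al < u" "u < al" for u using cell_eqI[of 0 u] that by (simp add: B_def)
  have Bs: "B u = s\<^sup>2" if "al < u" "u < 3 * al" for u using cell_eqI[of 1 u] that by (simp add: B_def)
  have "e = 0"
  proof (rule ccontr)
    assume "e \<noteq> 0"
    show False
    proof (cases "e \<le> 2 * al")
      case True
      have "al \<le> max (- al) (al - e)"
      proof (rule AE_interval_contradiction[OF aee])
        fix u assume "max (- al) (al - e) < u" "u < al"
        then show "B (u + e) \<noteq> B u" using B1[of u] Bs[of "u + e"] True s2 by simp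
      qed
      then show False using \<open>e \<noteq> 0\<close> e al_pos by auto
    next
      case False
      have "min al (3 * al - e) \<le> - al"
      proof (rule AE_interval_contradiction[OF aee])
        fix u assume "- al < u" "u < min al (3 * al - e)"
        then show "B (u + e) \<noteq> B u" using B1[of u] Bs[of "u + e"] False s2 by simp
      qed
      then show False using e al_pos by auto
    qed
  qed
  then have "d = 4 * al * of_int (- n)" by (simp add: e_def algebra_simps)
  then show ?thesis by blast
qed

lemma U_eq_sin:
  assumes "s = 1"
  shows "U x = sin x"
proof -
  have "al = arctan (1 / s)" by (rule al_def)
  also have "\<dots> = pi / 4" using assms by (simp add: arctan_one)
  finally have al: "al = pi / 4" .
  have div: "z / s = z" for z using assms by simp
  obtain n :: int where n: "- al \<le> x + of_int n * (2 * pi)" "x + of_int n * (2 * pi) < - al + 2 * pi"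
    using ex_period_window[of "2 * pi" "- al" x] by auto
  define y where "y = x + of_int n * (2 * pi)"
  have "U y = U x" using periodic_int[of U "2 * pi" x n] U_shift8 by (simp add: y_def al)
  moreover have "sin y = sin x" unfolding y_def by (rule periodic_int) simp
  moreover have "U y = sin y"
  proof -
    have y: "- pi / 4 \<le> y" "y < 7 * pi / 4" using n by (simp_all add: y_def al)
    consider "y \<le> pi / 4" | "pi / 4 \<le> y" "y \<le> 3 * pi / 4" | "3 * pi / 4 \<le> y" "y \<le> 5 * pi / 4" | "5 * pi / 4 \<le> y" by linarith
    then show ?thesis
    proof cases
      case 1 then show ?thesis using U_eq_piece[of 0 y] y by (simp add: al piece_def)
    next
      case 2 then show ?thesis using U_eq_piece[of 1 y] y by (simp add: al piece_def div cos_diff)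
    next
      case 3 then show ?thesis using U_eq_piece[of 2 y] y by (simp add: al piece_def sin_diff)
    next
      case 4
      have "U y = piece 3 (y - 2 * al * of_int 3)" by (rule U_eq_piece) (use 4 y in \<open>simp_all add: al\<close>)
      also have "y - 2 * al * of_int 3 = y - 3 / 2 * pi" by (simp add: al)
      also have "piece 3 (y - 3 / 2 * pi) = - cos (y - 3 / 2 * pi)" by (simp add: piece_def div)
      also have "\<dots> = sin y" unfolding cos_diff cos_3over2_pi sin_3over2_pi by simp
      finally show ?thesis .
    qed
  qed
  ultimately show ?thesis by simp
qed

end

context coefficient begin

text \<open>Length of an interval on which \<open>gamma_bar\<close> is 1.\<close>
definition hh :: real where "hh = c_const M p q * (pi / 2)"

text \<open>The value of \<open>k\<close> where the coefficient is \<open>M\<close>; where it is 1, so is \<open>k\<close>.\<close>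
definition rr :: real where "rr = M powr ((p - q) / 2)"

lemma rr_pos: "0 < rr" using M_gt_1 by (simp add: rr_def)

lemma c_const_eq: "c_const M p q = 2 * rr / (1 + rr)"
proof -
  have "- (p - q) / 2 = - ((p - q) / 2)" by (rule minus_divide_left[symmetric])
  then have "M powr (- (p - q) / 2) = 1 / rr" unfolding rr_def powr_minus_divide[symmetric] by (simp only:)
  then have "c_const M p q = 2 / (1 + 1 / rr)" unfolding c_const_def by (simp only:)
  also have "\<dots> = 2 * rr / (1 + rr)" using rr_pos by (simp add: divide_simps)
  finally show ?thesis .
qed

lemma c_const_pos: "0 < c_const M p q" using rr_pos by (simp add: c_const_eq)

lemma hh_pos: "0 < hh" and hh_less: "hh < pi" and hh_rr: "rr * (pi - hh) = hh"
proof -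
  have h: "hh = pi * rr / (1 + rr)" using rr_pos by (simp add: hh_def c_const_eq field_simps)
  show "0 < hh" unfolding h using rr_pos by simp
  show "rr * (pi - hh) = hh" unfolding h using rr_pos by (simp add: field_simps)
  then have "0 < rr * (pi - hh)" using \<open>0 < hh\<close> by simp
  then show "hh < pi" using zero_less_mult_pos[OF _ rr_pos, of "pi - hh"] by simp
qed

lemma inv_ss: "M powr (- (p + q) / 4) = 1 / ss"
proof -
  have "- (p + q) / 4 = - ((p + q) / 4)" by (rule minus_divide_left[symmetric])
  then show ?thesis unfolding ss_def powr_minus_divide[symmetric] by (simp only:)
qed

lemma al_eq: "al = arctan (M powr (- (p + q) / 4))"
  unfolding inv_ss by (rule al_def)

lemma sqrt_mu: "sqrt (mu_const M p q) = 4 * al / pi"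
proof -
  have "mu_const M p q = (4 * al / pi)\<^sup>2" unfolding mu_const_def al_eq by simp
  then show ?thesis using al_pos by (simp only: real_sqrt_abs) simp
qed

definition step :: "real \<Rightarrow> real" where "step u = (if even (cell u) then 1 else M)"

lemma step_measurable [measurable]: "step \<in> borel_measurable borel" unfolding step_def by measurable

text \<open>For \<open>0 < p + q\<close> the weight determines the coefficient.\<close>
lemma matches_iff_step:
  assumes "0 < p + q"
  shows "matches x \<longleftrightarrow> (AE t in lborel. \<gamma> t = step (phase t - x))"
proof -
  have inj: "\<gamma> t powr ((p + q) / 2) = y powr ((p + q) / 2) \<longleftrightarrow> \<gamma> t = y" if "0 < y" for t y
  proof
    assume "\<gamma> t powr ((p + q) / 2) = y powr ((p + q) / 2)"
    then have "(\<gamma> t powr ((p + q) / 2)) powr (2 / (p + q)) = (y powr ((p + q) / 2)) powr (2 / (p + q))" by simp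
    moreover have "(p + q) / 2 * (2 / (p + q)) = 1" using assms by simp
    ultimately have "\<gamma> t powr 1 = y powr 1" by (simp only: powr_powr)
    then show "\<gamma> t = y" using that \<gamma>_pos[of t] by simp
  qed simp
  have "B u = step u powr ((p + q) / 2)" for u by (simp add: B_def step_def ss2)
  moreover have "0 < step u" for u using M_gt_1 by (simp add: step_def)
  ultimately show ?thesis unfolding matches_def using inj by simp
qed

lemma phase_linear:
  assumes "AE t in lborel. t1 < t \<longrightarrow> t < t2 \<longrightarrow> k t = v" "t1 \<le> t" "t \<le> t2"
  shows "phase t - phase t1 = om * v * (t - t1)"
proof -
  have "AE u in lborel. u \<notin> {t1, t2}" by (rule AE_not_in) (auto intro: countable_imp_null_set_lborel)
  with assms(1) have "AE u\<in>{t1..t} in lborel. k u = v" by eventually_elim (use assms(2,3) in auto)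
  then have "(LINT u:{t1..t}|lborel. k u) = (LINT u:{t1..t}|lborel. v)"
    by (intro set_lebesgue_integral_cong_AE) auto
  also have "\<dots> = v * (t - t1)" using assms(2) by (simp add: set_integral_const mult.commute)
  finally show ?thesis using phase_diff[OF assms(2)] by simp
qed

text \<open>The density \<open>k\<close> of \<open>gamma_bar\<close> on the first period.\<close>
definition bar_k :: "real \<Rightarrow> real" where
  "bar_k \<theta> = (if \<theta> < hh \<or> pi \<le> \<theta> \<and> \<theta> < pi + hh then 1 else rr)"

text \<open>On each of the four intervals the phase has constant slope. As it grows by \<open>8 * al\<close> altogether and
  \<open>rr * (pi - hh) = hh\<close>, it grows by \<open>2 * al\<close> on each of them, which determines \<open>om\<close>.\<close>
lemma phase_of_bar_k:
  assumes ae: "AE t in lborel. t0 < t \<longrightarrow> t < t0 + 2 * pi \<longrightarrow> k t = bar_k (t - t0)"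
  shows "0 \<le> \<theta> \<Longrightarrow> \<theta> \<le> hh \<Longrightarrow> phase (t0 + \<theta>) - phase t0 = 2 * al * (\<theta> / hh)"
    and "hh \<le> \<theta> \<Longrightarrow> \<theta> \<le> pi \<Longrightarrow> phase (t0 + \<theta>) - phase t0 = 2 * al + 2 * al * (rr * (\<theta> - hh) / hh)"
    and "pi \<le> \<theta> \<Longrightarrow> \<theta> \<le> pi + hh \<Longrightarrow> phase (t0 + \<theta>) - phase t0 = 4 * al + 2 * al * ((\<theta> - pi) / hh)"
    and "pi + hh \<le> \<theta> \<Longrightarrow> \<theta> \<le> 2 * pi \<Longrightarrow> phase (t0 + \<theta>) - phase t0 = 6 * al + 2 * al * (rr * (\<theta> - pi - hh) / hh)"
proof -
  note h = hh_pos hh_less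
  have seg: "phase (t0 + \<theta>) - phase (t0 + a) = om * v * (\<theta> - a)"
    if "0 \<le> a" "a \<le> \<theta>" "\<theta> \<le> b" "b \<le> 2 * pi" "\<And>u. a < u \<Longrightarrow> u < b \<Longrightarrow> bar_k u = v" for a b v \<theta>
  proof -
    have "AE t in lborel. t0 + a < t \<longrightarrow> t < t0 + b \<longrightarrow> k t = v"
      using ae
    proof eventually_elim
      case (elim t)
      show ?case using elim that(5)[of "t - t0"] that(1,4) by auto
    qed
    from phase_linear[OF this, of "t0 + \<theta>"] that show ?thesis by simp
  qed
  have s1: "phase (t0 + \<theta>) - phase t0 = om * \<theta>" if "0 \<le> \<theta>" "\<theta> \<le> hh" for \<theta>
    using seg[of 0 \<theta> hh 1] that h by (simp add: bar_k_def)
  have s2: "phase (t0 + \<theta>) - phase (t0 + hh) = om * rr * (\<theta> - hh)" if "hh \<le> \<theta>" "\<theta> \<le> pi" for \<theta>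
    using seg[of hh \<theta> pi rr] that h by (simp add: bar_k_def)
  have s3: "phase (t0 + \<theta>) - phase (t0 + pi) = om * (\<theta> - pi)" if "pi \<le> \<theta>" "\<theta> \<le> pi + hh" for \<theta>
    using seg[of pi \<theta> "pi + hh" 1] that h by (simp add: bar_k_def)
  have s4: "phase (t0 + \<theta>) - phase (t0 + (pi + hh)) = om * rr * (\<theta> - (pi + hh))" if "pi + hh \<le> \<theta>" "\<theta> \<le> 2 * pi" for \<theta>
    using seg[of "pi + hh" \<theta> "2 * pi" rr] that h by (simp add: bar_k_def)
  have e: "om * rr * (pi - hh) = om * hh" using hh_rr by (simp add: mult.assoc)
  have "phase (t0 + 2 * pi) - phase t0 = 4 * (om * hh)"
    using s1[of hh] s2[of pi] s3[of "pi + hh"] s4[of "2 * pi"] e h by (simp add: algebra_simps)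
  then have oh: "om * hh = 2 * al" using phase_periodic[of t0] by simp
  then have om: "om = 2 * al / hh" using h by (simp add: field_simps)
  show "0 \<le> \<theta> \<Longrightarrow> \<theta> \<le> hh \<Longrightarrow> phase (t0 + \<theta>) - phase t0 = 2 * al * (\<theta> / hh)"
    using s1[of \<theta>] by (simp add: om)
  show "hh \<le> \<theta> \<Longrightarrow> \<theta> \<le> pi \<Longrightarrow> phase (t0 + \<theta>) - phase t0 = 2 * al + 2 * al * (rr * (\<theta> - hh) / hh)"
    using s1[of hh] s2[of \<theta>] h oh by (simp add: om)
  show "pi \<le> \<theta> \<Longrightarrow> \<theta> \<le> pi + hh \<Longrightarrow> phase (t0 + \<theta>) - phase t0 = 4 * al + 2 * al * ((\<theta> - pi) / hh)"
    using s1[of hh] s2[of pi] s3[of \<theta>] h oh e by (simp add: om)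
  show "pi + hh \<le> \<theta> \<Longrightarrow> \<theta> \<le> 2 * pi \<Longrightarrow> phase (t0 + \<theta>) - phase t0 = 6 * al + 2 * al * (rr * (\<theta> - pi - hh) / hh)"
    using s1[of hh] s2[of pi] s3[of "pi + hh"] s4[of \<theta>] h oh e by (simp add: om diff_diff_eq)
qed

text \<open>The four intervals in the definitions of \<open>gamma_bar\<close> and \<open>w_bar\<close> are the four cells of a period of \<open>U\<close>. The
  definitions start at the left end of the even cell 0, that is, at the phase \<open>x - al\<close> for a zero of the
  profile at \<open>x\<close>.\<close>
lemma bar_formulas:
  assumes ae: "AE t in lborel. t0 < t \<longrightarrow> t < t0 + 2 * pi \<longrightarrow> k t = bar_k (t - t0)"
  defines "x \<equiv> phase t0 + al"
  shows "U (phase t - x) = w_bar M p q (t - t0)" "step (phase t - x) = gamma_bar M p q (t - t0)"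
proof -
  note h = hh_pos hh_less
  define \<theta> where "\<theta> = (t - t0) rmod (2 * pi)"
  have \<theta>: "0 \<le> \<theta>" "\<theta> < 2 * pi" unfolding \<theta>_def by (auto intro: rmod_nonneg rmod_less)
  define n where "n = \<lfloor>(t - t0) / (2 * pi)\<rfloor>"
  have t: "t = t0 + \<theta> + of_int n * (2 * pi)" by (simp add: \<theta>_def rmod_def n_def)
  have ph: "phase (u + of_int m * (2 * pi)) = phase u + of_int m * (8 * al)" for u and m :: int
  proof -
    have per: "phase (v + 2 * pi) - 4 * al / pi * (v + 2 * pi) = phase v - 4 * al / pi * v" for v
      using phase_periodic[of v] by (simp add: distrib_left)
    moreover have "4 * al / pi * (u + of_int m * (2 * pi)) = 4 * al / pi * u + of_int m * (8 * al)"
      by (simp add: distrib_left)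
    ultimately show ?thesis
      using periodic_int[of "\<lambda>v. phase v - 4 * al / pi * v", OF per, of u m] by linarith
  qed
  define y where "y = phase (t0 + \<theta>) - phase t0 - al"
  have y: "phase t - x = y + of_int n * (8 * al)" unfolding t ph by (simp add: y_def x_def)
  have "U (phase t - x) = U y" unfolding y by (rule periodic_int) (rule U_shift8)
  moreover have "step (phase t - x) = step y"
  proof -
    have "cell (y + of_int n * (8 * al)) = cell y + 4 * n"
      using cell_shift[of y "4 * n"] by (simp add: algebra_simps)
    then show ?thesis by (simp add: step_def y)
  qed
  moreover have "U y = w_bar M p q (t - t0) \<and> step y = gamma_bar M p q (t - t0)"
  proof -
    note f = phase_of_bar_k[OF ae, of \<theta>]
    have hc: "hh = c_const M p q * (pi / 2)" by (simp add: hh_def)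
    have frac: "0 \<le> r \<Longrightarrow> 0 < d \<Longrightarrow> r < d \<Longrightarrow> 0 \<le> 2 * al * (r / d) \<and> 2 * al * (r / d) < 2 * al" for r d :: real
    proof -
      fix r d :: real assume rd: "0 \<le> r" "0 < d" "r < d"
      then have "0 \<le> r / d" "r / d < 1" by simp_all
      then have "0 \<le> 2 * al * (r / d)" "2 * al * (r / d) < 2 * al * 1"
        using al_pos by (intro mult_nonneg_nonneg mult_strict_left_mono; simp)+
      then show "0 \<le> 2 * al * (r / d) \<and> 2 * al * (r / d) < 2 * al" by linarith
    qed
    have wb: "w_bar M p q (t - t0) = (if \<theta> < hh then sin (4 * al / pi * (\<theta> / c_const M p q - pi / 4))
        else if \<theta> < pi then 1 / ss * cos (4 * al / pi * (pi / 2 + rr / c_const M p q * (\<theta> - hh) - 3 * pi / 4))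
        else if \<theta> < pi + hh then - sin (4 * al / pi * (pi + (\<theta> - pi) / c_const M p q - 5 * pi / 4))
        else - (1 / ss) * cos (4 * al / pi * (3 * pi / 2 + rr / c_const M p q * (\<theta> - pi - hh) - 7 * pi / 4)))"
      unfolding w_bar_def Let_def \<theta>_def[symmetric] sqrt_mu inv_ss rr_def[symmetric] hh_def[symmetric] by (rule refl)
    have gb: "gamma_bar M p q (t - t0) = (if \<theta> < hh \<or> pi \<le> \<theta> \<and> \<theta> < pi + hh then 1 else M)"
      unfolding gamma_bar_def Let_def \<theta>_def[symmetric] hh_def[symmetric] by (rule refl)
    consider "\<theta> < hh" | "hh \<le> \<theta>" "\<theta> < pi" | "pi \<le> \<theta>" "\<theta> < pi + hh" | "pi + hh \<le> \<theta>" by linarith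
    then show ?thesis
    proof cases
      case 1
      have ye: "y = 2 * al * (\<theta> / hh) - al" using f(1) 1 \<theta> by (simp add: y_def)
      have cy: "cell y = 0" by (rule cell_eqI) (use frac[of \<theta> hh] 1 \<theta> h in \<open>auto simp: ye\<close>)
      have e: "y = 4 * al / pi * (\<theta> / c_const M p q - pi / 4)" unfolding ye hc using c_const_pos by (simp add: field_simps)
      have uy: "U y = sin y" using cy by (simp add: U_def piece_def)
      have c: "\<theta> < hh" using 1 h by simp_all
      have "w_bar M p q (t - t0) = sin y" by (simp only: wb c if_True if_False e)
      moreover have "gamma_bar M p q (t - t0) = 1"
        unfolding gb using 1 by simp
      ultimately show ?thesis using cy uy by (simp add: step_def)
    next
      case 2
      have lt: "rr * (\<theta> - hh) < hh" using 2 rr_pos hh_rr by (metis diff_strict_right_mono mult_strict_left_mono)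
      have ye: "y = al + 2 * al * (rr * (\<theta> - hh) / hh)" using f(2) 2 by (simp add: y_def)
      have cy: "cell y = 1" by (rule cell_eqI) (use frac[of "rr * (\<theta> - hh)" hh] 2 lt rr_pos h in \<open>auto simp: ye\<close>)
      have e: "y - 2 * al = 4 * al / pi * (pi / 2 + rr / c_const M p q * (\<theta> - hh) - 3 * pi / 4)"
        unfolding ye using c_const_pos by (simp add: hc field_simps)
      have uy: "U y = cos (y - 2 * al) / ss" using cy by (simp add: U_def piece_def)
      have c: "\<not> \<theta> < hh" "\<theta> < pi" using 2 h by simp_all
      have "w_bar M p q (t - t0) = 1 / ss * cos (y - 2 * al)" by (simp only: wb c if_True if_False e)
      moreover have "gamma_bar M p q (t - t0) = M"
        unfolding gb using 2 h by simp
      ultimately show ?thesis using cy uy by (simp add: step_def)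
    next
      case 3
      have ye: "y = 3 * al + 2 * al * ((\<theta> - pi) / hh)" using f(3) 3 by (simp add: y_def)
      have cy: "cell y = 2" by (rule cell_eqI) (use frac[of "\<theta> - pi" hh] 3 h in \<open>auto simp: ye\<close>)
      have e: "y - 4 * al = 4 * al / pi * (pi + (\<theta> - pi) / c_const M p q - 5 * pi / 4)"
        unfolding ye hc using c_const_pos by (simp add: field_simps)
      have uy: "U y = - sin (y - 4 * al)" using cy by (simp add: U_def piece_def)
      have c: "\<not> \<theta> < hh" "\<not> \<theta> < pi" "\<theta> < pi + hh" using 3 h by simp_all
      have "w_bar M p q (t - t0) = - sin (y - 4 * al)" by (simp only: wb c if_True if_False e)
      moreover have "gamma_bar M p q (t - t0) = 1"
        unfolding gb using 3 h by simp
      ultimately show ?thesis using cy uy by (simp add: step_def)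
    next
      case 4
      have lt: "rr * (\<theta> - pi - hh) < hh"
      proof -
        have "rr * (\<theta> - pi - hh) < rr * (pi - hh)" using rr_pos \<theta> by (intro mult_strict_left_mono) auto
        then show ?thesis using hh_rr by simp
      qed
      have ye: "y = 5 * al + 2 * al * (rr * (\<theta> - pi - hh) / hh)" using f(4) 4 \<theta> by (simp add: y_def)
      have cy: "cell y = 3" by (rule cell_eqI) (use frac[of "rr * (\<theta> - pi - hh)" hh] 4 lt rr_pos h in \<open>auto simp: ye\<close>)
      have e: "y - 6 * al = 4 * al / pi * (3 * pi / 2 + rr / c_const M p q * (\<theta> - pi - hh) - 7 * pi / 4)"
        unfolding ye using c_const_pos by (simp add: hc field_simps)
      have uy: "U y = - cos (y - 6 * al) / ss" using cy by (simp add: U_def piece_def)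
      have c: "\<not> \<theta> < hh" "\<not> \<theta> < pi" "\<not> \<theta> < pi + hh" using 4 h by simp_all
      have "w_bar M p q (t - t0) = - (1 / ss) * cos (y - 6 * al)" by (simp only: wb c if_True if_False e)
      moreover have "gamma_bar M p q (t - t0) = M"
        unfolding gb using 4 h by simp
      ultimately show ?thesis using cy uy by (simp add: step_def)
    qed
  qed
  ultimately show "U (phase t - x) = w_bar M p q (t - t0)" "step (phase t - x) = gamma_bar M p q (t - t0)" by auto
qed

text \<open>Let the phase pass the ends of the cells at the times \<open>T i\<close>. It crosses an even cell in the time
  \<open>2 * al / om\<close> and an odd cell in the time \<open>2 * al / (om * rr)\<close>. Four cells take the time \<open>2 * pi\<close>, which
  determines \<open>om\<close> and shows that the crossing times are those in the definition of \<open>gamma_bar\<close>.\<close>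
lemma matches_imp_bar:
  assumes pos: "0 < p + q" and m: "matches x"
  shows "\<exists>\<phi>. (\<forall>t. U (phase t - x) = w_bar M p q (t + \<phi>)) \<and> (AE t in lborel. \<gamma> t = gamma_bar M p q (t + \<phi>))"
proof -
  have ae: "AE t in lborel. \<gamma> t = step (phase t - x)" using m unfolding matches_iff_step[OF pos] .
  define T where "T i = unphase (x - al + 2 * al * real i)" for i :: nat
  have phT: "phase (T i) = x - al + 2 * al * real i" for i by (simp add: T_def)
  have kk: "k t = (if even i then 1 else rr)"
    if "\<gamma> t = step (phase t - x)" "T i < t" "t < T (Suc i)" for i t
  proof -
    have "phase (T i) < phase t" "phase t < phase (T (Suc i))" using that phase_less_iff by auto
    then have "cell (phase t - x) = int i" unfolding phT by (intro cell_eqI) (auto simp: algebra_simps)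
    then show ?thesis using that(1) by (simp add: k_def step_def rr_def)
  qed
  have len: "2 * al = om * (if even i then 1 else rr) * (T (Suc i) - T i)" for i
  proof -
    have "AE t in lborel. T i < t \<longrightarrow> t < T (Suc i) \<longrightarrow> k t = (if even i then 1 else rr)"
      using ae by eventually_elim (intro impI kk)
    moreover have "T i \<le> T (Suc i)" unfolding T_def using al_pos by (intro monoD[OF unphase_mono]) simp
    ultimately have "phase (T (Suc i)) - phase (T i) = om * (if even i then 1 else rr) * (T (Suc i) - T i)"
      by (intro phase_linear[of _ "T (Suc i)"]) auto
    then show ?thesis unfolding phT by (simp add: algebra_simps)
  qed
  define t0 where "t0 = T 0"
  define l where "l = 2 * al / om"
  have len_even: "T (Suc i) - T i = l" if "even i" for i
    using len[of i] that om_pos by (simp add: l_def field_simps)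
  have len_odd: "T (Suc i) - T i = l / rr" if "odd i" for i
    using len[of i] that om_pos rr_pos by (simp add: l_def field_simps)
  have T: "T (Suc 0) = t0 + l" "T (Suc (Suc 0)) = T (Suc 0) + l / rr" "T (Suc (Suc (Suc 0))) = T (Suc (Suc 0)) + l"
    "T (Suc (Suc (Suc (Suc 0)))) = T (Suc (Suc (Suc 0))) + l / rr"
    using len_even[of 0] len_odd[of "Suc 0"] len_even[of "Suc (Suc 0)"] len_odd[of "Suc (Suc (Suc 0))"]
    by (simp_all add: t0_def)
  have T4: "T (Suc (Suc (Suc (Suc 0)))) = t0 + 2 * pi"
    unfolding t0_def T_def using unphase_periodic[of "x - al"] by (simp add: algebra_simps)
  then have "l + l / rr = pi" using T by simp
  then have "l * (1 + rr) = pi * rr" using rr_pos by (simp add: field_simps)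
  then have lh: "l = hh" using rr_pos by (simp add: hh_def c_const_eq field_simps)
  then have lr: "l / rr = pi - hh" using \<open>l + l / rr = pi\<close> by simp
  have T': "T 0 = t0" "T (Suc 0) = t0 + hh" "T (Suc (Suc 0)) = t0 + pi" "T (Suc (Suc (Suc 0))) = t0 + pi + hh" "T (Suc (Suc (Suc (Suc 0)))) = t0 + 2 * pi"
    using T T4 lh lr by (simp_all add: t0_def)
  \<comment> \<open>At the ends of the cells the values of the piecewise definitions do not matter.\<close>
  have brk: "AE t in lborel. t \<notin> {t0, t0 + hh, t0 + pi, t0 + pi + hh}"
    by (rule AE_not_in) (auto intro: countable_imp_null_set_lborel)
  have "AE t in lborel. t0 < t \<longrightarrow> t < t0 + 2 * pi \<longrightarrow> k t = bar_k (t - t0)"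
    using ae brk
  proof eventually_elim
    case (elim t)
    show ?case
    proof (intro impI)
      assume t: "t0 < t" "t < t0 + 2 * pi"
      consider "t < t0 + hh" | "t0 + hh < t" "t < t0 + pi" | "t0 + pi < t" "t < t0 + pi + hh" | "t0 + pi + hh < t"
      proof -
        have "t \<noteq> t0 + hh" "t \<noteq> t0 + pi" "t \<noteq> t0 + pi + hh" using elim(2) by auto
        then show thesis using that by linarith
      qed
      then show "k t = bar_k (t - t0)"
      proof cases
        case 1 then show ?thesis using kk[OF elim(1), of 0] t T' by (simp add: bar_k_def)
      next
        case 2 then show ?thesis using kk[OF elim(1), of "Suc 0"] t T' hh_pos by (simp add: bar_k_def)
      next
        case 3 then show ?thesis using kk[OF elim(1), of "Suc (Suc 0)"] t T' hh_less by (simp add: bar_k_def)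
      next
        case 4 then show ?thesis using kk[OF elim(1), of "Suc (Suc (Suc 0))"] t T' hh_pos hh_less by (simp add: bar_k_def)
      qed
    qed
  qed
  note bf = bar_formulas[OF this]
  have x: "phase t0 + al = x" using phT[of 0] by (simp add: t0_def)
  have "AE t in lborel. \<gamma> t = gamma_bar M p q (t - t0)" using ae bf(2) unfolding x by simp
  then show ?thesis using bf(1) unfolding x by (intro exI[of _ "- t0"]) simp
qed

lemma bar_imp_matches:
  assumes pos: "0 < p + q" and ae: "AE t in lborel. \<gamma> t = gamma_bar M p q (t + \<phi>)"
  shows "\<exists>x. matches x \<and> (\<forall>t. U (phase t - x) = w_bar M p q (t + \<phi>))"
proof -
  have "AE t in lborel. - \<phi> < t \<longrightarrow> t < - \<phi> + 2 * pi \<longrightarrow> k t = bar_k (t - - \<phi>)"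
    using ae
  proof eventually_elim
    case (elim t)
    show ?case
    proof (intro impI)
      assume "- \<phi> < t" "t < - \<phi> + 2 * pi"
      then have "(t + \<phi>) rmod (2 * pi) = t + \<phi>" by (intro rmod_idem) auto
      then show "k t = bar_k (t - - \<phi>)"
        using elim by (simp add: k_def gamma_bar_def bar_k_def Let_def hh_def rr_def)
    qed
  qed
  note bf = bar_formulas[OF this]
  have "matches (phase (- \<phi>) + al)" unfolding matches_iff_step[OF pos] using ae bf(2) by simp
  then show ?thesis using bf(1) by (intro exI[of _ "phase (- \<phi>) + al"]) simp
qed

text \<open>Two positions of the profile for the same weight differ by a half period at most, up to periods.\<close>
lemma matches_rigid:
  assumes pos: "0 < p + q" and "matches x" "matches y"
  shows "(\<forall>u. U (u - x) = U (u - y)) \<or> (\<forall>u. U (u - x) = - U (u - y))"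
proof -
  have "1 < ss" unfolding ss_def using M_gt_1 pos by (intro gr_one_powr) auto
  have "AE u in lborel. B (u - x) = B (u - y)"
    using assms(2,3) unfolding matches_iff by eventually_elim simp
  then have "AE u in lborel. B (y + 1 * u - x) = B (y + 1 * u - y)" by (intro AE_borel_affine) auto
  then have "AE u in lborel. B (u + (y - x)) = B u" by (simp add: algebra_simps)
  from B_shift_rigid[OF \<open>1 < ss\<close> this] obtain n :: int where n: "y - x = 4 * al * of_int n" by blast
  have e: "u - x = (u - y) + 4 * al * of_int n" for u using n by simp
  show ?thesis unfolding e using U_shift_multiple[of n] by auto
qed

lemma period_lebesgue: "(LINT t:{0..2 * pi}|lebesgue. \<gamma> t powr ((p - q) / 2)) = period"
  using set_integrable_lebesgue_borel(2)[of k "{0..2 * pi}"] by (simp add: period_def k_def)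

lemma wirtinger_bound_eq: "wirtinger_bound M p q \<gamma> = bound"
  unfolding wirtinger_bound_def period_lebesgue al_eq[symmetric] bound_def om_def
  using al_pos period_pos by (simp add: field_simps power2_eq_square)

end


section \<open>Cases of equality for arbitrary representatives\<close>

lemma interval_lebesgue_LINT:
  fixes f g :: "real \<Rightarrow> real"
  assumes [measurable]: "g \<in> borel_measurable borel" and ae: "AE t in lebesgue. f t = g t"
  shows "(LINT t=ereal 0..ereal x|lebesgue. f t) = (LINT t:{0..x}|lborel. g t) - (LINT t:{x..0}|lborel. g t)"
proof -
  have ends: "(LINT t:{a<..<b}|lborel. g t) = (LINT t:{a..b}|lborel. g t)" for a b
  proof (rule set_integral_cong_set[symmetric])
    have "AE t in lborel. t \<notin> {a, b}" by (rule AE_not_in) (auto intro: countable_imp_null_set_lborel)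
    then show "AE t in lborel. (t \<in> {a<..<b}) = (t \<in> {a..b})" by eventually_elim auto
  qed (auto simp: set_borel_measurable_def)
  have o: "(LINT t:{a<..<b}|lebesgue. f t) = (LINT t:{a..b}|lborel. g t)" for a b
    using LINT_lebesgue_AE(1)[OF assms, of "{a<..<b}"] ends by simp
  have z: "(LINT t:{a..b}|lborel. g t) = 0" if "b \<le> a" for a b
  proof -
    have "(LINT t:{a..b}|lborel. g t) = (LINT t:{a<..<b}|lborel. g t)" by (rule ends[symmetric])
    also have "{a<..<b} = {}" using that by auto
    finally show ?thesis by (simp add: set_lebesgue_integral_def)
  qed
  show ?thesis
  proof (cases "0 \<le> x")
    case True
    then have "(LINT t=ereal 0..ereal x|lebesgue. f t) = (LINT t:{0<..<x}|lebesgue. f t)"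
      by (simp add: interval_lebesgue_integral_def zero_ereal_def)
    then show ?thesis using z[of 0 x] True by (simp add: o)
  next
    case False
    then have "(LINT t=ereal 0..ereal x|lebesgue. f t) = - (LINT t:{x<..<0}|lebesgue. f t)"
      by (simp add: interval_lebesgue_integral_def zero_ereal_def)
    then show ?thesis using z[of x 0] False by (simp add: o)
  qed
qed

context coefficient begin

lemma best_eq_iff_bar:
  assumes pos: "0 < p + q"
  shows "best = bound \<longleftrightarrow> (\<exists>\<phi>. AE t in lebesgue. \<gamma> t = gamma_bar M p q (t + \<phi>))"
proof
  assume "best = bound"
  then obtain x where "matches x" using matches_if_best_eq_bound by blast
  then show "\<exists>\<phi>. AE t in lebesgue. \<gamma> t = gamma_bar M p q (t + \<phi>)"
    using matches_imp_bar[OF pos] AE_completion by blast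
next
  assume "\<exists>\<phi>. AE t in lebesgue. \<gamma> t = gamma_bar M p q (t + \<phi>)"
  then obtain \<phi> where "AE t in lborel. \<gamma> t = gamma_bar M p q (t + \<phi>)" unfolding AE_completion_iff by blast
  then show "best = bound" using bar_imp_matches[OF pos] best_eq_bound_if_matches by blast
qed

lemma extremal_iff_bar:
  assumes pos: "0 < p + q" and ae: "AE t in lborel. \<gamma> t = gamma_bar M p q (t + \<phi>)"
  shows "extremal (\<lambda>t. \<gamma> t powr p) (\<lambda>t. \<gamma> t powr q) w \<longleftrightarrow>
    (\<exists>K. K \<noteq> 0 \<and> (AE t in lebesgue. w t = K * w_bar M p q (t + \<phi>)))"
proof -
  obtain x0 where x0: "matches x0" "\<forall>t. U (phase t - x0) = w_bar M p q (t + \<phi>)" using bar_imp_matches[OF pos ae] by blast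
  show ?thesis unfolding extremal_iff_profile[OF x0(1)]
  proof
    assume "\<exists>K x. K \<noteq> 0 \<and> matches x \<and> (AE t in lebesgue. w t = K * U (phase t - x))"
    then obtain K x where K: "K \<noteq> 0" "matches x" "AE t in lebesgue. w t = K * U (phase t - x)" by blast
    from matches_rigid[OF pos K(2) x0(1)] show "\<exists>K. K \<noteq> 0 \<and> (AE t in lebesgue. w t = K * w_bar M p q (t + \<phi>))"
    proof
      assume "\<forall>u. U (u - x) = U (u - x0)"
      then have "AE t in lebesgue. w t = K * w_bar M p q (t + \<phi>)" using K(3) x0(2) by simp
      then show ?thesis using K(1) by blast
    next
      assume "\<forall>u. U (u - x) = - U (u - x0)"
      then have "AE t in lebesgue. w t = - K * w_bar M p q (t + \<phi>)" using K(3) x0(2) by simp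
      then show ?thesis using K(1) by (intro exI[of _ "- K"]) simp
    qed
  next
    assume "\<exists>K. K \<noteq> 0 \<and> (AE t in lebesgue. w t = K * w_bar M p q (t + \<phi>))"
    then have "\<exists>K. K \<noteq> 0 \<and> (AE t in lebesgue. w t = K * U (phase t - x0))" using x0(2) by simp
    then show "\<exists>K x. K \<noteq> 0 \<and> matches x \<and> (AE t in lebesgue. w t = K * U (phase t - x))" using x0(1) by blast
  qed
qed

lemma matches_all_if_sum_0:
  assumes "p + q = 0"
  shows "matches x"
proof -
  have "ss = 1" using M_gt_1 by (simp add: ss_def assms)
  then have "B u = 1" for u using B_bounds(1,2)[of u] by simp
  then show ?thesis using \<gamma>_pos by (simp add: matches_def assms less_imp_neq[symmetric])
qed

text \<open>Here \<open>s = 1\<close>: the weight is constant, the profile is the sine and may start anywhere.\<close>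
lemma extremal_iff_cos:
  assumes "p + q = 0"
  shows "extremal (\<lambda>t. \<gamma> t powr p) (\<lambda>t. \<gamma> t powr q) w \<longleftrightarrow>
    (\<exists>K \<phi>. K \<noteq> 0 \<and> (AE t in lebesgue. w t = K * cos (phase t + \<phi>)))"
proof -
  have s1: "ss = 1" using M_gt_1 by (simp add: ss_def assms)
  have c: "U (u - x) = cos (u + (- x - pi / 2))" for u x
  proof -
    have "cos (u + (- x - pi / 2)) = cos ((u - x) - pi / 2)" by (simp add: algebra_simps)
    also have "\<dots> = sin (u - x)" by (simp add: cos_diff)
    finally show ?thesis using U_eq_sin[OF s1] by simp
  qed
  show ?thesis unfolding extremal_iff_profile[OF matches_all_if_sum_0[OF assms, of 0]]
  proof
    assume "\<exists>K x. K \<noteq> 0 \<and> matches x \<and> (AE t in lebesgue. w t = K * U (phase t - x))"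
    then show "\<exists>K \<phi>. K \<noteq> 0 \<and> (AE t in lebesgue. w t = K * cos (phase t + \<phi>))" unfolding c by blast
  next
    assume "\<exists>K \<phi>. K \<noteq> 0 \<and> (AE t in lebesgue. w t = K * cos (phase t + \<phi>))"
    then obtain K \<phi> where K: "K \<noteq> 0" "AE t in lebesgue. w t = K * cos (phase t + \<phi>)" by blast
    have "cos (phase t + \<phi>) = U (phase t - (- \<phi> - pi / 2))" for t unfolding c by simp
    then have "AE t in lebesgue. w t = K * U (phase t - (- \<phi> - pi / 2))" using K(2) by simp
    then show "\<exists>K x. K \<noteq> 0 \<and> matches x \<and> (AE t in lebesgue. w t = K * U (phase t - x))"
      using K(1) matches_all_if_sum_0[OF assms] by blast
  qed
qed

lemma om_if_sum_0:
  assumes "p + q = 0"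
  shows "om = 2 * pi / (LINT t:{0..2 * pi}|lborel. \<gamma> t powr p)"
proof -
  have "ss = 1" using M_gt_1 by (simp add: ss_def assms)
  have "al = arctan (1 / ss)" by (rule al_def)
  also have "\<dots> = pi / 4" by (simp add: \<open>ss = 1\<close> arctan_one)
  finally have al: "al = pi / 4" .
  have e: "(p - q) / 2 = p" using assms by simp
  have "k = (\<lambda>t. \<gamma> t powr p)" unfolding k_def[abs_def] e by (rule refl)
  then show ?thesis by (simp add: om_def period_def al)
qed

lemma phase_if_sum_0:
  assumes "p + q = 0"
  shows "phase x = om * ((LINT t:{0..x}|lborel. \<gamma> t powr p) - (LINT t:{x..0}|lborel. \<gamma> t powr p))"
proof -
  have e: "(p - q) / 2 = p" using assms by simp
  have "k = (\<lambda>t. \<gamma> t powr p)" unfolding k_def[abs_def] e by (rule refl)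
  then show ?thesis by (simp add: phase_def)
qed

end

text \<open>An arbitrary representative \<open>g\<close> of the class of \<open>\<gamma>\<close>: everything in the statement depends on the class only.\<close>
locale coefficient_representative = coefficient +
  fixes g :: "real \<Rightarrow> real"
  assumes g_eq: "AE t in lebesgue. g t = \<gamma> t"
begin

lemma powr_AE: "AE t in lebesgue. g t powr r = \<gamma> t powr r"
  using g_eq by eventually_elim simp

lemma LINT_powr_eq:
  assumes [measurable]: "W \<in> borel_measurable borel" and w: "AE t in lebesgue. w t = W t"
  shows "(LINT t:{0..2 * pi}|lebesgue. g t powr r * w t) = (LINT t:{0..2 * pi}|lebesgue. \<gamma> t powr r * w t)"
proof -
  have [measurable]: "(\<lambda>t. \<gamma> t powr r * W t) \<in> borel_measurable borel" by measurable
  have "(LINT t:{0..2 * pi}|lebesgue. g t powr r * w t) = (LINT t:{0..2 * pi}|lborel. \<gamma> t powr r * W t)"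
  proof (rule LINT_lebesgue_AE(1))
    show "AE t in lebesgue. g t powr r * w t = \<gamma> t powr r * W t" using powr_AE[of r] w by eventually_elim simp
  qed measurable
  also have "\<dots> = (LINT t:{0..2 * pi}|lebesgue. \<gamma> t powr r * w t)"
  proof (rule LINT_lebesgue_AE(1)[symmetric])
    show "AE t in lebesgue. \<gamma> t powr r * w t = \<gamma> t powr r * W t" using w by eventually_elim simp
  qed measurable
  finally show ?thesis .
qed

lemma H1_integrals:
  assumes "w \<in> H1_loc"
  shows "(LINT t:{0..2 * pi}|lebesgue. g t powr p * w t) = (LINT t:{0..2 * pi}|lebesgue. \<gamma> t powr p * w t)"
    "(LINT t:{0..2 * pi}|lebesgue. g t powr p * (w t)\<^sup>2) = (LINT t:{0..2 * pi}|lebesgue. \<gamma> t powr p * (w t)\<^sup>2)"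
    "(LINT t:{0..2 * pi}|lebesgue. g t powr q * (weak_deriv w t)\<^sup>2) = (LINT t:{0..2 * pi}|lebesgue. \<gamma> t powr q * (weak_deriv w t)\<^sup>2)"
proof -
  obtain W G where WG: "sobolev_pair W G" and w: "AE t in lebesgue. w t = W t"
    using assms unfolding H1_loc_iff_sobolev_pair by blast
  note [measurable] = sobolev_pairD(2,5)[OF WG]
  show "(LINT t:{0..2 * pi}|lebesgue. g t powr p * w t) = (LINT t:{0..2 * pi}|lebesgue. \<gamma> t powr p * w t)"
    by (rule LINT_powr_eq[OF _ w]) measurable
  have "AE t in lebesgue. (w t)\<^sup>2 = (W t)\<^sup>2" using w by eventually_elim simp
  then show "(LINT t:{0..2 * pi}|lebesgue. g t powr p * (w t)\<^sup>2) = (LINT t:{0..2 * pi}|lebesgue. \<gamma> t powr p * (w t)\<^sup>2)"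
    by (rule LINT_powr_eq[rotated]) measurable
  have "AE t in lebesgue. (weak_deriv w t)\<^sup>2 = (G t)\<^sup>2" using weak_deriv_sobolev_pair[OF WG w] by eventually_elim simp
  then show "(LINT t:{0..2 * pi}|lebesgue. g t powr q * (weak_deriv w t)\<^sup>2) = (LINT t:{0..2 * pi}|lebesgue. \<gamma> t powr q * (weak_deriv w t)\<^sup>2)"
    by (rule LINT_powr_eq[rotated]) measurable
qed

lemma admissible_eq: "admissible (\<lambda>t. g t powr p) = admissible (\<lambda>t. \<gamma> t powr p)"
  unfolding admissible_def using H1_integrals(1) by (intro Collect_cong) auto

lemma admissible_H1: "w \<in> admissible a \<Longrightarrow> w \<in> H1_loc" by (simp add: admissible_def)

lemma wirtinger_const_eq: "wirtinger_const (\<lambda>t. g t powr p) (\<lambda>t. g t powr q) = best"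
  unfolding wirtinger_const_def admissible_eq
  by (intro arg_cong[where f = Inf] Collect_cong conj_cong ball_cong refl)
    (simp add: H1_integrals(2,3)[OF admissible_H1])

lemma extremal_eq: "extremal (\<lambda>t. g t powr p) (\<lambda>t. g t powr q) w \<longleftrightarrow> extremal (\<lambda>t. \<gamma> t powr p) (\<lambda>t. \<gamma> t powr q) w"
  unfolding extremal_def wirtinger_const_eq admissible_eq
  using H1_integrals(2,3)[OF admissible_H1, of w "\<lambda>t. \<gamma> t powr p"] by auto

lemma LINT_g_powr: "(LINT t:{0..2 * pi}|lebesgue. g t powr r) = (LINT t:{0..2 * pi}|lborel. \<gamma> t powr r)"
  by (rule LINT_lebesgue_AE(1)[OF _ powr_AE]) measurable

lemma wirtinger_bound_g: "wirtinger_bound M p q g = bound"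
proof -
  have "wirtinger_bound M p q g = wirtinger_bound M p q \<gamma>"
    unfolding wirtinger_bound_def LINT_g_powr by (simp add: set_integrable_lebesgue_borel(2))
  then show ?thesis by (simp add: wirtinger_bound_eq)
qed

lemma bar_g: "(AE t in lebesgue. g t = gamma_bar M p q (t + \<phi>)) \<longleftrightarrow> (AE t in lebesgue. \<gamma> t = gamma_bar M p q (t + \<phi>))"
proof
  assume "AE t in lebesgue. g t = gamma_bar M p q (t + \<phi>)"
  with g_eq show "AE t in lebesgue. \<gamma> t = gamma_bar M p q (t + \<phi>)" by eventually_elim simp
next
  assume "AE t in lebesgue. \<gamma> t = gamma_bar M p q (t + \<phi>)"
  with g_eq show "AE t in lebesgue. g t = gamma_bar M p q (t + \<phi>)" by eventually_elim simp
qed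

lemma phase_g:
  assumes "p + q = 0"
  shows "2 * pi / (LINT t:{0..2 * pi}|lebesgue. g t powr p) * (LINT t=ereal 0..ereal x|lebesgue. (g t powr p)) = phase x"
  unfolding LINT_g_powr om_if_sum_0[OF assms, symmetric] phase_if_sum_0[OF assms]
  by (subst interval_lebesgue_LINT[OF _ powr_AE]) auto

end

text \<open>Take a Borel representative, make it periodic and truncate it at 1 and \<open>M\<close>.\<close>
lemma coeff_class_representative:
  assumes "1 < M" "g \<in> coeff_class M" "0 \<le> p + q"
  shows "\<exists>\<gamma>. coefficient_representative M p q \<gamma> g"
proof -
  have g: "g \<in> borel_measurable lebesgue" "ae_periodic g" "essinf lebesgue (\<lambda>x. ereal (g x)) = 1"
    "esssup lebesgue (\<lambda>x. ereal (g x)) = ereal M" using assms(2) by (auto simp: coeff_class_def)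
  have "esssup lebesgue (\<lambda>x. - ereal (g x)) = - 1" using g(3) unfolding essinf_def by (metis ereal_uminus_uminus)
  then have low: "AE t in lebesgue. 1 \<le> g t"
    using esssup_AE[of "\<lambda>x. - ereal (g x)" lebesgue] by (auto simp: one_ereal_def elim!: eventually_mono)
  have up: "AE t in lebesgue. g t \<le> M"
    using esssup_AE[of "\<lambda>x. ereal (g x)" lebesgue] g(4) by simp
  obtain h where h: "h \<in> borel_measurable lborel" "AE t in lborel. g t = h t"
    using completion_ex_borel_measurable_real[OF g(1)] by auto
  have gh: "AE t in lebesgue. g t = h t" using h(2) by (rule AE_completion)
  have "AE t in lebesgue. h (t + 2 * pi) = h t"
    using ae_periodic_cong[OF gh] g(2) by (simp add: ae_periodic_def)
  then have "AE t in lborel. h (t + 2 * pi) = h t" unfolding AE_completion_iff .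
  then obtain h0 where h0: "h0 \<in> borel_measurable borel" "\<And>t. h0 (t + 2 * pi) = h0 t" "AE t in lborel. h t = h0 t"
    using periodic_representative[of "2 * pi" h] h(1) by auto
  define \<gamma> where "\<gamma> t = max 1 (min M (h0 t))" for t
  have "coefficient M p q \<gamma>"
  proof
    show "\<gamma> \<in> borel_measurable borel" unfolding \<gamma>_def using h0(1) by measurable
    show "1 \<le> \<gamma> t" "\<gamma> t \<le> M" "\<gamma> (t + 2 * pi) = \<gamma> t" for t using assms(1) h0(2) by (auto simp: \<gamma>_def)
  qed (use assms in auto)
  moreover have "AE t in lebesgue. g t = \<gamma> t"
    using low up gh AE_completion[OF h0(3)] by eventually_elim (auto simp: \<gamma>_def)
  ultimately have "coefficient_representative M p q \<gamma> g" by (simp add: coefficient_representative_def coefficient_representative_axioms_def)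
  then show ?thesis by blast
qed

lemma coefficient_gamma_bar:
  assumes "1 < M" "0 \<le> p + q"
  shows "coefficient M p q (\<lambda>t. gamma_bar M p q (t + \<phi>))"
proof
  show "(\<lambda>t. gamma_bar M p q (t + \<phi>)) \<in> borel_measurable borel"
    unfolding gamma_bar_def Let_def rmod_def by measurable
  have "(x + 2 * pi) rmod (2 * pi) = x rmod (2 * pi)" for x
    by (simp add: rmod_def add_divide_distrib algebra_simps)
  then have "gamma_bar M p q (x + 2 * pi) = gamma_bar M p q x" for x unfolding gamma_bar_def by (simp only:)
  moreover have "t + 2 * pi + \<phi> = (t + \<phi>) + 2 * pi" for t by simp
  ultimately show "gamma_bar M p q (t + 2 * pi + \<phi>) = gamma_bar M p q (t + \<phi>)" for t
    by (simp only:)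
  show "1 \<le> gamma_bar M p q (t + \<phi>)" "gamma_bar M p q (t + \<phi>) \<le> M" for t
    using assms(1) by (auto simp: gamma_bar_def Let_def)
qed (use assms in auto)

theorem theorem1:
  fixes M p q :: real and \<gamma> :: "real \<Rightarrow> real"
  assumes "M > 1" and "\<gamma> \<in> coeff_class M" and "p + q \<ge> 0"
  shows "wirtinger_const (\<lambda>t. \<gamma> t powr p) (\<lambda>t. \<gamma> t powr q) \<le> wirtinger_bound M p q \<gamma> \<and>
    (p + q > 0 \<longrightarrow>
       (wirtinger_const (\<lambda>t. \<gamma> t powr p) (\<lambda>t. \<gamma> t powr q) = wirtinger_bound M p q \<gamma>
          \<longleftrightarrow> (\<exists>\<phi>. AE \<theta> in lebesgue. \<gamma> \<theta> = gamma_bar M p q (\<theta> + \<phi>))) \<and>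
       (\<forall>\<phi> w. extremal (\<lambda>\<theta>. gamma_bar M p q (\<theta> + \<phi>) powr p)
                       (\<lambda>\<theta>. gamma_bar M p q (\<theta> + \<phi>) powr q) w
          \<longleftrightarrow> (\<exists>K. K \<noteq> 0 \<and> (AE \<theta> in lebesgue. w \<theta> = K * w_bar M p q (\<theta> + \<phi>))))) \<and>
    (p + q = 0 \<longrightarrow>
       wirtinger_const (\<lambda>t. \<gamma> t powr p) (\<lambda>t. \<gamma> t powr q) = wirtinger_bound M p q \<gamma> \<and>
       (\<forall>w. extremal (\<lambda>\<theta>. \<gamma> \<theta> powr p) (\<lambda>\<theta>. \<gamma> \<theta> powr (- p)) w
          \<longleftrightarrow> (\<exists>K \<phi>. K \<noteq> 0 \<and> (AE \<theta> in lebesgue. w \<theta> = K *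
                 cos (2 * pi / (LINT t:{0..2*pi}|lebesgue. \<gamma> t powr p)
                        * (LINT t=ereal 0..ereal \<theta>|lebesgue. (\<gamma> t powr p)) + \<phi>)))))"
proof -
  obtain \<gamma>' where rep: "coefficient_representative M p q \<gamma>' \<gamma>" using coeff_class_representative[OF assms] by blast
  interpret coefficient_representative M p q \<gamma>' \<gamma> by (rule rep)
  show ?thesis
  proof (intro conjI impI allI)
    show "wirtinger_const (\<lambda>t. \<gamma> t powr p) (\<lambda>t. \<gamma> t powr q) \<le> wirtinger_bound M p q \<gamma>"
      unfolding wirtinger_const_eq wirtinger_bound_g by (rule best_le_bound)
  next
    assume "0 < p + q"
    then show "wirtinger_const (\<lambda>t. \<gamma> t powr p) (\<lambda>t. \<gamma> t powr q) = wirtinger_bound M p q \<gamma>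
        \<longleftrightarrow> (\<exists>\<phi>. AE \<theta> in lebesgue. \<gamma> \<theta> = gamma_bar M p q (\<theta> + \<phi>))"
      unfolding wirtinger_const_eq wirtinger_bound_g bar_g by (rule best_eq_iff_bar)
  next
    fix \<phi> w assume "0 < p + q"
    then show "extremal (\<lambda>\<theta>. gamma_bar M p q (\<theta> + \<phi>) powr p) (\<lambda>\<theta>. gamma_bar M p q (\<theta> + \<phi>) powr q) w
        \<longleftrightarrow> (\<exists>K. K \<noteq> 0 \<and> (AE \<theta> in lebesgue. w \<theta> = K * w_bar M p q (\<theta> + \<phi>)))"
      by (intro coefficient.extremal_iff_bar[OF coefficient_gamma_bar[OF assms(1,3)]]) auto
  next
    assume "p + q = 0"
    from best_eq_bound_if_matches[OF matches_all_if_sum_0[OF this]]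
    show "wirtinger_const (\<lambda>t. \<gamma> t powr p) (\<lambda>t. \<gamma> t powr q) = wirtinger_bound M p q \<gamma>"
      unfolding wirtinger_const_eq wirtinger_bound_g .
  next
    fix w assume pq: "p + q = 0"
    then have "- p = q" by simp
    then have "extremal (\<lambda>\<theta>. \<gamma> \<theta> powr p) (\<lambda>\<theta>. \<gamma> \<theta> powr (- p)) w \<longleftrightarrow> extremal (\<lambda>\<theta>. \<gamma>' \<theta> powr p) (\<lambda>\<theta>. \<gamma>' \<theta> powr q) w"
      using extremal_eq by simp
    then show "extremal (\<lambda>\<theta>. \<gamma> \<theta> powr p) (\<lambda>\<theta>. \<gamma> \<theta> powr (- p)) w
          \<longleftrightarrow> (\<exists>K \<phi>. K \<noteq> 0 \<and> (AE \<theta> in lebesgue. w \<theta> = K *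
                 cos (2 * pi / (LINT t:{0..2*pi}|lebesgue. \<gamma> t powr p)
                        * (LINT t=ereal 0..ereal \<theta>|lebesgue. (\<gamma> t powr p)) + \<phi>)))"
      unfolding phase_g[OF pq] extremal_iff_cos[OF pq] .
  qed
qed

end
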